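(* Let $N>2$ be an integer with $N\not\equiv0\pmod3$, let $K_N$ be the Koch $N$-surface, $s_N=\log(N^2+2)/\log N$, and let $a_n$ be the sequence defined below for $K_N$. Then for every $n\in\mathbb N$, $$a_n\ \ge\ \mathcal H^{s_N}(K_N)\ \ge\ a_n\exp\!\left(-\frac{\sqrt6\,s_N}{N^{\,n-3}}\right).$$
   Context: Let $T\subset\mathbb{R}^3$ be the closed equilateral triangle of side $1$ in the plane $z=0$ with centroid at the origin. $T_N$ is the subdivision of $T$ into $N^2$ closed equilateral triangles of side $1/N$ by lines parallel to the sides of $T$; since $N\not\equiv0\pmod 3$, the origin lies in the interior of exactly one triangle $T_{\rm mid}\in T_N$. Let $\Delta$ be the regular tetrahedron with base $T_{\rm mid}$ and apex in $\{z>0\}$. $K_N$ is the unique nonempty compact set with $K_N=\bigcup_{i=1}^{N^2+2}F_{i}(K_N)$, where $F_1,\dots,F_{N^2+2}$ are similitudes of ratio $1/N$ mapping $T$ onto each triangle of $T_N$ other than $T_{\rm mid}$ (sending the side $\{z>0\}$ of $T$ to the side $\{z>0\}$) and onto each of the three faces of $\Delta$ other than $T_{\rm mid}$ (sending the side $\{z>0\}$ of $T$ to the outward side of $\Delta$). The $n$-cells are $F_{\omega_n}\circ\cdots\circ F_{\omega_1}(K_N)$, $\omega\in\{1,\dots,N^2+2\}^n$, $K_N^n$ is the set of $n$-cells, $\mu$ is the natural self-similar probability measure (each $n$-cell has measure $(N^2+2)^{-n}$), $|\cdot|$ is diameter, and $$a_n:=\min_{1\le k\le (N^2+2)^n}\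 \min_{\{\Delta_i^{(n)}\}_{i=1}^k\subseteq K_N^n}\frac{|\bigcup_{i=1}^k\Delta_i^{(n)}|^{s_N}}{\mu(\bigcup_{i=1}^k\Delta_i^{(n)})},$$ the inner minimum over all sets of $k$ distinct $n$-cells. *)

theory Defs
  imports "HOL-Probability.Probability"
begin

type_synonym pt = "real^3"

definition hausdorff_content :: "real \<Rightarrow> real \<Rightarrow> 'a::metric_space set \<Rightarrow> ennreal" where
  "hausdorff_content s \<delta> A =
     (INF U \<in> {U :: nat \<Rightarrow> 'a set. A \<subseteq> (\<Union>i. U i) \<and> (\<forall>i. bounded (U i) \<and> diameter (U i) \<le> \<delta>)}.
        (\<Sum>i. ennreal (diameter (U i) powr s)))"

definition hausdorff_measure :: "real \<Rightarrow> 'a::metric_space set \<Rightarrow> ennreal" where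
  "hausdorff_measure s A = (SUP \<delta> \<in> {0<..}. hausdorff_content s \<delta> A)"

text \<open>Unit equilateral triangle T in the plane z = 0 with centroid at the origin.\<close>
definition kv1 :: pt where "kv1 = vector [1 / sqrt 3, 0, 0]"
definition kv2 :: pt where "kv2 = vector [- 1 / (2 * sqrt 3), 1/2, 0]"
definition kv3 :: pt where "kv3 = vector [- 1 / (2 * sqrt 3), - 1/2, 0]"

definition baseT :: "pt set" where "baseT = convex hull {kv1, kv2, kv3}"

definition gridP :: "nat \<Rightarrow> nat \<Rightarrow> nat \<Rightarrow> pt" where
  "gridP N i j = kv1 + (real i / real N) *\<^sub>R (kv2 - kv1) + (real j / real N) *\<^sub>R (kv3 - kv1)"

text \<open>Vertex sets of the N^2 small triangles of T_N (upward and downward ones).\<close>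
definition subtris :: "nat \<Rightarrow> pt set set" where
  "subtris N =
     {{gridP N i j, gridP N (i+1) j, gridP N i (j+1)} | i j. i + j < N} \<union>
     {{gridP N (i+1) j, gridP N i (j+1), gridP N (i+1) (j+1)} | i j. i + j + 2 \<le> N}"

definition midtri :: "nat \<Rightarrow> pt set" where
  "midtri N = (THE V. V \<in> subtris N \<and> 0 \<in> rel_interior (convex hull V))"

text \<open>Apex of the regular tetrahedron with base T_mid (side 1/N), above the plane z = 0.\<close>
definition apex :: "nat \<Rightarrow> pt" where
  "apex N = (1/3) *\<^sub>R (\<Sum>(midtri N)) + vector [0, 0, sqrt (2/3) / real N]"

definition tetra :: "nat \<Rightarrow> pt set" where
  "tetra N = convex hull (insert (apex N) (midtri N))"

definition upper :: "pt set" where "upper = {x. x $ 3 > 0}"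

definition planar_targets :: "nat \<Rightarrow> pt set set" where
  "planar_targets N = (\<lambda>V. convex hull V) ` (subtris N - {midtri N})"

definition face_targets :: "nat \<Rightarrow> pt set set" where
  "face_targets N = (\<lambda>p. convex hull (insert (apex N) (midtri N - {p}))) ` midtri N"

text \<open>Admissible IFS: similitudes of ratio 1/N, indexed by 1..N^2+2, mapping T bijectively
  onto the targets, with the prescribed orientation (upper side of T goes to the upper side for
  planar triangles, and to the outward side of the tetrahedron, i.e. the open half-space bounded
  by the face that is disjoint from the tetrahedron, for lateral faces).\<close>
definition koch_ifs :: "nat \<Rightarrow> (nat \<Rightarrow> pt \<Rightarrow> pt) \<Rightarrow> bool" where
  "koch_ifs N F \<longleftrightarrow>
     (\<forall>i \<in> {1..N^2+2}. \<forall>x y. dist (F i x) (F i y) = dist x y / real N) \<and>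
     bij_betw (\<lambda>i. F i ` baseT) {1..N^2+2} (planar_targets N \<union> face_targets N) \<and>
     (\<forall>i \<in> {1..N^2+2}. F i ` baseT \<in> planar_targets N \<longrightarrow> F i ` upper = upper) \<and>
     (\<forall>i \<in> {1..N^2+2}. F i ` baseT \<in> face_targets N \<longrightarrow> F i ` upper \<inter> tetra N = {})"

definition kcell :: "(nat \<Rightarrow> pt \<Rightarrow> pt) \<Rightarrow> pt set \<Rightarrow> nat list \<Rightarrow> pt set" where
  "kcell F K w = fold (\<lambda>i A. F i ` A) w K"

definition kcells :: "nat \<Rightarrow> (nat \<Rightarrow> pt \<Rightarrow> pt) \<Rightarrow> pt set \<Rightarrow> nat \<Rightarrow> pt set set" where
  "kcells N F K n = {kcell F K w | w. length w = n \<and> set w \<subseteq> {1..N^2+2}}"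

definition koch_a :: "nat \<Rightarrow> (nat \<Rightarrow> pt \<Rightarrow> pt) \<Rightarrow> pt set \<Rightarrow> pt measure \<Rightarrow> real \<Rightarrow> nat \<Rightarrow> real" where
  "koch_a N F K \<mu> s n =
     Min {diameter (\<Union>C) powr s / measure \<mu> (\<Union>C) | C. C \<subseteq> kcells N F K n \<and> C \<noteq> {}}"

end

theory Submission
  imports Defs
begin

text \<open>
  Every cell is an image of \<open>K\<close> under a composition of standard maps: \<open>K\<close> has the symmetries of the
  triangle, so the choice of the similitudes within the given targets does not matter.

  Upper bound: if \<open>C\<close> is a set of \<open>n\<close>-cells, cover \<open>\<Union>C\<close> by itself and each remaining \<open>n\<close>-cell by a
  scaled copy of a covering of \<open>K\<close>, and iterate.

  Lower bound: it suffices that \<open>a * exp (- \<dots>) * \<mu> X \<le> diameter X powr s\<close> for compact \<open>X \<subseteq> K\<close>. If the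
  diameter of \<open>X\<close> is at least \<open>sqrt (2/3) / N ^ 3\<close>, the union of the \<open>n\<close>-cells meeting \<open>X\<close> has
  diameter at most \<open>2 / N ^ n\<close> larger, which costs the exponential factor. If it is smaller, then
  \<open>X\<close> lies in one 1-cell, near one vertex, or near a common edge of two 1-cells; in each case a
  homothety of ratio \<open>N\<close> moves the small cells containing \<open>X\<close> to cells of the next larger size, so
  that \<open>X\<close> can be replaced by a subset of \<open>K\<close> of \<open>N\<close> times the diameter and at least \<open>N\<^sup>2 + 2\<close> times
  the measure. Finitely many steps reach the first case.
\<close>

section \<open>Coordinates and similitudes\<close>

text \<open>The threshold \<open>sqrt (2/3) / N ^ 3\<close> comes from a Lipschitz constant. With
  the 1-cells rescaled to unit size, the linear functionals that separate two adjacent cells have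
  constant at most \<open>sqrt (3/2)\<close>, so a set below the threshold that meets both cells
  stays within \<open>1 / N ^ 2\<close> of the common edge, the width of a row after two
  subdivisions. The exponent inherits \<open>2 / sqrt (2/3) = sqrt 6\<close>. The obstacle is the
  fold: two 1-cells sharing an edge need not be coplanar. But their placements can be chosen to
  agree on the line of the edge, so a homothety centred on that line acts in the same way in the
  coordinates of either cell, and the fold disappears from the argument. Bumps that overhang an edge
  threaten this. They are controlled by a pyramid that contains \<open>K\<close> and whose apex, for
  N = 4, is the apex of the tetrahedron itself. The hypotheses exclude N = 3, and at N = 4 several
  estimates are sharp.\<close>

definition kv :: "3 \<Rightarrow> pt" where
  "kv i = (if i = 1 then kv1 else if i = 2 then kv2 else kv3)"

text \<open>Barycentric coordinates of the vertical projection, and the height measured in units of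
  \<open>sqrt (2/3)\<close>, the height of the regular tetrahedron of side 1.\<close>

definition bc :: "pt \<Rightarrow> 3 \<Rightarrow> real" where "bc x i = 1/3 + 2 * (x \<bullet> kv i)"

definition ht :: "pt \<Rightarrow> real" where "ht x = sqrt (3/2) * x $ 3"

text \<open>Inverse of the coordinates, provided that \<open>p\<close> has sum 1. The maps below are
  defined through \<open>mk\<close>, so their coordinates are known once that sum is
  checked.\<close>

definition mk :: "(3 \<Rightarrow> real) \<Rightarrow> real \<Rightarrow> pt" where
  "mk p h = (\<Sum>i\<in>UNIV. p i *\<^sub>R kv i) + vector [0, 0, sqrt (2/3) * h]"

lemma kv_inner: "kv i \<bullet> kv j = (if i = j then 1/3 else -1/6)"
proof -
  have "(sqrt 3 * sqrt 3 :: real) = 3" by simp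
  then show ?thesis
    using exhaust_3[of i] exhaust_3[of j]
    by (auto simp: kv_def kv1_def kv2_def kv3_def inner_vec_def sum_3 field_simps)
qed

lemma bc_eq:
  "bc x 1 = 1/3 + 2 / sqrt 3 * x $ 1"
  "bc x 2 = 1/3 - 1 / sqrt 3 * x $ 1 + x $ 2"
  "bc x 3 = 1/3 - 1 / sqrt 3 * x $ 1 - x $ 2"
  by (simp_all add: bc_def kv_def kv1_def kv2_def kv3_def inner_vec_def sum_3 algebra_simps)

lemma sum_bc [simp]: "(\<Sum>i\<in>UNIV. bc x i) = 1"
  by (simp add: sum_3 bc_eq algebra_simps)

lemma pt_eqI:
  assumes "\<And>i. bc x i = bc y i" "ht x = ht y"
  shows "x = y"
proof -
  have "x $ 1 = y $ 1" "x $ 3 = y $ 3"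
    using assms(1)[of 1] assms(2) by (simp_all add: bc_eq ht_def)
  moreover have "x $ 2 = y $ 2"
    using assms(1)[of 2] \<open>x $ 1 = y $ 1\<close> by (simp add: bc_eq)
  ultimately show ?thesis
    by (simp add: vec_eq_iff forall_3)
qed

lemma bc_mk:
  assumes "(\<Sum>i\<in>UNIV. p i) = 1"
  shows "bc (mk p h) i = p i"
proof -
  have "vector [0, 0, sqrt (2/3) * h] \<bullet> kv i = 0"
    by (simp add: kv_def kv1_def kv2_def kv3_def inner_vec_def sum_3)
  then have "mk p h \<bullet> kv i = (\<Sum>j\<in>UNIV. p j * (if j = i then 1/3 else -1/6))"
    by (simp add: mk_def inner_add_left inner_sum_left kv_inner)
  then show ?thesis
    using assms exhaust_3[of i] unfolding bc_def
    by (auto simp: sum_3 field_simps)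
qed

lemma ht_mk [simp]: "ht (mk p h) = h"
proof -
  have "mk p h $ 3 = sqrt (2/3) * h"
    by (simp add: mk_def sum_3 kv_def kv1_def kv2_def kv3_def)
  moreover have "sqrt (3/2) * sqrt (2/3) = (1::real)"
    by (simp flip: real_sqrt_mult)
  ultimately show ?thesis
    by (simp add: ht_def mult.assoc[symmetric])
qed

text \<open>The three vectors \<open>kv i\<close> form a tight frame of the horizontal plane, which
  makes the form diagonal; the factor 2/3 undoes the scaling of the height.\<close>

lemma dist_sq: "(dist x y)\<^sup>2 = (\<Sum>i\<in>UNIV. (bc x i - bc y i)\<^sup>2) / 2 + 2/3 * (ht x - ht y)\<^sup>2"
proof -
  define a b c where "a = x $ 1 - y $ 1" and "b = x $ 2 - y $ 2" and "c = x $ 3 - y $ 3"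
  have 1: "(dist x y)\<^sup>2 = a\<^sup>2 + b\<^sup>2 + c\<^sup>2"
    by (simp add: dist_norm norm_vec_def L2_set_def sum_3 a_def b_def c_def)
  have "bc x 1 - bc y 1 = 2 / sqrt 3 * a" "bc x 2 - bc y 2 = - 1 / sqrt 3 * a + b"
    "bc x 3 - bc y 3 = - 1 / sqrt 3 * a - b" "ht x - ht y = sqrt (3/2) * c"
    by (simp_all add: bc_eq ht_def a_def b_def c_def algebra_simps diff_divide_distrib)
  then have "(\<Sum>i\<in>UNIV. (bc x i - bc y i)\<^sup>2) / 2 + 2/3 * (ht x - ht y)\<^sup>2
    = (2 / sqrt 3 * a)\<^sup>2 / 2 + (- 1 / sqrt 3 * a + b)\<^sup>2 / 2 + (- 1 / sqrt 3 * a - b)\<^sup>2 / 2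
      + 2/3 * (sqrt (3/2) * c)\<^sup>2"
    by (simp add: sum_3 add_divide_distrib)
  also have "\<dots> = a\<^sup>2 + b\<^sup>2 + c\<^sup>2"
  proof -
    have s: "(1 / sqrt 3)\<^sup>2 = (1/3::real)" "(sqrt (3/2))\<^sup>2 = (3/2::real)"
      by (simp_all add: power_divide)
    define t where "t = 1 / sqrt (3::real)"
    have "(2 * t * a)\<^sup>2 / 2 + (- t * a + b)\<^sup>2 / 2 + (- t * a - b)\<^sup>2 / 2 = 3 * t\<^sup>2 * a\<^sup>2 + b\<^sup>2"
      by (simp add: power2_eq_square field_simps)
    then show ?thesis
      using s by (simp add: t_def power_mult_distrib)
  qed
  finally show ?thesis using 1 by simp
qed

lemma cont_bc: "continuous_on S (\<lambda>x. bc x i)"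
  unfolding bc_def by (intro continuous_intros)

lemma cont_ht: "continuous_on S ht"
  unfolding ht_def by (intro continuous_intros)

lemma triple_index:
  fixes i :: 3
  obtains j l where "i \<noteq> j" "i \<noteq> l" "j \<noteq> l" "UNIV = {i, j, l}"
proof -
  have "UNIV = {1, 2, 3 :: 3}" using exhaust_3 by auto
  then show thesis
    using exhaust_3[of i] that[of 2 3] that[of 1 3] that[of 1 2] by (auto simp: insert_commute)
qed

lemma sum_triple:
  assumes "UNIV = {i, j, l :: 3}" "i \<noteq> j" "i \<noteq> l" "j \<noteq> l"
  shows "sum f UNIV = f i + (f j + f l)"
  unfolding assms(1) using assms(2-) by simp

lemma triple_cases: "UNIV = {i, j, l :: 3} \<Longrightarrow> x = i \<or> x = j \<or> x = l"
  using UNIV_I[of x] by auto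

lemma triple_UNIV:
  fixes i j l :: 3
  assumes "i \<noteq> j" "i \<noteq> l" "j \<noteq> l"
  shows "UNIV = {i, j, l}"
proof -
  have "x = i \<or> x = j \<or> x = l" for x
    using assms exhaust_3[of i] exhaust_3[of j] exhaust_3[of l] exhaust_3[of x] by auto
  then show ?thesis by auto
qed

lemma pair_index:
  fixes i j :: 3
  assumes "i \<noteq> j"
  obtains l where "UNIV = {i, j, l}" "i \<noteq> l" "j \<noteq> l"
proof -
  have "\<exists>l. i \<noteq> l \<and> j \<noteq> l"
    using exhaust_3[of i] exhaust_3[of j] assms
      exI[of "\<lambda>l. i \<noteq> l \<and> j \<noteq> l" 1] exI[of "\<lambda>l. i \<noteq> l \<and> j \<noteq> l" 2] exI[of "\<lambda>l. i \<noteq> l \<and> j \<noteq> l" 3]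
    by auto
  then show thesis using that triple_UNIV[OF assms] by blast
qed

lemma bc_third:
  assumes "i \<noteq> j" "i \<noteq> l" "j \<noteq> l"
  shows "bc x l = 1 - bc x i - bc x j"
  using sum_bc[of x] sum_triple[OF triple_UNIV[OF assms] assms, of "bc x"] by simp

lemma dist_sq_triple:
  fixes x y :: pt
  assumes "UNIV = {i, j, l}" "i \<noteq> j" "i \<noteq> l" "j \<noteq> l"
  defines "u \<equiv> bc x i - bc y i" and "v \<equiv> bc x j - bc y j"
  shows "(dist x y)\<^sup>2 = u\<^sup>2 + u * v + v\<^sup>2 + 2/3 * (ht x - ht y)\<^sup>2"
proof -
  have "bc x l - bc y l = - (u + v)"
    using sum_bc[of x] sum_bc[of y] by (simp add: sum_triple[OF assms(1-4)] u_def v_def)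
  then have "(\<Sum>k\<in>UNIV. (bc x k - bc y k)\<^sup>2) = u\<^sup>2 + (v\<^sup>2 + (- (u + v))\<^sup>2)"
    by (simp only: sum_triple[OF assms(1-4)] u_def v_def)
  also have "\<dots> = 2 * (u\<^sup>2 + u * v + v\<^sup>2)"
    by (simp add: power2_eq_square algebra_simps)
  finally show ?thesis
    unfolding dist_sq by simp
qed

section \<open>Lipschitz bounds for coordinate functionals\<close>

lemma le_sqrt_dist:
  assumes "d\<^sup>2 \<le> B * (dist x y)\<^sup>2"
  shows "\<bar>d\<bar> \<le> sqrt B * dist x y"
proof -
  have "\<bar>d\<bar> = sqrt (d\<^sup>2)" by simp
  also have "\<dots> \<le> sqrt (B * (dist x y)\<^sup>2)" using assms by (intro real_sqrt_le_mono)
  finally show ?thesis by (simp add: real_sqrt_mult)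
qed

lemma bc_dist: "\<bar>bc x i - bc y i\<bar> \<le> sqrt (4/3) * dist x y"
proof (rule le_sqrt_dist)
  obtain j l where T: "UNIV = {i, j, l}" "i \<noteq> j" "i \<noteq> l" "j \<noteq> l" by (metis triple_index)
  have "0 \<le> (2 * (bc x j - bc y j) + (bc x i - bc y i))\<^sup>2 + 8/3 * (ht x - ht y)\<^sup>2" by simp
  then show "(bc x i - bc y i)\<^sup>2 \<le> 4/3 * (dist x y)\<^sup>2"
    unfolding dist_sq_triple[OF T] by (simp add: power2_eq_square algebra_simps)
qed

lemma ht_dist: "\<bar>ht x - ht y\<bar> \<le> sqrt (3/2) * dist x y"
proof (rule le_sqrt_dist)
  have "0 \<le> (\<Sum>i\<in>UNIV. (bc x i - bc y i)\<^sup>2)" by (intro sum_nonneg) auto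
  then show "(ht x - ht y)\<^sup>2 \<le> 3/2 * (dist x y)\<^sup>2" by (simp add: dist_sq)
qed

text \<open>The gradient of \<open>bc _ i\<close> is horizontal of square length 4/3, that of
  \<open>ht\<close> is vertical of square length 3/2. The sum therefore has square Lipschitz
  constant 4/3 + 3/2 * \<theta>^2, which reaches 3/2 exactly at |\<theta>| = 1/3.\<close>

lemma slanted_dist:
  assumes "\<bar>\<theta>\<bar> \<le> 1/3"
  shows "\<bar>(bc x i + \<theta> * ht x) - (bc y i + \<theta> * ht y)\<bar> \<le> sqrt (3/2) * dist x y"
proof (rule le_sqrt_dist)
  obtain j l where T: "UNIV = {i, j, l}" "i \<noteq> j" "i \<noteq> l" "j \<noteq> l" by (metis triple_index)
  define u v h where "u = bc x i - bc y i" and "v = bc x j - bc y j" and "h = ht x - ht y"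
  have "\<theta>\<^sup>2 \<le> (1/3)\<^sup>2" using assms by (metis abs_ge_zero power2_abs power_mono)
  then have t: "8 * \<theta>\<^sup>2 \<le> 1 - \<theta>\<^sup>2" by (simp add: power2_eq_square)
  have "(u + \<theta> * h)\<^sup>2 \<le> 9/8 * u\<^sup>2 + h\<^sup>2"
  proof -
    have "0 \<le> (u - 8 * \<theta> * h)\<^sup>2 / 8 + (1 - \<theta>\<^sup>2 - 8 * \<theta>\<^sup>2) * h\<^sup>2"
      using t by simp
    then show ?thesis by (simp add: power2_eq_square field_simps)
  qed
  moreover have "9/8 * u\<^sup>2 \<le> 3/2 * (u\<^sup>2 + u * v + v\<^sup>2)"
  proof -
    have "3/2 * (u\<^sup>2 + u * v + v\<^sup>2) = 9/8 * u\<^sup>2 + 3/8 * (2 * v + u)\<^sup>2"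
      by (simp add: power2_eq_square field_simps)
    then show ?thesis by simp
  qed
  moreover have "3/2 * (dist x y)\<^sup>2 = 3/2 * (u\<^sup>2 + u * v + v\<^sup>2) + h\<^sup>2"
    unfolding dist_sq_triple[OF T] by (simp add: u_def v_def h_def)
  ultimately have "(u + \<theta> * h)\<^sup>2 \<le> 3/2 * (dist x y)\<^sup>2"
    by linarith
  also have "u + \<theta> * h = (bc x i + \<theta> * ht x) - (bc y i + \<theta> * ht y)"
    by (simp add: u_def h_def algebra_simps)
  finally show "((bc x i + \<theta> * ht x) - (bc y i + \<theta> * ht y))\<^sup>2 \<le> 3/2 * (dist x y)\<^sup>2" .
qed

text \<open>The functional is arc length along the side \<open>bc x i = 0\<close>: its gradient is a
  unit vector parallel to that side.\<close>

lemma along_dist: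
  assumes "i \<noteq> j"
  shows "\<bar>(bc x j + bc x i / 2) - (bc y j + bc y i / 2)\<bar> \<le> dist x y"
proof -
  obtain l where T: "UNIV = {i, j, l}" "i \<noteq> j" "i \<noteq> l" "j \<noteq> l"
    using assms pair_index by blast
  define u v where "u = bc x i - bc y i" and "v = bc x j - bc y j"
  have "(v + u / 2)\<^sup>2 \<le> u\<^sup>2 + u * v + v\<^sup>2" by (simp add: power2_eq_square algebra_simps)
  also have "\<dots> \<le> 1 * (dist x y)\<^sup>2"
    unfolding dist_sq_triple[OF T] by (simp add: u_def v_def)
  also have "v + u / 2 = (bc x j + bc x i / 2) - (bc y j + bc y i / 2)"
    by (simp add: u_def v_def diff_divide_distrib)
  finally have "((bc x j + bc x i / 2) - (bc y j + bc y i / 2))\<^sup>2 \<le> 1 * (dist x y)\<^sup>2" .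
  from le_sqrt_dist[OF this] show ?thesis by simp
qed

definition hom :: "pt \<Rightarrow> real \<Rightarrow> pt \<Rightarrow> pt" where "hom y r x = y + r *\<^sub>R (x - y)"

lemma bc_hom: "bc (hom y r x) i = bc y i + r * (bc x i - bc y i)"
  by (simp add: bc_def hom_def inner_add_left inner_diff_left algebra_simps)

lemma ht_hom: "ht (hom y r x) = ht y + r * (ht x - ht y)"
  by (simp add: ht_def hom_def algebra_simps)

lemma dist_hom: "r \<ge> 0 \<Longrightarrow> dist (hom y r x) (hom y r x') = r * dist x x'"
proof -
  assume "r \<ge> 0"
  have "hom y r x - hom y r x' = r *\<^sub>R (x - x')" by (simp add: hom_def algebra_simps)
  with \<open>r \<ge> 0\<close> show ?thesis by (simp add: dist_norm)
qed

text \<open>A pyramid over the triangle that the standard maps send into itself.\<close>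

definition pyr :: "pt set" where "pyr = {x. 0 \<le> ht x \<and> (\<forall>i. 4/3 * ht x \<le> bc x i)}"

lemma pyrD: "x \<in> pyr \<Longrightarrow> 0 \<le> ht x" "x \<in> pyr \<Longrightarrow> 4/3 * ht x \<le> bc x i"
  by (auto simp: pyr_def)

lemma pyr_nonneg: "x \<in> pyr \<Longrightarrow> 0 \<le> bc x i"
  using pyrD(1)[of x] pyrD(2)[of x i] by simp

lemma pyr_pair:
  assumes "x \<in> pyr" "i \<noteq> j"
  shows "bc x i + bc x j \<le> 1 - 4/3 * ht x"
proof -
  obtain l where T: "UNIV = {i, j, l}" "i \<noteq> l" "j \<noteq> l"
    using assms(2) pair_index by blast
  then show ?thesis
    using pyrD(2)[OF assms(1), of l] bc_third[OF assms(2) T(2,3), of x] by simp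
qed

lemma pyr_upper:
  assumes "x \<in> pyr"
  shows "bc x i \<le> 1 - 8/3 * ht x"
proof -
  obtain j l where T: "UNIV = {i, j, l}" "i \<noteq> j" "i \<noteq> l" "j \<noteq> l" by (metis triple_index)
  then show ?thesis
    using pyrD(2)[OF assms, of j] pyr_pair[OF assms T(2)] by simp
qed

lemma pyr_ht: "x \<in> pyr \<Longrightarrow> ht x \<le> 1/4"
  using pyrD(2)[of x 1] pyr_upper[of x 1] by simp

lemma compact_pyr: "compact pyr"
proof -
  have "closed pyr"
    unfolding pyr_def
    by (intro closed_Collect_conj closed_Collect_all closed_Collect_le continuous_intros cont_bc cont_ht)
  moreover have "bounded pyr"
  proof -
    have "dist (mk (\<lambda>_. 1/3) 0) x \<le> 2" if "x \<in> pyr" for x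
    proof -
      have *: "bc (mk (\<lambda>_. 1/3) 0) i = 1/3" for i by (rule bc_mk) (simp add: sum_3)
      have "(1/3 - bc x i)\<^sup>2 \<le> 1" for i
        using pyr_nonneg[OF that, of i] pyr_upper[OF that, of i] pyrD(1)[OF that]
        by (simp add: abs_square_le_1 abs_le_iff)
      then have "(\<Sum>i\<in>UNIV. (1/3 - bc x i)\<^sup>2) \<le> of_nat (card (UNIV::3 set)) * 1"
        by (intro sum_bounded_above) auto
      moreover have "(ht x)\<^sup>2 \<le> 1"
        using pyrD(1)[OF that] pyr_ht[OF that] by (simp add: abs_square_le_1)
      ultimately have "(dist (mk (\<lambda>_. 1/3) 0) x)\<^sup>2 \<le> 2\<^sup>2"
        unfolding dist_sq * by simp
      then show ?thesis by (rule power2_le_imp_le) simp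
    qed
    then show ?thesis unfolding bounded_def by blast
  qed
  ultimately show ?thesis by (simp add: compact_eq_bounded_closed)
qed

text \<open>Subtracting 4/3 of the height from the coordinates leaves nonnegative numbers of sum
  \<open>1 - 4 * ht x\<close>, whose squares add up to at most the square of the sum. What remains
  is a quadratic in the two heights, at most 1 because they lie between 0 and 1/4.\<close>

lemma dist_pyr_le_1:
  assumes "x \<in> pyr" "y \<in> pyr"
  shows "dist x y \<le> 1"
proof -
  define h k where "h = ht x" and "k = ht y"
  have h: "0 \<le> h" "h \<le> 1/4" "0 \<le> k" "k \<le> 1/4"
    using pyrD(1) pyr_ht assms by (auto simp: h_def k_def)
  define a b where "a = (\<lambda>i. bc x i - 4/3 * h)" and "b = (\<lambda>i. bc y i - 4/3 * k)"
  have nn: "0 \<le> a i" "0 \<le> b i" for i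
    using pyrD(2) assms by (auto simp: a_def b_def h_def k_def)
  have sa: "sum a UNIV = 1 - 4 * h" and sb: "sum b UNIV = 1 - 4 * k"
    by (simp_all add: a_def b_def sum_subtractf)
  have sq: "(\<Sum>i\<in>UNIV. (f i)\<^sup>2) \<le> (sum f UNIV)\<^sup>2" if "\<And>i. 0 \<le> f i" for f :: "3 \<Rightarrow> real"
  proof -
    have "0 \<le> f 1 * f 2" "0 \<le> f 1 * f 3" "0 \<le> f 2 * f 3" using that by auto
    then show ?thesis by (simp add: sum_3 power2_eq_square algebra_simps)
  qed
  have "(\<Sum>i\<in>UNIV. (bc x i - bc y i)\<^sup>2) = (\<Sum>i\<in>UNIV. (a i - b i + 4/3 * (h - k))\<^sup>2)"
    by (intro sum.cong refl arg_cong[of _ _ "\<lambda>t. t\<^sup>2"]) (simp add: a_def b_def field_simps)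
  also have "\<dots> = (\<Sum>i\<in>UNIV. (a i)\<^sup>2) + (\<Sum>i\<in>UNIV. (b i)\<^sup>2) - 2 * (\<Sum>i\<in>UNIV. a i * b i)
      + 8/3 * (h - k) * (sum a UNIV - sum b UNIV) + 16/3 * (h - k)\<^sup>2"
    by (simp add: sum_3 power2_eq_square field_simps)
  also have "\<dots> \<le> (1 - 4 * h)\<^sup>2 + (1 - 4 * k)\<^sup>2 + 8/3 * (h - k) * (4 * k - 4 * h) + 16/3 * (h - k)\<^sup>2"
    using sq[of a, OF nn(1)] sq[of b, OF nn(2)] sum_nonneg[of UNIV "\<lambda>i. a i * b i"] nn
    by (simp add: sa sb)
  finally have "(dist x y)\<^sup>2 \<le> ((1 - 4 * h)\<^sup>2 + (1 - 4 * k)\<^sup>2 + 8/3 * (h - k) * (4 * k - 4 * h)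
      + 16/3 * (h - k)\<^sup>2) / 2 + 2/3 * (h - k)\<^sup>2"
    unfolding dist_sq h_def k_def by simp
  also have "\<dots> = 1 - 4 * h - 4 * k + 8 * h\<^sup>2 + 8 * k\<^sup>2 - 2 * (h - k)\<^sup>2"
    by (simp add: power2_eq_square field_simps)
  also have "\<dots> \<le> 1"
  proof -
    have "h * h \<le> 1/4 * h" "k * k \<le> 1/4 * k" using h by (intro mult_right_mono; simp)+
    then have "8 * h\<^sup>2 + 8 * k\<^sup>2 \<le> 4 * h + 4 * k" using h by (simp add: power2_eq_square)
    moreover have "0 \<le> (h - k)\<^sup>2" by simp
    ultimately show ?thesis using h by linarith
  qed
  finally show ?thesis by (simp add: abs_square_le_1)
qed

text \<open>The triangles of the subdivision into \<open>m\<^sup>2\<close> parts are indexed by the integer parts \<open>k\<close> of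
  \<open>m\<close> times the barycentric coordinates of their interior points; the sum of \<open>k\<close> is \<open>m - 1\<close> for the
  triangles homothetic to the large one and \<open>m - 2\<close> for the inverted ones.\<close>

definition box :: "int \<Rightarrow> (3 \<Rightarrow> int) \<Rightarrow> bool" where
  "box m k \<longleftrightarrow> sum k UNIV = m - 1 \<or> sum k UNIV = m - 2"

text \<open>For an inverted triangle the map contains a half turn about a vertical axis, so that the
  upper side stays the upper side. The values N, N * N and 1 of \<open>m\<close> all occur;
  \<open>m = 1\<close> gives the tiling of the whole plane by unit triangles, with indices of any
  sign.\<close>

definition pl :: "int \<Rightarrow> (3 \<Rightarrow> int) \<Rightarrow> pt \<Rightarrow> pt" where
  "pl m k x = mk (\<lambda>i. (if sum k UNIV = m - 1 then real_of_int (k i) + bc x i else real_of_int (k i) + 1 - bc x i) / m) (ht x / m)"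

lemma bc_pl:
  assumes "m > 0" "box m k"
  shows "bc (pl m k x) i = (if sum k UNIV = m - 1 then real_of_int (k i) + bc x i else real_of_int (k i) + 1 - bc x i) / m"
proof -
  have "(\<Sum>i\<in>UNIV. (if sum k UNIV = m - 1 then real_of_int (k i) + bc x i else real_of_int (k i) + 1 - bc x i)) = m"
    using assms(2) unfolding box_def
    by (auto simp: sum.distrib sum_subtractf simp flip: of_int_sum)
  then have "(\<Sum>i\<in>UNIV. (if sum k UNIV = m - 1 then real_of_int (k i) + bc x i else real_of_int (k i) + 1 - bc x i) / m) = 1"
    using assms(1) by (simp flip: sum_divide_distrib)
  then show ?thesis unfolding pl_def by (rule bc_mk)
qed

lemma ht_pl: "ht (pl m k x) = ht x / m"
  by (simp add: pl_def)

lemma dist_pl: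
  assumes "m > 0" "box m k"
  shows "dist (pl m k x) (pl m k y) = dist x y / m"
proof -
  have "(bc (pl m k x) i - bc (pl m k y) i)\<^sup>2 = (bc x i - bc y i)\<^sup>2 / (real_of_int m)\<^sup>2" for i
    unfolding bc_pl[OF assms]
    by (simp add: power_divide power2_commute flip: diff_divide_distrib)
  then have "(dist (pl m k x) (pl m k y))\<^sup>2 = (dist x y / m)\<^sup>2"
    by (simp add: dist_sq ht_pl power_divide add_divide_distrib
        flip: diff_divide_distrib sum_divide_distrib)
  then show ?thesis
    using assms(1) by (simp add: power2_eq_iff_nonneg)
qed

lemma pl_box:
  assumes "m > 0" "box m k" "x \<in> pyr"
  shows "k i + 4/3 * ht x \<le> m * bc (pl m k x) i" "m * bc (pl m k x) i \<le> k i + 1 - 4/3 * ht x"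
  using pyrD[OF assms(3)] pyr_upper[OF assms(3), of i] assms(1) bc_pl[OF assms(1,2), of x i]
  by (auto split: if_splits)

text \<open>Inside an inverted triangle the inner index counts from the opposite end of the strip,
  hence \<open>n * (k i + 1) - l i - 1\<close>; two inversions cancel.\<close>

lemma pl_comp:
  assumes "m > 0" "n > 0" "box m k" "box n l"
  defines "a \<equiv> \<lambda>i. if sum k UNIV = m - 1 then n * k i + l i else n * (k i + 1) - l i - 1"
  shows "box (m * n) a" "pl m k (pl n l x) = pl (m * n) a x"
proof -
  have sa: "sum a UNIV = (if sum k UNIV = m - 1 then n * sum k UNIV + sum l UNIV
    else n * (sum k UNIV + 3) - sum l UNIV - 3)"
    by (simp add: a_def sum_3 algebra_simps)
  show b: "box (m * n) a"
    using assms(3,4) unfolding box_def sa by (auto simp: algebra_simps)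
  have t: "sum a UNIV = m * n - 1 \<longleftrightarrow> (sum k UNIV = m - 1 \<longleftrightarrow> sum l UNIV = n - 1)"
    using assms(3,4) unfolding box_def sa by (auto simp: algebra_simps)
  show "pl m k (pl n l x) = pl (m * n) a x"
  proof (rule pt_eqI)
    show "bc (pl m k (pl n l x)) i = bc (pl (m * n) a x) i" for i
      using assms(1,2) b t
      by (simp add: bc_pl assms(3,4) a_def field_simps)
    show "ht (pl m k (pl n l x)) = ht (pl (m * n) a x)"
      by (simp add: ht_pl)
  qed
qed

text \<open>The similitude onto the lateral face opposite to vertex \<open>j\<close> of the tetrahedron over the whole triangle.\<close>

definition lt :: "3 \<Rightarrow> pt \<Rightarrow> pt" where
  "lt j x = mk (\<lambda>i. if i = j then bc x j / 3 - 8/9 * ht x else bc x i + bc x j / 3 + 4/9 * ht x)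
     (bc x j + ht x / 3)"

lemma bc_lt: "bc (lt j x) i =
  (if i = j then bc x j / 3 - 8/9 * ht x else bc x i + bc x j / 3 + 4/9 * ht x)"
  unfolding lt_def
proof (rule bc_mk)
  obtain i l where T: "UNIV = {j, i, l}" "j \<noteq> i" "j \<noteq> l" "i \<noteq> l" by (metis triple_index)
  show "(\<Sum>i\<in>UNIV. if i = j then bc x j / 3 - 8/9 * ht x else bc x i + bc x j / 3 + 4/9 * ht x) = 1"
    using T sum_bc[of x] by (simp add: sum_triple[OF T])
qed

lemma ht_lt: "ht (lt j x) = bc x j + ht x / 3"
  by (simp add: lt_def)

lemma dist_lt: "dist (lt j x) (lt j y) = dist x y"
proof -
  obtain i l where T: "UNIV = {j, i, l}" "j \<noteq> i" "j \<noteq> l" "i \<noteq> l" by (metis triple_index)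
  have "(dist (lt j x) (lt j y))\<^sup>2 = (dist x y)\<^sup>2"
    unfolding dist_sq_triple[OF T] bc_lt ht_lt using T
    by (simp add: power2_eq_square field_simps)
  then show ?thesis by (simp add: power2_eq_iff_nonneg)
qed

section \<open>Symmetries of the triangle and the standard maps\<close>

definition tau :: "(3 \<Rightarrow> 3) \<Rightarrow> pt \<Rightarrow> pt" where
  "tau \<pi> x = mk (\<lambda>i. bc x (\<pi> i)) (ht x)"

lemma sum_perm: "bij \<pi> \<Longrightarrow> (\<Sum>i\<in>UNIV. f (\<pi> i)) = (\<Sum>i\<in>UNIV. f i)"
  by (rule sum.reindex_bij_betw)

lemma bc_tau: "bij \<pi> \<Longrightarrow> bc (tau \<pi> x) i = bc x (\<pi> i)"
  unfolding tau_def by (rule bc_mk) (simp add: sum_perm)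

lemma ht_tau: "ht (tau \<pi> x) = ht x"
  by (simp add: tau_def)

lemma dist_tau: "bij \<pi> \<Longrightarrow> dist (tau \<pi> x) (tau \<pi> y) = dist x y"
proof -
  assume b: "bij \<pi>"
  have "(dist (tau \<pi> x) (tau \<pi> y))\<^sup>2 = (dist x y)\<^sup>2"
    unfolding dist_sq bc_tau[OF b] ht_tau sum_perm[OF b, of "\<lambda>i. (bc x i - bc y i)\<^sup>2"] ..
  then show ?thesis by (simp add: power2_eq_iff_nonneg)
qed

lemma tau_tau: "bij \<pi> \<Longrightarrow> bij \<rho> \<Longrightarrow> tau \<pi> (tau \<rho> x) = tau (\<rho> \<circ> \<pi>) x"
  by (rule pt_eqI) (simp_all add: bc_tau ht_tau bij_comp)

lemma tau_id: "tau id x = x"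
  by (rule pt_eqI) (simp_all add: bc_tau ht_tau)

lemma tau_inv: "bij \<pi> \<Longrightarrow> tau (inv \<pi>) (tau \<pi> x) = x" "bij \<pi> \<Longrightarrow> tau \<pi> (tau (inv \<pi>) x) = x"
  by (simp_all add: tau_tau bij_imp_bij_inv tau_id bij_is_inj bij_is_surj surj_iff[THEN iffD1] inv_o_cancel)

lemma tau_pyr: "bij \<pi> \<Longrightarrow> x \<in> pyr \<Longrightarrow> tau \<pi> x \<in> pyr"
  by (simp add: pyr_def bc_tau ht_tau)

datatype code = Pl "3 \<Rightarrow> int" | Lt 3

definition mid :: "int \<Rightarrow> 3 \<Rightarrow> int" where "mid N = (\<lambda>_. N div 3)"

fun gm :: "int \<Rightarrow> code \<Rightarrow> pt \<Rightarrow> pt" where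
  "gm N (Pl k) = pl N k"
| "gm N (Lt j) = (\<lambda>x. pl N (mid N) (lt j x))"

definition codes :: "int \<Rightarrow> code set" where
  "codes N = Pl ` {k. box N k \<and> (\<forall>i. 0 \<le> k i) \<and> k \<noteq> mid N} \<union> range Lt"

fun pcode :: "(3 \<Rightarrow> 3) \<Rightarrow> code \<Rightarrow> code" where
  "pcode \<pi> (Pl k) = Pl (k \<circ> \<pi>)"
| "pcode \<pi> (Lt j) = Lt (inv \<pi> j)"

lemma box_mid: "\<not> 3 dvd N \<Longrightarrow> box N (mid N)"
  by (simp add: box_def mid_def sum_3) presburger

lemma pcode_codes:
  assumes "bij \<pi>" "c \<in> codes N"
  shows "pcode \<pi> c \<in> codes N"
proof (cases c)
  case (Pl k)
  have "k \<circ> \<pi> = mid N \<Longrightarrow> k = mid N"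
    using assms(1) unfolding mid_def by (metis bij_is_surj comp_apply ext surjD)
  moreover have "sum (k \<circ> \<pi>) UNIV = sum k UNIV"
    using sum_perm[OF assms(1), of k] by (simp add: comp_def)
  ultimately show ?thesis
    using assms(2) Pl by (auto simp: codes_def box_def image_iff)
qed (auto simp: codes_def)

text \<open>This is what allows a symmetry to be moved past a standard map to the innermost
  position. Since \<open>tau \<pi>\<close> reads coordinate \<open>\<pi> i\<close> into place
  \<open>i\<close>, lateral faces are relabelled by the inverse permutation.\<close>

lemma tau_gm:
  assumes "bij \<pi>" "c \<in> codes N" "N > 0" "\<not> 3 dvd N"
  shows "tau \<pi> (gm N c x) = gm N (pcode \<pi> c) (tau \<pi> x)"
proof (cases c)
  case (Pl k)
  have s: "sum (k \<circ> \<pi>) UNIV = sum k UNIV"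
    using sum_perm[OF assms(1), of k] by (simp add: comp_def)
  have b: "box N k" "box N (k \<circ> \<pi>)"
    using assms(2) Pl s by (auto simp: codes_def box_def)
  show ?thesis
    unfolding Pl
    by (rule pt_eqI) (simp_all only: gm.simps pcode.simps bc_tau[OF assms(1)] ht_tau ht_pl bc_pl[OF assms(3) b(1)]
        bc_pl[OF assms(3) b(2)] s comp_apply)
next
  case (Lt j)
  have i: "\<pi> i = j \<longleftrightarrow> i = inv \<pi> j" for i
    using assms(1) by (metis bij_inv_eq_iff)
  have m: "box N (mid N)" using box_mid assms(4) by blast
  have p: "\<pi> (inv \<pi> j) = j" using assms(1) by (simp add: bij_is_surj surj_f_inv_f)
  show ?thesis
    unfolding Lt
    by (rule pt_eqI) (simp_all add: bc_tau[OF assms(1)] ht_tau ht_pl bc_pl[OF assms(3) m]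
        bc_lt ht_lt i p, simp_all add: mid_def)
qed

lemma dist_gm:
  assumes "N > 0" "\<not> 3 dvd N" "c \<in> codes N"
  shows "dist (gm N c x) (gm N c y) = dist x y / N"
  using assms box_mid[OF assms(2)]
  by (cases c) (auto simp: codes_def dist_pl dist_lt)

text \<open>Up to a constant, \<open>psi i\<close> bounds on \<open>pyr\<close> from below the distance to any cell attached along
  the edge \<open>bc x i = 0\<close>.\<close>

definition psi :: "3 \<Rightarrow> pt \<Rightarrow> real" where "psi i x = bc x i - 4/15 * ht x"

definition corner :: "int \<Rightarrow> 3 \<Rightarrow> 3 \<Rightarrow> int" where "corner N i = (\<lambda>j. if j = i then N - 1 else 0)"

section \<open>Locating the 1-cells near the sides and corners of the triangle\<close>

locale koch_scale =
  fixes N :: int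
  assumes N4: "N \<ge> 4" and N3: "\<not> 3 dvd N"
begin

lemma Npos [simp]: "N > 0" "N \<noteq> 0" "real_of_int N > 0" using N4 by auto

lemma box_mid' [simp]: "box N (mid N)" using box_mid N3 .

lemma kappa: "N div 3 \<ge> 1" "N = 3 * (N div 3) + 1 \<or> N = 3 * (N div 3) + 2"
proof -
  show "N div 3 \<ge> 1" using N4 by simp
  show "N = 3 * (N div 3) + 1 \<or> N = 3 * (N div 3) + 2" using N3 by presburger
qed

lemma kappa_real: obtains q :: real where "real_of_int (N div 3) = q" "q \<ge> 1"
  using kappa(1) by simp

definition up :: bool where "up \<longleftrightarrow> N = 3 * (N div 3) + 1"

lemma mid_up: "sum (mid N) UNIV = N - 1 \<longleftrightarrow> up"
  unfolding up_def mid_def sum_3 by linarith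

lemma bc_Lt:
  "bc (gm N (Lt j) x) i * N = (if up then N div 3 + bc (lt j x) i
     else N div 3 + 1 - bc (lt j x) i)"
proof -
  have "mid N i = N div 3" by (simp add: mid_def)
  then show ?thesis using bc_pl[of N "mid N" "lt j x" i] by (simp add: mid_up)
qed

lemma ht_Lt: "ht (gm N (Lt j) x) * N = bc x j + ht x / 3"
  by (simp add: ht_pl ht_lt)

lemma Pl_codes: "Pl k \<in> codes N \<longleftrightarrow> box N k \<and> (\<forall>i. 0 \<le> k i) \<and> k \<noteq> mid N"
  by (auto simp: codes_def)

lemma Lt_codes [simp]: "Lt j \<in> codes N"
  by (auto simp: codes_def)

text \<open>The constant 4/15 measures the overhang of a lateral pyramid beyond its base edge and is
  exact: for \<open>i = j\<close> the second bound reduces to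
  \<open>4/3 * ht x \<le> bc x j\<close>, the slope in the definition of \<open>pyr\<close>.\<close>

lemma lt_pyr_bounds:
  assumes "x \<in> pyr"
  shows "bc (lt j x) i \<le> 1" "- 4/15 * ht (lt j x) \<le> bc (lt j x) i" "0 \<le> ht (lt j x)" "ht (lt j x) \<le> 1"
    "i \<noteq> j \<Longrightarrow> 0 \<le> bc (lt j x) i" "4/3 * ht (lt j x) \<le> 1 + bc (lt j x) i"
    "bc (lt j x) i + 4/3 * ht (lt j x) \<le> 5/3"
proof -
  define a h where "a = bc x j" and "h = ht x"
  have "0 \<le> h" "4/3 * h \<le> a" "a \<le> 1 - 8/3 * h"
    using pyrD[OF assms] pyr_upper[OF assms] by (auto simp: a_def h_def)
  moreover have "ht (lt j x) = a + h / 3"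
    by (simp add: ht_lt a_def h_def)
  moreover have "(i = j \<and> bc (lt j x) i = a / 3 - 8/9 * h) \<or>
     (i \<noteq> j \<and> (\<exists>b. bc (lt j x) i = b + a / 3 + 4/9 * h \<and> 4/3 * h \<le> b \<and> b + a \<le> 1 - 4/3 * h))"
    using pyrD(2)[OF assms, of i] pyr_pair[OF assms, of i j] by (auto simp: bc_lt a_def h_def)
  ultimately show "bc (lt j x) i \<le> 1" "- 4/15 * ht (lt j x) \<le> bc (lt j x) i" "0 \<le> ht (lt j x)"
    "ht (lt j x) \<le> 1" "i \<noteq> j \<Longrightarrow> 0 \<le> bc (lt j x) i" "4/3 * ht (lt j x) \<le> 1 + bc (lt j x) i"
    "bc (lt j x) i + 4/3 * ht (lt j x) \<le> 5/3"
    by (elim disjE conjE exE; simp; argo)+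
qed

text \<open>Planar maps shrink heights and coordinates alike. The lateral maps have room because the
  middle triangle is at least one row, \<open>N div 3\<close> of them, away from every side.\<close>

lemma gm_pyr:
  assumes "c \<in> codes N" "x \<in> pyr"
  shows "gm N c x \<in> pyr"
proof (cases c)
  case (Pl k)
  then have b: "box N k" "\<And>i. 0 \<le> k i" using assms by (auto simp: Pl_codes)
  have "0 \<le> ht x" using assms(2) by (rule pyrD)
  moreover have "4/3 * ht x \<le> N * bc (pl N k x) i" for i
    using pl_box(1)[OF _ b(1) assms(2), of i] b(2)[of i] by simp
  ultimately show ?thesis
    unfolding Pl pyr_def by (simp add: ht_pl field_simps)
next
  case (Lt j)
  obtain q :: real where q: "real_of_int (N div 3) = q" "q \<ge> 1" by (rule kappa_real)
  have h: "0 * real_of_int N \<le> ht (gm N c x) * N"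
    unfolding Lt ht_Lt using lt_pyr_bounds(3)[OF assms(2), of j] by (simp add: ht_lt)
  have p: "4/3 * ht (gm N c x) * N \<le> bc (gm N c x) i * N" for i
  proof -
    define t b where "t = ht (lt j x)" and "b = bc (lt j x) i"
    have "4/3 * t \<le> 1 + b" "b + 4/3 * t \<le> 5/3"
      unfolding t_def b_def using lt_pyr_bounds(6,7)[OF assms(2)] by auto
    then have "4/3 * t \<le> (if up then q + b else q + 1 - b)"
      using q(2) by auto
    moreover have "ht (gm N c x) * N = t"
      unfolding Lt ht_Lt t_def ht_lt ..
    moreover have "bc (gm N c x) i * N = (if up then q + b else q + 1 - b)"
      unfolding Lt bc_Lt b_def using q(1) by simp
    ultimately show ?thesis
      by (simp only: mult.assoc)
  qed
  show ?thesis
    using mult_right_le_imp_le[OF h] mult_right_le_imp_le[OF p] unfolding pyr_def by simp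
qed

text \<open>A planar cell outside the row has \<open>k i \<ge> 1\<close> and gains 4/3 of its
  height, more than the 4/15 subtracted by \<open>psi\<close>. A lateral cell approaches side
  \<open>i\<close> only by overhanging, and only an upright middle triangle turns its edge
  \<open>i\<close> towards that side.\<close>

lemma psi_row:
  assumes "c \<in> codes N" "x \<in> pyr" "N * psi i (gm N c x) < 1"
  shows "(\<exists>k. c = Pl k \<and> k i = 0) \<or> (c = Lt i \<and> up)"
proof (cases c)
  case (Pl k)
  then have b: "box N k" "0 \<le> k i" using assms by (auto simp: Pl_codes)
  have "N * psi i (pl N k x) = N * bc (pl N k x) i - 4/15 * ht x"
    by (simp add: psi_def ht_pl algebra_simps)
  then have "k i < 1"
    using assms(3) pl_box(1)[OF _ b(1) assms(2), of i] pyrD(1)[OF assms(2)] by (simp add: Pl)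
  then show ?thesis using b Pl by simp
next
  case (Lt j)
  have e: "N * psi i (gm N c x) = bc (gm N c x) i * N - 4/15 * (ht (gm N c x) * N)"
    by (simp add: psi_def algebra_simps)
  obtain q :: real where q: "real_of_int (N div 3) = q" "q \<ge> 1" by (rule kappa_real)
  have "j = i \<and> up"
  proof (rule ccontr)
    assume n: "\<not> ?thesis"
    have "1 \<le> bc (gm N c x) i * N - 4/15 * (ht (gm N c x) * N)"
      unfolding Lt bc_Lt ht_Lt
      using n q(2) pyrD(1)[OF assms(2)] pyr_upper[OF assms(2), of j] pyrD(2)[OF assms(2), of i] pyrD(2)[OF assms(2), of j]
        pyr_upper[OF assms(2), of i] pyr_pair[OF assms(2), of i j]
      by (cases "i = j"; cases "up"; simp add: bc_lt q(1); argo)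
    with e assms(3) show False by simp
  qed
  then show ?thesis using Lt by simp
qed

text \<open>On \<open>Lt i\<close> the overhang costs up to 4/15 of the height and
  \<open>psi\<close> subtracts as much again; with scaled height at most 1 and at least one row of
  distance, 1 - 8/15 = 7/15 remains.\<close>

lemma psi_row':
  assumes "c \<in> codes N" "x \<in> pyr" "N * psi i (gm N c x) < 7/15"
  obtains k where "c = Pl k" "k i = 0"
proof -
  have "\<not> (c = Lt i \<and> up)"
  proof
    assume c: "c = Lt i \<and> up"
    have e: "N * psi i (gm N c x) = bc (gm N c x) i * N - 4/15 * (ht (gm N c x) * N)"
      by (simp add: psi_def algebra_simps)
    obtain q :: real where q: "real_of_int (N div 3) = q" "q \<ge> 1" by (rule kappa_real)
    have "7/15 \<le> bc (gm N c x) i * N - 4/15 * (ht (gm N c x) * N)"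
      unfolding c[THEN conjunct1] bc_Lt ht_Lt
      using c q(2) pyrD(2)[OF assms(2), of i] pyrD(1)[OF assms(2)] pyr_upper[OF assms(2), of i]
      by (simp add: bc_lt q(1), argo)
    with e assms(3) show False by simp
  qed
  with psi_row[OF assms(1,2), of i] assms(3) that show thesis by auto
qed

text \<open>On a lateral cell the left-hand side is at most \<open>N div 3 + 2\<close>, which does
  not exceed N - 1, with equality for N = 4. For a planar cell the bound gives
  \<open>k i > N - 2\<close>, and only the corner has such an index.\<close>

lemma corner_cell:
  assumes "c \<in> codes N" "x \<in> pyr" "N * (bc (gm N c x) i + 4/15 * ht (gm N c x)) > N - 1"
  shows "c = Pl (corner N i)"
proof (cases c)
  case (Pl k)
  then have b: "box N k" "\<And>j. 0 \<le> k j" using assms by (auto simp: Pl_codes)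
  have "N * (bc (gm N c x) i + 4/15 * ht (gm N c x)) = N * bc (pl N k x) i + 4/15 * ht x"
    by (simp add: Pl ht_pl algebra_simps)
  then have "k i > N - 2"
    using assms(3) pl_box(2)[OF _ b(1) assms(2), of i] pyrD(1)[OF assms(2)] by simp
  obtain j l where T: "UNIV = {i, j, l}" "i \<noteq> j" "i \<noteq> l" "j \<noteq> l" by (metis triple_index)
  have "k i = N - 1 \<and> k j = 0 \<and> k l = 0"
    using b(1) b(2)[of j] b(2)[of l] \<open>k i > N - 2\<close> by (auto simp: box_def sum_triple[OF T])
  then have "k = corner N i"
    using T triple_cases[OF T(1)] by (force simp: corner_def fun_eq_iff)
  then show ?thesis using Pl by simp
next
  case (Lt j)
  have e: "N * (bc (gm N c x) i + 4/15 * ht (gm N c x)) =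
      bc (gm N c x) i * N + 4/15 * (ht (gm N c x) * N)"
    by (simp add: algebra_simps)
  obtain q :: real where q: "real_of_int (N div 3) = q" "q \<ge> 1" by (rule kappa_real)
  have "bc (gm N c x) i * N + 4/15 * (ht (gm N c x) * N) \<le> real_of_int (N div 3) + 2"
    unfolding Lt bc_Lt ht_Lt
    using pyrD(1)[OF assms(2)] pyr_upper[OF assms(2), of j] pyrD(2)[OF assms(2), of i] pyrD(2)[OF assms(2), of j]
        pyr_upper[OF assms(2), of i] pyr_pair[OF assms(2), of i j] pyr_ht[OF assms(2)]
    by (cases "i = j"; cases "up"; simp add: bc_lt q(1); argo)
  moreover have "N div 3 + 2 \<le> N - 1" using kappa by auto
  then have "real_of_int (N div 3) + 2 \<le> N - 1" by linarith
  ultimately have False using assms(3) e by linarith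
  then show ?thesis ..
qed

end

section \<open>Pairs of cells that share an edge\<close>

definition rf :: "3 \<Rightarrow> pt \<Rightarrow> pt" where
  "rf i x = mk (\<lambda>l. if l = i then - bc x i else bc x l + bc x i) (ht x)"

lemma bc_rf: "bc (rf i x) l = (if l = i then - bc x i else bc x l + bc x i)"
  unfolding rf_def
proof (rule bc_mk)
  obtain j l where T: "UNIV = {i, j, l}" "i \<noteq> j" "i \<noteq> l" "j \<noteq> l" by (metis triple_index)
  then show "(\<Sum>l\<in>UNIV. if l = i then - bc x i else bc x l + bc x i) = 1"
    using sum_bc[of x] by (simp add: sum_triple[OF T])
qed

lemma ht_rf: "ht (rf i x) = ht x"
  by (simp add: rf_def)

definition lti :: "3 \<Rightarrow> pt \<Rightarrow> pt" where
  "lti j x = mk (\<lambda>i. if i = j then bc x j / 3 + 8/9 * ht x else bc x i + bc x j / 3 - 4/9 * ht x)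
     (ht x / 3 - bc x j)"

lemma bc_lti: "bc (lti j x) i =
  (if i = j then bc x j / 3 + 8/9 * ht x else bc x i + bc x j / 3 - 4/9 * ht x)"
  unfolding lti_def
proof (rule bc_mk)
  obtain i l where T: "UNIV = {j, i, l}" "j \<noteq> i" "j \<noteq> l" "i \<noteq> l" by (metis triple_index)
  then show "(\<Sum>i\<in>UNIV. if i = j then bc x j / 3 + 8/9 * ht x else bc x i + bc x j / 3 - 4/9 * ht x) = 1"
    using sum_bc[of x] by (simp add: sum_triple[OF T])
qed

lemma ht_lti: "ht (lti j x) = ht x / 3 - bc x j"
  by (simp add: lti_def)

lemma lt_lti: "lt j (lti j x) = x"
  by (rule pt_eqI) (simp_all add: bc_lt ht_lt bc_lti ht_lti field_simps)

lemma dist_lt_left: "dist (lt j x) y = dist x (lti j y)"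
  using dist_lt[of j x "lti j y"] by (simp add: lt_lti)

text \<open>Two placements of the cell, of ratio \<open>1 / r\<close>, that agree on the whole line
  carrying side \<open>i\<close>. The bounds say that nearness of the images forces both points to
  be near the side in their own coordinates, and that positions along the side can be compared as if
  the fold were flattened.\<close>

definition edge :: "real \<Rightarrow> 3 \<Rightarrow> (pt \<Rightarrow> pt) \<Rightarrow> (pt \<Rightarrow> pt) \<Rightarrow> bool" where
  "edge r i A B \<longleftrightarrow> (\<forall>x. bc x i = 0 \<and> ht x = 0 \<longrightarrow> A x = B x) \<and>
     (\<forall>x\<in>pyr. \<forall>y\<in>pyr. psi i x \<le> sqrt (3/2) * (r * dist (A x) (B y)) \<and>
        psi i y \<le> sqrt (3/2) * (r * dist (A x) (B y)) \<and>
        (\<forall>j. j \<noteq> i \<longrightarrow> \<bar>(bc x j + bc x i / 2) - (bc y j + bc y i / 2)\<bar> \<le> r * dist (A x) (B y)))"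

lemma edge_pl:
  assumes "edge 1 i \<alpha> \<beta>" "N > 0" "box N k"
  shows "edge N i (\<lambda>x. pl N k (\<alpha> x)) (\<lambda>x. pl N k (\<beta> x))"
  using assms unfolding edge_def by (auto simp: dist_pl)

lemma edge_flat: "edge 1 i (\<lambda>x. x) (rf i)"
  unfolding edge_def
proof (intro conjI ballI allI impI)
  fix x assume "bc x i = 0 \<and> ht x = 0"
  then show "x = rf i x" by (intro pt_eqI) (auto simp: bc_rf ht_rf)
next
  fix x y assume x: "x \<in> pyr" and y: "y \<in> pyr"
  note b = pyrD(1)[OF x] pyrD(1)[OF y] pyr_nonneg[OF x, of i] pyr_nonneg[OF y, of i]
  show "psi i x \<le> sqrt (3/2) * (1 * dist x (rf i y))"
    using slanted_dist[of "-4/15" x i "rf i y"] b by (simp add: psi_def bc_rf ht_rf)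
  show "psi i y \<le> sqrt (3/2) * (1 * dist x (rf i y))"
    using slanted_dist[of "4/15" x i "rf i y"] b by (simp add: psi_def bc_rf ht_rf)
  fix j assume "j \<noteq> i"
  then show "\<bar>(bc x j + bc x i / 2) - (bc y j + bc y i / 2)\<bar> \<le> 1 * dist x (rf i y)"
    using along_dist[of i j x "rf i y"] by (simp add: bc_rf algebra_simps)
qed

text \<open>In the coordinates of the lateral cell, \<open>bc _ i - 4/15 * ht _\<close> takes at the
  point from \<open>y\<close> the value 4/5 * \<open>ht y\<close> - 3/5 * \<open>bc y i\<close>,
  nonpositive by the slope 4/3 of the pyramid. For \<open>y\<close> the same happens in base
  coordinates with the sign of the slope reversed.\<close>

lemma edge_base: "edge 1 i (lt i) (rf i)"
  unfolding edge_def
proof (intro conjI ballI allI impI)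
  fix x assume "bc x i = 0 \<and> ht x = 0"
  then show "lt i x = rf i x" by (intro pt_eqI) (auto simp: bc_rf ht_rf bc_lt ht_lt)
next
  fix x y assume x: "x \<in> pyr" and y: "y \<in> pyr"
  note b = pyrD(1)[OF x] pyrD(1)[OF y] pyrD(2)[OF x, of i] pyrD(2)[OF y, of i]
  show "psi i x \<le> sqrt (3/2) * (1 * dist (lt i x) (rf i y))"
    unfolding dist_lt_left
    using slanted_dist[of "-4/15" x i "lti i (rf i y)"] b
    by (simp add: psi_def bc_rf ht_rf bc_lti ht_lti) argo
  show "psi i y \<le> sqrt (3/2) * (1 * dist (lt i x) (rf i y))"
    using slanted_dist[of "4/15" "lt i x" i "rf i y"] b
    by (simp add: psi_def bc_rf ht_rf bc_lt ht_lt) argo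
  fix j assume "j \<noteq> i"
  then show "\<bar>(bc x j + bc x i / 2) - (bc y j + bc y i / 2)\<bar> \<le> 1 * dist (lt i x) (rf i y)"
    unfolding dist_lt_left
    using along_dist[of i j x "lti i (rf i y)"] by (simp add: bc_rf ht_rf bc_lti field_simps)
qed

text \<open>\<open>bc _ j - ht _ / 3\<close> is a multiple of the signed distance from the plane of
  the face opposite to \<open>j\<close>: it equals \<open>- ht z\<close> at \<open>lt j z\<close>
  and \<open>bc x j + ht x / 3\<close> at \<open>lt i x\<close>. The common edge is side
  \<open>j\<close> for one map and side \<open>i\<close> for the other; the transposition makes the
  two parametrizations agree.\<close>

lemma edge_side:
  assumes "i \<noteq> j"
  shows "edge 1 j (lt i) (\<lambda>x. lt j (tau (Transposition.transpose i j) x))"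
  unfolding edge_def
proof (intro conjI ballI allI impI)
  have bij: "bij (Transposition.transpose i j)" by simp
  fix x assume "bc x j = 0 \<and> ht x = 0"
  then show "lt i x = lt j (tau (Transposition.transpose i j) x)"
    using assms
    by (intro pt_eqI) (auto simp: bc_lt ht_lt bc_tau[OF bij] ht_tau Transposition.transpose_def)
next
  have bij: "bij (Transposition.transpose i j)" by simp
  fix x y assume x: "x \<in> pyr" and y: "y \<in> pyr"
  define z where "z = tau (Transposition.transpose i j) y"
  have z: "bc z i = bc y j" "bc z j = bc y i" "ht z = ht y" "\<And>l. l \<noteq> i \<Longrightarrow> l \<noteq> j \<Longrightarrow> bc z l = bc y l"
    by (simp_all add: z_def bc_tau[OF bij] ht_tau Transposition.transpose_def)
  note b = pyrD(1)[OF x] pyrD(1)[OF y] pyrD(2)[OF x, of i] pyrD(2)[OF y, of i]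
  show "psi j x \<le> sqrt (3/2) * (1 * dist (lt i x) (lt j z))"
    using slanted_dist[of "-1/3" "lt i x" j "lt j z"] b assms
    by (simp add: psi_def bc_lt ht_lt z) argo
  show "psi j y \<le> sqrt (3/2) * (1 * dist (lt i x) (lt j z))"
    using slanted_dist[of "-1/3" "lt i x" i "lt j z"] b assms
    by (simp add: psi_def bc_lt ht_lt z) argo
  fix l assume l: "l \<noteq> j"
  have "bc (lti i (lt j z)) l + bc (lti i (lt j z)) j / 2 = bc y l + bc y j / 2"
  proof (cases "l = i")
    case True
    obtain k where T: "UNIV = {i, j, k}" "i \<noteq> k" "j \<noteq> k" using pair_index[OF assms] .
    show ?thesis using True assms by (simp add: bc_lti ht_lti bc_lt ht_lt z field_simps)
  next
    case False
    then show ?thesis using l assms by (simp add: bc_lti ht_lti bc_lt ht_lt z field_simps)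
  qed
  then show "\<bar>(bc x l + bc x j / 2) - (bc y l + bc y j / 2)\<bar> \<le> 1 * dist (lt i x) (lt j z)"
    unfolding dist_lt_left
    using along_dist[of j l x "lti i (lt j z)"] l by simp
qed

text \<open>Composites of \<open>n\<close> standard maps with one innermost symmetry. By
  \<open>tau_gm\<close> this class is closed under composition, and \<open>n\<close> counts the
  contractions only.\<close>

inductive adm :: "int \<Rightarrow> nat \<Rightarrow> (pt \<Rightarrow> pt) \<Rightarrow> bool" for N where
  adm_0: "bij \<pi> \<Longrightarrow> adm N 0 (tau \<pi>)"
| adm_Suc: "c \<in> codes N \<Longrightarrow> adm N n S \<Longrightarrow> adm N (Suc n) (\<lambda>x. gm N c (S x))"

context koch_scale
begin

lemma tau_gm': "bij \<pi> \<Longrightarrow> c \<in> codes N \<Longrightarrow> tau \<pi> (gm N c x) = gm N (pcode \<pi> c) (tau \<pi> x)"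
  using tau_gm N3 by simp

lemma dist_gm': "c \<in> codes N \<Longrightarrow> dist (gm N c x) (gm N c y) = dist x y / N"
  using dist_gm N3 by simp

lemma adm_id: "adm N 0 (\<lambda>x. x)"
  using adm_0[of id N] by (simp add: tau_id[abs_def])

lemma adm_gm: "c \<in> codes N \<Longrightarrow> adm N 1 (gm N c)"
  using adm_Suc[OF _ adm_id] by simp

lemma tau_adm: "adm N n S \<Longrightarrow> bij \<pi> \<Longrightarrow> adm N n (\<lambda>x. tau \<pi> (S x))"
proof (induction arbitrary: \<pi> rule: adm.induct)
  case (adm_0 \<rho>)
  then show ?case
    by (simp add: tau_tau bij_comp adm.adm_0)
next
  case (adm_Suc c n S)
  then show ?case
    by (simp add: tau_gm' adm.adm_Suc pcode_codes)
qed

lemma adm_comp: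
  assumes "adm N m S" "adm N n T"
  shows "adm N (m + n) (\<lambda>x. S (T x))"
  using assms(1)
proof induction
  case (adm_0 \<pi>)
  then show ?case using tau_adm[OF assms(2)] by simp
next
  case (adm_Suc c n S)
  then show ?case using adm.adm_Suc by simp
qed

lemma dist_adm: "adm N n S \<Longrightarrow> dist (S x) (S y) = dist x y / real_of_int N ^ n"
  by (induction rule: adm.induct) (simp_all add: dist_tau dist_gm')

lemma adm_cont: "adm N n S \<Longrightarrow> continuous_on A S"
proof -
  assume S: "adm N n S"
  have "1-lipschitz_on A S"
  proof (rule lipschitz_onI)
    show "dist (S x) (S y) \<le> 1 * dist x y" for x y
      using dist_adm[OF S, of x y] N4 by (simp add: divide_le_eq mult_le_cancel_left1)
  qed simp
  then show ?thesis by (rule lipschitz_on_continuous_on)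
qed

text \<open>Affinity expressed through homotheties, because scalings about a centre are what has to
  be carried from the triangle to a cell.\<close>

definition aff :: "(pt \<Rightarrow> pt) \<Rightarrow> bool" where
  "aff S \<longleftrightarrow> (\<forall>x y r. S (hom y r x) = hom (S y) r (S x))"

lemma aff_tau: "bij \<pi> \<Longrightarrow> aff (tau \<pi>)"
  unfolding aff_def by (intro allI pt_eqI) (simp_all add: bc_tau ht_tau bc_hom ht_hom)

lemma aff_pl: "m > 0 \<Longrightarrow> box m k \<Longrightarrow> aff (pl m k)"
  unfolding aff_def by (intro allI pt_eqI) (simp_all add: bc_pl ht_pl bc_hom ht_hom field_simps)

lemma aff_lt: "aff (lt j)"
  unfolding aff_def by (intro allI pt_eqI) (simp_all add: bc_lt ht_lt bc_hom ht_hom field_simps)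

lemma aff_adm: "adm N n S \<Longrightarrow> aff S"
proof (induction rule: adm.induct)
  case (adm_0 \<pi>)
  then show ?case by (rule aff_tau)
next
  case (adm_Suc c n S)
  have "aff (gm N c)"
    using adm_Suc(1) aff_pl[of N] aff_lt
    by (cases c) (auto simp: Pl_codes aff_def)
  then show ?case using adm_Suc by (simp add: aff_def)
qed

lemma affD: "aff S \<Longrightarrow> hom (S y) r (S x) = S (hom y r x)"
  by (simp add: aff_def)

end

section \<open>The attractor and its symmetries\<close>

text \<open>\<open>tw c\<close> is the symmetry by which a given similitude may differ from the
  standard map with the same target; it is left arbitrary.\<close>

locale koch_attractor = koch_scale +
  fixes K :: "pt set" and tw :: "code \<Rightarrow> 3 \<Rightarrow> 3"
  assumes K_compact: "compact K" and K_nonempty: "K \<noteq> {}"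
    and bij_tw: "\<And>c. bij (tw c)"
    and K_tw: "K = (\<Union>c\<in>codes N. (\<lambda>x. gm N c (tau (tw c) x)) ` K)"
begin

text \<open>The largest distance from a point of \<open>X\<close> to \<open>L\<close> is contracted, hence zero.\<close>

lemma contract_subset:
  fixes X L :: "pt set"
  assumes "compact X" "closed L" "L \<noteq> {}"
    and "\<And>x. x \<in> X \<Longrightarrow> \<exists>y\<in>X. infdist x L \<le> infdist y L / N"
  shows "X \<subseteq> L"
proof (cases "X = {}")
  case False
  have "continuous_on X (\<lambda>x. infdist x L)" by (intro continuous_intros)
  then obtain x where x: "x \<in> X" "\<And>y. y \<in> X \<Longrightarrow> infdist y L \<le> infdist x L"
    using continuous_attains_sup[OF assms(1) False] by blast
  obtain y where "y \<in> X" "infdist x L \<le> infdist y L / N" using assms(4) x(1) by blast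
  then have "infdist x L \<le> infdist x L / N"
    using x(2)[of y] by (meson divide_right_mono order_trans Npos(3) less_imp_le)
  then have "infdist x L * (N - 1) \<le> 0"
    by (simp add: field_simps)
  then have "infdist x L \<le> 0"
    using N4 by (simp add: mult_le_0_iff)
  then have "infdist y L = 0" if "y \<in> X" for y
    using x(2)[OF that] infdist_nonneg[of y L] by linarith
  then show ?thesis
    using in_closed_iff_infdist_zero[OF assms(2,3)] by blast
qed simp

lemma infdist_gm:
  assumes "c \<in> codes N" "\<And>y. y \<in> L' \<Longrightarrow> gm N c y \<in> L" "closed L'" "L' \<noteq> {}"
  shows "infdist (gm N c x) L \<le> infdist x L' / N"
proof -
  obtain y where y: "y \<in> L'" "infdist x L' = dist x y"
    using infdist_attains_inf[OF assms(3,4)] by blast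
  have "infdist (gm N c x) L \<le> dist (gm N c x) (gm N c y)"
    by (rule infdist_le) (use y assms in auto)
  then show ?thesis using y dist_gm'[OF assms(1)] by simp
qed

lemma K_pyr: "K \<subseteq> pyr"
proof (rule contract_subset)
  show "closed pyr" using compact_pyr by (rule compact_imp_closed)
  have "mk (\<lambda>_. 1/3) 0 \<in> pyr" by (auto simp: pyr_def bc_mk)
  then show ne: "pyr \<noteq> {}" by blast
  fix x assume "x \<in> K"
  then obtain c y where c: "c \<in> codes N" "y \<in> K" "x = gm N c (tau (tw c) y)"
    using K_tw by blast
  have "infdist x pyr \<le> infdist (tau (tw c) y) pyr / N"
    unfolding c(3) by (rule infdist_gm[OF c(1)]) (use gm_pyr[OF c(1)] ne compact_pyr compact_imp_closed in auto)
  moreover have "infdist (tau (tw c) y) pyr \<le> infdist y pyr"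
  proof -
    obtain z where z: "z \<in> pyr" "infdist y pyr = dist y z"
      using infdist_attains_inf[of pyr y] ne compact_pyr compact_imp_closed by blast
    show ?thesis
      using infdist_le[OF tau_pyr[OF bij_tw z(1)], of "tau (tw c) y" c] z dist_tau[OF bij_tw] by simp
  qed
  ultimately show "\<exists>y\<in>K. infdist x pyr \<le> infdist y pyr / N"
    using c(2) divide_right_mono[of "infdist (tau (tw c) y) pyr" "infdist y pyr" N] N4 by (intro bexI[of _ y]) auto
qed (rule K_compact)

lemma finite_bij: "finite {\<pi>::3\<Rightarrow>3. bij \<pi>}"
  by (rule finite_subset[of _ UNIV]) auto

text \<open>The union \<open>X\<close> of all symmetric copies of \<open>K\<close> is contracted
  into \<open>K\<close>: a symmetry passes through the outer standard map, and the one left inside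
  only selects another copy.\<close>

lemma K_tau:
  assumes "bij \<pi>" "x \<in> K"
  shows "tau \<pi> x \<in> K"
proof -
  define X where "X = (\<Union>\<pi>\<in>{\<pi>::3\<Rightarrow>3. bij \<pi>}. tau \<pi> ` K)"
  have "X \<subseteq> K"
  proof (rule contract_subset)
    show "compact X"
      unfolding X_def
      by (intro compact_UN finite_bij compact_continuous_image K_compact)
        (use adm_cont[OF adm_0] in auto)
    fix x assume "x \<in> X"
    then obtain \<pi> y where p: "bij \<pi>" "y \<in> K" "x = tau \<pi> y" by (auto simp: X_def)
    obtain c z where c: "c \<in> codes N" "z \<in> K" "y = gm N c (tau (tw c) z)"
      using K_tw p(2) by blast
    define d where "d = pcode \<pi> c"
    have d: "d \<in> codes N" using pcode_codes p c by (auto simp: d_def)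
    have x: "x = gm N d (tau \<pi> (tau (tw c) z))"
      using p c by (simp add: tau_gm' d_def)
    \<comment> \<open>Preparing the argument with \<open>inv (tw d)\<close> makes \<open>x\<close>
      an image under the given map for \<open>d\<close>, twist included.\<close>
    define w where "w = tau (inv (tw d)) (tau \<pi> (tau (tw c) z))"
    have w: "w \<in> X"
      unfolding w_def X_def using c(2) p(1) bij_tw bij_imp_bij_inv[OF bij_tw]
      by (auto simp: tau_tau bij_comp intro!: exI[of _ "tw c \<circ> \<pi> \<circ> inv (tw d)"])
    have x2: "x = gm N d (tau (tw d) w)"
      unfolding w_def x by (simp add: tau_inv bij_tw)
    obtain v where v: "v \<in> K" "infdist w K = dist w v"
      using infdist_attains_inf[of K w] K_compact K_nonempty compact_imp_closed by blast
    have "gm N d (tau (tw d) v) \<in> K" using v d K_tw by blast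
    then have "infdist x K \<le> dist x (gm N d (tau (tw d) v))" by (rule infdist_le)
    also have "\<dots> = infdist w K / N"
      unfolding x2 v(2) by (simp add: dist_gm'[OF d] dist_tau bij_tw)
    finally show "\<exists>y\<in>X. infdist x K \<le> infdist y K / N" using w by blast
  qed (use K_compact K_nonempty compact_imp_closed in auto)
  then show ?thesis using assms by (auto simp: X_def)
qed

lemma K_tau_image: "bij \<pi> \<Longrightarrow> tau \<pi> ` K = K"
proof
  assume b: "bij \<pi>"
  then show "tau \<pi> ` K \<subseteq> K" using K_tau by blast
  show "K \<subseteq> tau \<pi> ` K"
    using K_tau[OF bij_imp_bij_inv[OF b]] tau_inv(2)[OF b] by (metis image_eqI subsetI)
qed

lemma K_eq: "K = (\<Union>c\<in>codes N. gm N c ` K)"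
proof -
  have "(\<lambda>x. gm N c (tau (tw c) x)) ` K = gm N c ` K" for c
    using K_tau_image[OF bij_tw, of c] by (metis image_image)
  then show ?thesis using K_tw by simp
qed

lemma gm_K: "c \<in> codes N \<Longrightarrow> x \<in> K \<Longrightarrow> gm N c x \<in> K"
  using K_eq by blast

lemma K_cases: assumes "x \<in> K" obtains c y where "c \<in> codes N" "y \<in> K" "x = gm N c y"
  using K_eq assms by blast

lemma adm_K: "adm N n S \<Longrightarrow> x \<in> K \<Longrightarrow> S x \<in> K"
  by (induction rule: adm.induct) (simp_all add: K_tau gm_K)

text \<open>The set \<open>U\<close> is covered by cells of some level \<open>Suc m\<close> which one homothety of ratio
  \<open>N\<close> maps onto cells of level \<open>m\<close>.\<close>

definition scalable :: "pt set \<Rightarrow> bool" where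
  "scalable U \<longleftrightarrow> (\<exists>y m. \<forall>u\<in>U. \<exists>S S'. adm N (Suc m) S \<and> adm N m S' \<and> u \<in> S ` K \<and>
     (\<forall>x. hom y N (S x) = S' x))"

text \<open>The bound confines \<open>x\<close> to the lowest row of level 2. In an upright 1-cell
  of the row \<open>psi_row\<close> applies once more to \<open>z\<close>, and a tetrahedron may
  still reach down; an inverted one touches the side with its vertex \<open>i\<close> only, so
  \<open>z\<close> lies in that corner.\<close>

lemma row_structure:
  assumes "x \<in> K" "N\<^sup>2 * psi i x < 1"
  obtains k z where "Pl k \<in> codes N" "k i = 0" "z \<in> K" "x = pl N k z"
    "(sum k UNIV = N - 1 \<and> (\<exists>l y. Pl l \<in> codes N \<and> l i = 0 \<and> y \<in> K \<and> z = pl N l y)) \<or>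
     (sum k UNIV = N - 1 \<and> (\<exists>y\<in>K. z = gm N (Lt i) y)) \<or>
     (sum k UNIV = N - 2 \<and> (\<exists>y\<in>K. z = pl N (corner N i) y))"
proof -
  obtain c z where c: "c \<in> codes N" "z \<in> K" "x = gm N c z" using K_cases[OF assms(1)] .
  have zp: "z \<in> pyr" using c K_pyr by blast
  have lt: "N * psi i x < 1 / N"
    using assms(2) by (simp add: power2_eq_square field_simps)
  also have "1 / real_of_int N \<le> 7/15" using N4 by (simp add: field_simps)
  finally obtain k where k: "c = Pl k" "k i = 0"
    using psi_row'[OF c(1) zp, of i] c(3) by blast
  have b: "box N k" using c k Pl_codes by blast
  obtain d y where d: "d \<in> codes N" "y \<in> K" "z = gm N d y" using K_cases[OF c(2)] .
  have yp: "y \<in> pyr" using d K_pyr by blast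
  show thesis
  proof (rule that[of k z])
    show "Pl k \<in> codes N" "k i = 0" "z \<in> K" "x = pl N k z" using c k by auto
    show "(sum k UNIV = N - 1 \<and> (\<exists>l y. Pl l \<in> codes N \<and> l i = 0 \<and> y \<in> K \<and> z = pl N l y)) \<or>
     (sum k UNIV = N - 1 \<and> (\<exists>y\<in>K. z = gm N (Lt i) y)) \<or>
     (sum k UNIV = N - 2 \<and> (\<exists>y\<in>K. z = pl N (corner N i) y))"
    proof (cases "sum k UNIV = N - 1")
      case True
      have "N * psi i x = psi i z"
        using True b k c(3) by (simp add: psi_def bc_pl ht_pl algebra_simps)
      then have "N * psi i z < 1" using lt by (simp add: field_simps)
      then have "(\<exists>l. d = Pl l \<and> l i = 0) \<or> d = Lt i"
        using psi_row[OF d(1) yp, of i] d(3) by blast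
      then show ?thesis using True d gm.simps(1) by metis
    next
      case False
      then have s: "sum k UNIV = N - 2" using b by (auto simp: box_def)
      have "N * psi i x = 1 - (bc z i + 4/15 * ht z)"
        using False b k c(3) by (simp add: psi_def bc_pl ht_pl field_simps)
      with lt have "1 - (bc z i + 4/15 * ht z) < 1 / N" by simp
      then have "N * (1 - (bc z i + 4/15 * ht z)) < 1" by (simp add: field_simps)
      then have "N * (bc z i + 4/15 * ht z) > N - 1" by (simp add: algebra_simps)
      then have "d = Pl (corner N i)" using corner_cell[OF d(1) yp, of i] d(3) by blast
      then show ?thesis using s d by auto
    qed
  qed
qed

lemma pl_gm: "adm N 1 (pl N k)" if "Pl k \<in> codes N"
  using adm_gm[OF that] by (simp add: gm.simps(1)[abs_def])

lemma corner_codes: "Pl (corner N i) \<in> codes N"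
proof -
  obtain j l where T: "UNIV = {i, j, l}" "i \<noteq> j" "i \<noteq> l" "j \<noteq> l" by (metis triple_index)
  have "corner N i j \<noteq> mid N j" using T kappa(1) by (simp add: corner_def mid_def)
  then have "corner N i \<noteq> mid N" by metis
  moreover have "sum (corner N i) UNIV = N - 1" using T by (simp add: sum_triple[OF T] corner_def)
  ultimately show ?thesis using N4 by (auto simp: Pl_codes box_def, auto simp: corner_def)
qed

text \<open>Two planar levels merge into one index of the subdivision by \<open>N * N\<close>, so
  that a single integer vector describes what a homothety has to shift.\<close>

lemma row_cell:
  assumes "Pl k \<in> codes N" "k i = 0"
    "(sum k UNIV = N - 1 \<and> (\<exists>l y. Pl l \<in> codes N \<and> l i = 0 \<and> y \<in> K \<and> z = pl N l y)) \<or>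
     (sum k UNIV = N - 2 \<and> (\<exists>y\<in>K. z = pl N (corner N i) y))"
  obtains a y where "box (N * N) a" "a i = 0" "adm N 2 (pl (N * N) a)" "y \<in> K"
    "pl N k z = pl (N * N) a y"
proof -
  have *: "\<exists>a y. box (N * N) a \<and> a i = 0 \<and> adm N 2 (pl (N * N) a) \<and> y \<in> K \<and> pl N k z = pl (N * N) a y"
    if l: "Pl l \<in> codes N" "y \<in> K" "z = pl N l y"
    and i: "(if sum k UNIV = N - 1 then N * k i + l i else N * (k i + 1) - l i - 1) = 0" for l y
  proof -
    define a where "a = (\<lambda>i. if sum k UNIV = N - 1 then N * k i + l i else N * (k i + 1) - l i - 1)"
    have b: "box N k" "box N l" using assms l by (auto simp: Pl_codes)
    note c = pl_comp[OF Npos(1) Npos(1) b, folded a_def]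
    have "(\<lambda>x. pl N k (pl N l x)) = pl (N * N) a" using c(2) by auto
    with adm_comp[OF pl_gm[OF assms(1)] pl_gm[OF l(1)]] have "adm N 2 (pl (N * N) a)"
      by (simp add: numeral_2_eq_2)
    moreover have "a i = 0" using i by (simp add: a_def)
    ultimately show ?thesis using c l by blast
  qed
  from assms(3) have "\<exists>a y. box (N * N) a \<and> a i = 0 \<and> adm N 2 (pl (N * N) a) \<and> y \<in> K \<and> pl N k z = pl (N * N) a y"
  proof (elim disjE conjE exE bexE)
    fix l y assume "sum k UNIV = N - 1" "Pl l \<in> codes N" "l i = 0" "y \<in> K" "z = pl N l y"
    then show ?thesis using *[of l y] assms(2) by simp
  next
    fix y assume "sum k UNIV = N - 2" "y \<in> K" "z = pl N (corner N i) y"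
    then show ?thesis using *[of "corner N i" y] corner_codes assms(2) by (simp add: corner_def)
  qed
  then show thesis using that by blast
qed

text \<open>The work happens in the coordinates of one cell. A centre \<open>x0\<close> on the line
  of side \<open>i\<close> has the same image under \<open>A\<close> and \<open>B\<close>, hence one
  homothety about \<open>A x0\<close> treats both cells alike. The facts \<open>row\<close> and
  \<open>along\<close> bound the preimages across and along the side.\<close>

lemma scalable_edge:
  assumes A: "adm N 1 A" and B: "adm N 1 B" and E: "edge N i A B"
    and U: "U \<subseteq> A ` K \<union> B ` K" "U \<inter> A ` K \<noteq> {}" "U \<inter> B ` K \<noteq> {}"
    and small: "\<And>u v. u \<in> U \<Longrightarrow> v \<in> U \<Longrightarrow> dist u v < sqrt (2/3) / N ^ 3"
  shows "scalable U"
proof -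
  define R where "R u x \<longleftrightarrow> x \<in> K \<and> (u = A x \<or> u = B x)" for u x
  have Rex: "\<exists>x. R u x" if "u \<in> U" for u using U(1) that by (auto simp: R_def)
  obtain j l where T: "UNIV = {i, j, l}" "i \<noteq> j" "i \<noteq> l" "j \<noteq> l" by (metis triple_index)
  define w where "w x = bc x l - bc x j" for x
  have near: "N * dist u v < sqrt (2/3) / N\<^sup>2" if "u \<in> U" "v \<in> U" for u v
    using small[OF that] N4 by (simp add: field_simps power2_eq_square power3_eq_cube)
  have E1: "A x = B x" if "bc x i = 0" "ht x = 0" for x using E that by (auto simp: edge_def)
  have row: "N\<^sup>2 * psi i x < 1" if u: "u \<in> U" and x: "R u x" for u x
  proof -
    have Ep: "psi i x \<le> sqrt (3/2) * (N * dist (A x) (B y))" "psi i y \<le> sqrt (3/2) * (N * dist (A x) (B y))"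
      if "x \<in> K" "y \<in> K" for x y
      using E that K_pyr unfolding edge_def by blast+
    have "\<exists>v\<in>U. psi i x \<le> sqrt (3/2) * (N * dist u v)"
    proof (cases "u = A x")
      case True
      obtain y where "y \<in> K" "B y \<in> U" using U(3) by blast
      then show ?thesis using Ep(1)[of x y] x True by (auto simp: R_def)
    next
      case False
      then have "u = B x" using x by (simp add: R_def)
      obtain y where "y \<in> K" "A y \<in> U" using U(2) by blast
      then show ?thesis using Ep(2)[of y x] x \<open>u = B x\<close> by (auto simp: R_def dist_commute)
    qed
    then obtain v where v: "v \<in> U" "psi i x \<le> sqrt (3/2) * (N * dist u v)" by blast
    note v(2)
    also have "sqrt (3/2) * (N * dist u v) < sqrt (3/2) * (sqrt (2/3) / N\<^sup>2)"
      using near[OF u v(1)] by (intro mult_strict_left_mono) auto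
    also have "sqrt (3/2) * (sqrt (2/3) / N\<^sup>2) = 1 / real_of_int (N\<^sup>2)"
    proof -
      have "sqrt (3/2) * sqrt (2/3) = (1::real)" by (simp flip: real_sqrt_mult)
      then show ?thesis by simp
    qed
    finally show ?thesis by (simp add: field_simps)
  qed
  have along: "N\<^sup>2 * \<bar>w x - w y\<bar> < 41/25" if u: "u \<in> U" "v \<in> U" and x: "R u x" "R v y" for u v x y
  proof -
    have "\<bar>(bc x j + bc x i / 2) - (bc y j + bc y i / 2)\<bar> \<le> N * dist u v"
    proof -
      have AA: "dist x y = N * dist (A x) (A y)" "dist x y = N * dist (B x) (B y)"
        using dist_adm[OF A] dist_adm[OF B] by auto
      consider "u = A x" "v = A y" | "u = B x" "v = B y" | "u = A x" "v = B y" | "u = B x" "v = A y"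
        using x by (auto simp: R_def)
      then show ?thesis
      proof cases
        case 1 then show ?thesis using along_dist[OF T(2), of x y] AA by simp
      next
        case 2 then show ?thesis using along_dist[OF T(2), of x y] AA by simp
      next
        case 3
        have "x \<in> pyr" "y \<in> pyr" using x K_pyr by (auto simp: R_def)
        then show ?thesis using E T(2) 3 unfolding edge_def by auto
      next
        case 4
        have "x \<in> pyr" "y \<in> pyr" using x K_pyr by (auto simp: R_def)
        then have "\<bar>(bc y j + bc y i / 2) - (bc x j + bc x i / 2)\<bar> \<le> N * dist v u"
          using E T(2) 4 unfolding edge_def by auto
        then show ?thesis by (simp add: abs_minus_commute dist_commute)
      qed
    qed
    also have "\<dots> < sqrt (2/3) / N\<^sup>2" using near u by blast
    \<comment> \<open>41/50 is a rational upper bound of \<open>sqrt (2/3)\<close>. Up to sign and a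
      constant, \<open>w\<close> is twice the arc length, whence 41/25.\<close>
    also have "\<dots> \<le> 41/50 / N\<^sup>2"
      by (intro divide_right_mono real_le_lsqrt) (auto simp: power2_eq_square)
    finally have d: "\<bar>(bc x j + bc x i / 2) - (bc y j + bc y i / 2)\<bar> < 41/50 / N\<^sup>2" .
    have "w x - w y = - 2 * ((bc x j + bc x i / 2) - (bc y j + bc y i / 2))"
      using bc_third[OF T(2,3,4), of x] bc_third[OF T(2,3,4), of y] by (simp add: w_def)
    then have "\<bar>w x - w y\<bar> = 2 * \<bar>(bc x j + bc x i / 2) - (bc y j + bc y i / 2)\<bar>"
      by (simp only: abs_mult abs_neg_numeral)
    with d have "\<bar>w x - w y\<bar> < 41/25 / N\<^sup>2" by simp
    then show ?thesis by (simp add: field_simps)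
  qed
  have w_pyr: "\<bar>w x\<bar> \<le> 1" if "x \<in> K" for x
    using that K_pyr pyr_nonneg[of x j] pyr_nonneg[of x l] pyr_upper[of x j] pyr_upper[of x l] pyrD(1)[of x]
    by (auto simp: w_def)
  have w_pl: "m * w (pl m k x) = (if sum k UNIV = m - 1 then k l - k j + w x else k l - k j - w x)"
    if "m > 0" "box m k" for m k x
    using that by (simp add: w_def bc_pl right_diff_distrib)
  txt \<open>Either \<open>U\<close> meets a tetrahedron standing on the edge, and then it lies in the 2-cell carrying that
    tetrahedron and the corresponding 2-cell across the edge, or \<open>U\<close> lies in planar 3-cells along the edge,
    whose indices span at most 3 and can be shifted simultaneously.\<close>
  define Q where "Q k z \<longleftrightarrow> (sum k UNIV = N - 1 \<and> (\<exists>l y. Pl l \<in> codes N \<and> l i = 0 \<and> y \<in> K \<and> z = pl N l y)) \<or>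
     (sum k UNIV = N - 2 \<and> (\<exists>y\<in>K. z = pl N (corner N i) y))" for k :: "3 \<Rightarrow> int" and z
  show ?thesis
  proof (cases "\<exists>u\<in>U. \<exists>k y. Pl k \<in> codes N \<and> k i = 0 \<and> sum k UNIV = N - 1 \<and> y \<in> K \<and> R u (pl N k (gm N (Lt i) y))")
    case True
    then obtain u k y where b: "u \<in> U" "Pl k \<in> codes N" "k i = 0" "sum k UNIV = N - 1" "y \<in> K"
      "R u (pl N k (gm N (Lt i) y))" by blast
    define z where "z = gm N (Lt i) y"
    have yp: "y \<in> pyr" using b K_pyr by blast
    obtain q :: real where q: "real_of_int (N div 3) = q" "q \<ge> 1" by (rule kappa_real)
    have "1 \<le> bc z j * N" "1 \<le> bc z l * N" "11/15 \<le> bc z i * N"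
    proof -
      have 1: "bc (lt i y) p \<le> 1" "p \<noteq> i \<Longrightarrow> 0 \<le> bc (lt i y) p" "- 4/15 \<le> bc (lt i y) p" for p
        using lt_pyr_bounds(1,5)[OF yp, where j = i and i = p] lt_pyr_bounds(2)[OF yp, where j = i and i = p]
          lt_pyr_bounds(3,4)[OF yp, where j = i] by auto
      show "1 \<le> bc z j * N" "1 \<le> bc z l * N" "11/15 \<le> bc z i * N"
        unfolding z_def bc_Lt
        using 1(1,2)[of j] 1(1,2)[of l] 1(1,3)[of i] T(2,3) q by auto
    qed
    moreover have "(bc z i + bc z j + bc z l) * N = 1 * real_of_int N"
      using bc_third[OF T(2,3,4), of z] by simp
    then have "bc z i * N + bc z j * N + bc z l * N = N"
      by (simp only: distrib_right mult_1)
    \<comment> \<open>The scaled coordinates add up to N; two are at least 1 and the third at least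
      11/15, so the two differ by at most N - 2 - 11/15.\<close>
    ultimately have wz: "\<bar>N * w z\<bar> \<le> N - 273/100"
      by (simp add: w_def abs_le_iff algebra_simps)
    have bk: "box N k" using b by (simp add: Pl_codes)
    have all: "\<exists>z'\<in>K. x = pl N k z'" if v: "v \<in> U" "R v x" for v x
    proof -
      have xK: "x \<in> K" using v by (simp add: R_def)
      from row_structure[OF xK row[OF v]] obtain k' z' where
        s: "Pl k' \<in> codes N" "k' i = 0" "z' \<in> K" "x = pl N k' z'"
        "sum k' UNIV = N - 1 \<or> (sum k' UNIV = N - 2 \<and> (\<exists>y\<in>K. z' = pl N (corner N i) y))" by metis
      have bk': "box N k'" using s by (simp add: Pl_codes)
      define e where "e = (k' l - k' j) - (k l - k j)"
      have "N * \<bar>N * w x - N * w (pl N k z)\<bar> < 41/25"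
        using along[OF v(1) b(1) v(2) b(6)] N4
        by (simp add: z_def power2_eq_square abs_mult flip: right_diff_distrib)
      then have al: "\<bar>N * (N * w x) - N * (N * w (pl N k z))\<bar> < 41/25"
        using N4 by (simp add: abs_mult flip: right_diff_distrib)
      have w1: "N * w (pl N k z) = k l - k j + w z" using w_pl[of N k z] bk b(4) by simp
      \<comment> \<open>Since \<open>k i = k' i = 0\<close>, the index sums fix the parity of
        \<open>e\<close>: even in the upright case, odd in the inverted one. Upright: |N * e| < N +
        (N - 273/100) + 41/25 < 2 * N, so the even \<open>e\<close> is 0. Inverted: the corner gives
        |N * e| < 1 + (N - 273/100) + 41/25 < N, contradicting oddness by a narrow margin.\<close>
      from s(5) have "e = 0 \<and> sum k' UNIV = N - 1"
      proof (elim disjE conjE bexE)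
        assume up: "sum k' UNIV = N - 1"
        have wx: "N * w x = k' l - k' j + w z'" using w_pl[of N k' z'] bk' up s(4) by simp
        then have "\<bar>N * e + N * w z' - N * w z\<bar> < 41/25"
          using al unfolding w1 wx by (simp only: e_def of_int_diff of_int_mult distrib_left right_diff_distrib)
        moreover have "\<bar>N * w z'\<bar> \<le> N" using w_pyr[OF s(3)] N4 by (simp add: abs_mult)
        ultimately have "\<bar>real_of_int (N * e)\<bar> < real_of_int (2 * N)"
          using wz by (simp only: of_int_mult of_int_numeral)
        then have "\<bar>N * e\<bar> < 2 * N" by linarith
        then have "\<bar>e\<bar> < 2" using N4 by (simp add: abs_mult)
        moreover have "even e"
          using up b(3,4) s(2) by (simp add: e_def sum_triple[OF T]) presburger
        ultimately show ?thesis using up by presburger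
      next
        fix y' assume dn: "sum k' UNIV = N - 2" and y': "y' \<in> K" "z' = pl N (corner N i) y'"
        have wx: "N * w x = k' l - k' j - w z'" using w_pl[of N k' z'] bk' dn s(4) by simp
        then have "\<bar>N * e - N * w z' - N * w z\<bar> < 41/25"
          using al unfolding w1 wx by (simp only: e_def of_int_diff of_int_mult distrib_left right_diff_distrib)
        moreover have "\<bar>N * w z'\<bar> \<le> 1"
        proof -
          have "N * w z' = w y'"
            using w_pl[of N "corner N i" y'] y'(2) corner_codes[of i] T(2,3)
            by (auto simp: Pl_codes corner_def sum_triple[OF T])
          then show ?thesis using w_pyr[OF y'(1)] by simp
        qed
        ultimately have "\<bar>real_of_int (N * e)\<bar> < real_of_int N"
          using wz unfolding of_int_mult by linarith
        then have "\<bar>N * e\<bar> < N" by linarith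
        then have "e = 0" using N4 by (simp add: abs_mult)
        then have False
          using dn b(3,4) s(2) by (simp add: e_def sum_triple[OF T]) presburger
        then show ?thesis ..
      qed
      then have "k' i = k i \<and> k' j = k j \<and> k' l = k l"
        using b(3,4) s(2) by (simp add: e_def sum_triple[OF T])
      then have "k' q = k q" for q using triple_cases[OF T(1), of q] by auto
      then have "k' = k" by blast
      then show ?thesis using s by blast
    qed
    \<comment> \<open>The fixed point of \<open>pl N k\<close>; it lies on the side because
      \<open>k i = 0\<close>.\<close>
    define x0 where "x0 = mk (\<lambda>q. k q / (N - 1)) 0"
    have bx0: "bc x0 q = k q / (N - 1)" for q
      unfolding x0_def
    proof (rule bc_mk)
      have "(\<Sum>q\<in>UNIV. real_of_int (k q)) = N - 1" using b(4) by (simp flip: of_int_sum)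
      then show "(\<Sum>i\<in>UNIV. real_of_int (k i) / real_of_int (N - 1)) = 1"
        using N4 by (simp flip: sum_divide_distrib)
    qed
    have hx: "hom x0 N (pl N k x) = x" for x
    proof (rule pt_eqI)
      have e: "k q = (N - 1) * bc x0 q" for q using bx0 N4 by simp
      show "bc (hom x0 N (pl N k x)) q = bc x q" for q
        using bk b(4) by (simp add: bc_hom bc_pl right_diff_distrib left_diff_distrib e)
      show "ht (hom x0 N (pl N k x)) = ht x"
        by (simp add: ht_hom ht_pl x0_def)
    qed
    have AB: "A x0 = B x0" by (rule E1) (use bx0 b(3) in \<open>simp_all add: x0_def\<close>)
    have plk: "adm N 1 (pl N k)" using pl_gm b(2) .
    have *: "\<exists>S S'. adm N (Suc 1) S \<and> adm N 1 S' \<and> C x \<in> S ` K \<and> (\<forall>x. hom (A x0) N (S x) = S' x)"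
      if C: "adm N 1 C" "C x0 = A x0" and x: "\<exists>z'\<in>K. x = pl N k z'" for C x
    proof (intro exI conjI allI)
      show "adm N (Suc 1) (\<lambda>x. C (pl N k x))" using adm_comp[OF C(1) plk] by simp
      show "adm N 1 C" by fact
      show "C x \<in> (\<lambda>x. C (pl N k x)) ` K" using x by blast
      show "hom (A x0) N (C (pl N k x)) = C x" for x
        using affD[OF aff_adm[OF C(1)], of x0 N "pl N k x"] C(2) hx by simp
    qed
    show ?thesis
      unfolding scalable_def
    proof (intro exI[of _ "A x0"] exI[of _ 1] ballI)
      fix v assume v: "v \<in> U"
      obtain x where x: "R v x" using Rex[OF v] by blast
      show "\<exists>S S'. adm N (Suc 1) S \<and> adm N 1 S' \<and> v \<in> S ` K \<and> (\<forall>x. hom (A x0) N (S x) = S' x)"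
        using *[OF A _ all[OF v x]] *[OF B _ all[OF v x]] x AB by (auto simp: R_def)
    qed
  next
    case False
    define D where "D a \<longleftrightarrow> box (N * N) a \<and> a i = 0 \<and> adm N 2 (pl (N * N) a)" for a
    have cell: "\<exists>a y. D a \<and> y \<in> K \<and> x = pl (N * N) a y" if v: "v \<in> U" "R v x" for v x
    proof -
      have xK: "x \<in> K" using v by (simp add: R_def)
      from row_structure[OF xK row[OF v]] obtain k' z' where
        s: "Pl k' \<in> codes N" "k' i = 0" "z' \<in> K" "x = pl N k' z'"
        "(sum k' UNIV = N - 1 \<and> (\<exists>l y. Pl l \<in> codes N \<and> l i = 0 \<and> y \<in> K \<and> z' = pl N l y)) \<or>
         (sum k' UNIV = N - 1 \<and> (\<exists>y\<in>K. z' = gm N (Lt i) y)) \<or>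
         (sum k' UNIV = N - 2 \<and> (\<exists>y\<in>K. z' = pl N (corner N i) y))" .
      then have "Q k' z'" unfolding Q_def using False v by (simp del: gm.simps) blast
      from row_cell[OF s(1,2) this[unfolded Q_def]] show ?thesis using s(4) by (metis D_def)
    qed
    define W where "W = {a l - a j | a v x y. v \<in> U \<and> R v x \<and> D a \<and> y \<in> K \<and> x = pl (N * N) a y}"
    have NN: "0 < N * N" "real_of_int (N * N) > 0" by auto
    have wa: "\<bar>N * N * w (pl (N * N) a y) - (a l - a j)\<bar> \<le> 1" if "D a" "y \<in> K" for a y
      using w_pl[of "N * N" a y] w_pyr[OF that(2)] that(1) NN(1) by (auto simp: D_def)
    \<comment> \<open>Each index difference is within 1 of \<open>N * N * w x\<close>, and these
      values spread by less than 41/25; the total stays below 4.\<close>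
    have diff: "d' - d \<le> 3" if "d \<in> W" "d' \<in> W" for d d'
    proof -
      obtain a v x y where 1: "d = a l - a j" "v \<in> U" "R v x" "D a" "y \<in> K" "x = pl (N * N) a y"
        using \<open>d \<in> W\<close> by (auto simp: W_def)
      obtain a' v' x' y' where 2: "d' = a' l - a' j" "v' \<in> U" "R v' x'" "D a'" "y' \<in> K" "x' = pl (N * N) a' y'"
        using \<open>d' \<in> W\<close> by (auto simp: W_def)
      have "\<bar>N * N * w x - N * N * w x'\<bar> < 41/25"
        using along[OF 1(2) 2(2) 1(3) 2(3)] by (simp add: power2_eq_square abs_mult flip: right_diff_distrib)
      moreover have "\<bar>N * N * w x - d\<bar> \<le> 1" "\<bar>N * N * w x' - d'\<bar> \<le> 1"
        using wa[OF 1(4,5)] wa[OF 2(4,5)] 1 2 by auto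
      ultimately have "real_of_int d' - d < 4" by linarith
      then show ?thesis by linarith
    qed
    obtain u where u: "u \<in> U" using U(2) by blast
    then obtain d1 where d1: "d1 \<in> W" using Rex[OF u] cell[OF u] unfolding W_def by blast
    \<comment> \<open>The least element of \<open>W\<close>, which exists because
      \<open>diff\<close> bounds \<open>W\<close> below by \<open>d1 - 3\<close>.\<close>
    define d0 where "d0 = d1 - 3 + int (LEAST n. d1 - 3 + int n \<in> W)"
    have ex: "d1 - 3 + int 3 \<in> W" using d1 by simp
    have d0: "d0 \<in> W" unfolding d0_def by (rule LeastI[of "\<lambda>n. d1 - 3 + int n \<in> W", OF ex])
    have d0_le: "d0 \<le> d" if "d \<in> W" for d
    proof -
      have "d \<ge> d1 - 3" using diff[OF that d1] by simp
      then have "d1 - 3 + int (nat (d - (d1 - 3))) \<in> W" using that by simp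
      then have "(LEAST n. d1 - 3 + int n \<in> W) \<le> nat (d - (d1 - 3))" by (rule Least_le)
      then show ?thesis using \<open>d \<ge> d1 - 3\<close> unfolding d0_def by linarith
    qed
    define h where "h = (N * N - N) div 2"
    have h: "2 * h = N * N - N"
    proof -
      have "even (N * N - N)" by simp
      then show ?thesis unfolding h_def by simp
    qed
    \<comment> \<open>A shift moving \<open>\<sigma>\<close> from one index to the other changes
      their difference by the even number \<open>2 * \<sigma>\<close>, so the least difference can
      be brought to -2 or -1, and by \<open>diff\<close> all of them into the range from -2 to 2.
      Two indices of sum at least N - 2 \<ge> 2 are then nonnegative.\<close>
    define \<sigma> where "\<sigma> = - ((d0 + 2) div 2)"
    have \<sigma>: "d0 + 2 * \<sigma> = - 2 \<or> d0 + 2 * \<sigma> = - 1" unfolding \<sigma>_def by presburger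
    \<comment> \<open>The sum \<open>N - N * N\<close> turns indices of the finer subdivision into
      indices for N with the same orientation, and \<open>s i = 0\<close> puts the centre on the
      line of the side. The centre can lie outside the side itself, which is why \<open>edge\<close>
      speaks of the whole line.\<close>
    define s where "s = (\<lambda>q. if q = i then 0 else if q = j then - h - \<sigma> else - h + \<sigma>)"
    have s: "s i = 0" "s j = - h - \<sigma>" "s l = - h + \<sigma>" using T by (auto simp: s_def)
    have ssum: "sum s UNIV = N - N * N" using h by (simp add: sum_triple[OF T] s)
    define x0 where "x0 = mk (\<lambda>q. s q / (N - N * N)) 0"
    have nz: "real_of_int (N - N * N) \<noteq> 0" using N4 by (simp flip: of_int_mult)
    have bx0: "bc x0 q = s q / (N - N * N)" for q
      unfolding x0_def
    proof (rule bc_mk)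
      have "(\<Sum>q\<in>UNIV. real_of_int (s q)) = N - N * N" using ssum by (simp flip: of_int_sum)
      then show "(\<Sum>i\<in>UNIV. real_of_int (s i) / real_of_int (N - N * N)) = 1"
        using nz by (simp flip: sum_divide_distrib)
    qed
    have AB: "A x0 = B x0" by (rule E1) (use bx0 s in \<open>simp_all add: x0_def\<close>)
    have shift: "Pl (\<lambda>q. a q + s q) \<in> codes N \<and> (\<forall>y. hom x0 N (pl (N * N) a y) = pl N (\<lambda>q. a q + s q) y)"
      if a: "D a" "a l - a j \<in> W" for a
    proof
      define b where "b = (\<lambda>q. a q + s q)"
      have sb: "sum b UNIV = sum a UNIV + (N - N * N)"
        using ssum by (simp add: b_def sum.distrib)
      have ba: "box (N * N) a" using a by (simp add: D_def)
      have bb: "box N b" using ba by (auto simp: box_def sb)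
      have bi: "b i = 0" using a by (simp add: D_def b_def s)
      have lj: "- 2 \<le> b l - b j" "b l - b j \<le> 2"
        using diff[OF d0 a(2)] d0_le[OF a(2)] \<sigma> by (auto simp: b_def s)
      have "b l + b j \<ge> N - 2" using bb bi by (auto simp: box_def sum_triple[OF T])
      then have "b l \<ge> 0" "b j \<ge> 0" using lj N4 by auto
      then have "0 \<le> b q" for q using bi triple_cases[OF T(1), of q] by auto
      moreover have "b \<noteq> mid N" using bi kappa(1) by (auto simp: mid_def)
      ultimately show "Pl b \<in> codes N" using bb by (simp add: Pl_codes)
      show "\<forall>y. hom x0 N (pl (N * N) a y) = pl N b y"
      proof (intro allI pt_eqI)
        fix y q
        have e: "s q = (N - N * N) * bc x0 q" using bx0 nz by simp
        have "sum b UNIV = N - 1 \<longleftrightarrow> sum a UNIV = N * N - 1" by (auto simp: sb)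
        moreover have "real_of_int (b q) = a q + (N - N * N) * bc x0 q" by (simp add: b_def e)
        ultimately show "bc (hom x0 N (pl (N * N) a y)) q = bc (pl N b y) q"
          unfolding bc_hom bc_pl[OF NN(1) ba] bc_pl[OF Npos(1) bb]
          by (cases "sum a UNIV = N * N - 1"; simp; simp add: field_simps)
      next
        show "ht (hom x0 N (pl (N * N) a y)) = ht (pl N b y)" for y
          by (simp add: ht_hom ht_pl x0_def)
      qed
    qed
    have *: "\<exists>S S'. adm N (Suc 2) S \<and> adm N 2 S' \<and> C x \<in> S ` K \<and> (\<forall>x. hom (A x0) N (S x) = S' x)"
      if C: "adm N 1 C" "C x0 = A x0" and v: "v \<in> U" "R v x" for C x v
    proof -
      obtain a y where a: "D a" "y \<in> K" "x = pl (N * N) a y" using cell[OF v] by blast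
      then have "a l - a j \<in> W" using v unfolding W_def by blast
      note sh = shift[OF a(1) this]
      show ?thesis
      proof (intro exI conjI allI)
        show "adm N (Suc 2) (\<lambda>x. C (pl (N * N) a x))"
          using adm_comp[OF C(1), of 2 "pl (N * N) a"] a by (simp add: D_def numeral_eq_Suc)
        show "adm N 2 (\<lambda>x. C (pl N (\<lambda>q. a q + s q) x))"
          using adm_comp[OF C(1) pl_gm[OF sh[THEN conjunct1]]] by (simp add: numeral_2_eq_2)
        show "C x \<in> (\<lambda>x. C (pl (N * N) a x)) ` K" using a by blast
        show "hom (A x0) N (C (pl (N * N) a x)) = C (pl N (\<lambda>q. a q + s q) x)" for x
          using affD[OF aff_adm[OF C(1)], of x0 N "pl (N * N) a x"] C(2) sh by simp
      qed
    qed
    show ?thesis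
      unfolding scalable_def
    proof (intro exI[of _ "A x0"] exI[of _ 2] ballI)
      fix v assume v: "v \<in> U"
      obtain x where x: "R v x" using Rex[OF v] by blast
      show "\<exists>S S'. adm N (Suc 2) S \<and> adm N 2 S' \<and> v \<in> S ` K \<and> (\<forall>x. hom (A x0) N (S x) = S' x)"
        using *[OF A _ v x] *[OF B _ v x] x AB by (auto simp: R_def)
    qed
  qed
qed

end

section \<open>Small sets near the middle triangle\<close>

text \<open>The 1-cells seen in coordinates in which the middle triangle becomes the unit triangle.\<close>

fun ma :: "code \<Rightarrow> pt \<Rightarrow> pt" where
  "ma (Pl k) = pl 1 k"
| "ma (Lt j) = lt j"

fun mc :: "code \<Rightarrow> bool" where
  "mc (Pl k) \<longleftrightarrow> box 1 k \<and> k \<noteq> (\<lambda>_. 0)"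
| "mc (Lt j) \<longleftrightarrow> True"

section \<open>Separation of cells and lattice vertices\<close>

lemma bc_kv: "bc (kv l) i = (if i = l then 1 else 0)"
  by (simp add: bc_def kv_inner)

lemma kv_3: "kv l $ 3 = 0"
  by (simp add: kv_def kv1_def kv2_def kv3_def)

lemma ht_kv: "ht (kv l) = 0"
  by (simp add: ht_def kv_3)

text \<open>The functionals that separate neighbouring cells, for sets of diameter at most
  \<open>sqrt (2/3) * \<epsilon>\<close>: the Lipschitz constant \<open>sqrt (3/2)\<close> gives
  \<epsilon>, and \<open>sqrt (4/3)\<close> gives \<open>sqrt (8/9) * \<epsilon>\<close>, below
  19/20 * \<epsilon>.\<close>

definition close :: "real \<Rightarrow> pt set \<Rightarrow> bool" where
  "close \<epsilon> V \<longleftrightarrow> (\<forall>u\<in>V. \<forall>v\<in>V. \<bar>ht u - ht v\<bar> \<le> \<epsilon> \<and> (\<forall>i. \<bar>bc u i - bc v i\<bar> \<le> 19/20 * \<epsilon> \<and>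
     \<bar>(bc u i - ht u / 3) - (bc v i - ht v / 3)\<bar> \<le> \<epsilon>))"

text \<open>Integer triples of sum 1 are the vertices of the unit tiling. The sharper one-sided
  constant serves the lateral cells in \<open>corner_at_vertex\<close>: 13/5 + 2/3 * 7/4 < 4,
  whereas 29/10 in place of 13/5 would exceed 4.\<close>

definition near_vertex :: "real \<Rightarrow> pt set \<Rightarrow> (3 \<Rightarrow> int) \<Rightarrow> bool" where
  "near_vertex \<epsilon> V v \<longleftrightarrow> sum v UNIV = 1 \<and> (\<forall>u\<in>V. ht u \<le> 7/4 * \<epsilon> \<and>
     (\<forall>i. \<bar>bc u i - v i\<bar> \<le> 29/10 * \<epsilon> \<and> (v i = 0 \<longrightarrow> bc u i \<le> 13/5 * \<epsilon>)))"

lemma closeH: "close \<epsilon> V \<Longrightarrow> u \<in> V \<Longrightarrow> v \<in> V \<Longrightarrow> ht u \<le> ht v + \<epsilon>"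
proof -
  assume "close \<epsilon> V" "u \<in> V" "v \<in> V"
  then have "\<bar>ht u - ht v\<bar> \<le> \<epsilon>" unfolding close_def by blast
  then show "ht u \<le> ht v + \<epsilon>" by linarith
qed

lemma closeD:
  assumes "close \<epsilon> V" "u \<in> V" "v \<in> V"
  shows "bc u i \<le> bc v i + 19/20 * \<epsilon>" "bc v i \<le> bc u i + 19/20 * \<epsilon>"
proof -
  have "\<bar>bc u i - bc v i\<bar> \<le> 19/20 * \<epsilon>"
    using assms unfolding close_def by blast
  then show "bc u i \<le> bc v i + 19/20 * \<epsilon>" "bc v i \<le> bc u i + 19/20 * \<epsilon>"
    by linarith+
qed

lemma box1:
  assumes "box 1 k" "x \<in> pyr"
  shows "k i + 4/3 * ht (pl 1 k x) \<le> bc (pl 1 k x) i" "bc (pl 1 k x) i \<le> k i + 1 - 4/3 * ht (pl 1 k x)"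
  using pl_box[OF _ assms, of i] by (simp_all add: ht_pl)

lemma box1_ht: "x \<in> pyr \<Longrightarrow> 0 \<le> ht (pl 1 k x)"
  using pyrD(1) by (simp add: ht_pl)

text \<open>A line \<open>bc _ i = m\<close> runs between the two triangles. Points on its two sides
  differ in that coordinate by at least 4/3 of the sum of their heights, so these heights add up to
  at most 57/80 * \<epsilon>, and all of \<open>V\<close> is at most \<epsilon> higher.\<close>

lemma separated:
  assumes cl: "close \<epsilon> V" and k: "box 1 k" "box 1 k'" and x: "x \<in> pyr" "y \<in> pyr"
    and V: "pl 1 k x \<in> V" "pl 1 k' y \<in> V" and ne: "k i \<noteq> k' i"
  shows "\<exists>m::int. \<forall>z\<in>V. \<bar>bc z i - m\<bar> \<le> 19/20 * \<epsilon> \<and> ht z \<le> 7/4 * \<epsilon>"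
proof -
  have *: "\<exists>m::int. \<forall>z\<in>V. \<bar>bc z i - m\<bar> \<le> 19/20 * \<epsilon> \<and> ht z \<le> 7/4 * \<epsilon>"
    if k: "box 1 k" "box 1 k'" and x: "x \<in> pyr" "y \<in> pyr"
      and V: "pl 1 k x \<in> V" "pl 1 k' y \<in> V" and lt: "k i < k' i" for k k' x y
  proof (intro exI ballI)
    fix z assume z: "z \<in> V"
    have "real_of_int (k i) + 1 \<le> k' i" using lt by linarith
    note b = this box1[OF k(1) x(1), of i] box1[OF k(2) x(2), of i] box1_ht[OF x(1), of k] box1_ht[OF x(2), of k']
      closeH[OF cl z V(1)] closeD[OF cl z V(1), of i] closeD[OF cl z V(2), of i]
      closeD[OF cl V(1,2), of i]
    show "\<bar>bc z i - real_of_int (k i + 1)\<bar> \<le> 19/20 * \<epsilon> \<and> ht z \<le> 7/4 * \<epsilon>"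
      unfolding abs_le_iff of_int_add of_int_1
      using b by (intro conjI) linarith+
  qed
  show ?thesis
    using *[OF k x V] *[OF k(2,1) x(2,1) V(2,1)] linorder_less_linear[of "k i" "k' i"] ne by blast
qed

lemma near_vertexI:
  assumes "sum v UNIV = 1" "0 < \<epsilon>" "\<And>u. u \<in> V \<Longrightarrow> ht u \<le> 7/4 * \<epsilon>"
    and "UNIV = {i, j, l}" "i \<noteq> j" "i \<noteq> l" "j \<noteq> l"
    "\<And>u. u \<in> V \<Longrightarrow> v i - 19/20 * \<epsilon> \<le> bc u i" "\<And>u. u \<in> V \<Longrightarrow> bc u i \<le> v i + 19/20 * \<epsilon>"
    and "\<And>u. u \<in> V \<Longrightarrow> v j - 3/2 * \<epsilon> \<le> bc u j" "\<And>u. u \<in> V \<Longrightarrow> bc u j \<le> v j + 19/10 * \<epsilon>"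
    and "v l = 0 \<Longrightarrow> (\<And>u. u \<in> V \<Longrightarrow> bc u l \<le> 13/5 * \<epsilon>)"
  shows "near_vertex \<epsilon> V v"
  unfolding near_vertex_def
proof (intro conjI ballI allI impI)
  fix u r assume u: "u \<in> V"
  have v: "real_of_int (v l) = 1 - v i - v j"
    using assms(1) by (simp add: sum_triple[OF assms(4-7)] flip: of_int_add)
  note f = assms(2) assms(8-11)[OF u] bc_third[OF assms(5-7), of u] v
  show "\<bar>bc u r - v r\<bar> \<le> 29/10 * \<epsilon>"
    using triple_cases[OF assms(4), of r] f unfolding abs_le_iff
    by (elim disjE; (simp only:)?; intro conjI; linarith)
  assume "v r = 0"
  then show "bc u r \<le> 13/5 * \<epsilon>"
    using triple_cases[OF assms(4), of r] f assms(12)[OF _ u]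
    by (elim disjE; (simp only:)?; simp; linarith)
qed (use assms(1,3) in auto)

text \<open>\<open>V\<close> is near two lines of different directions, hence near the lattice point
  where they cross.\<close>

lemma near_vertex_planar:
  assumes e: "0 < \<epsilon>" and cl: "close \<epsilon> V" and k: "box 1 k" "box 1 k'" and x: "x \<in> pyr" "y \<in> pyr"
    and V: "pl 1 k x \<in> V" "pl 1 k' y \<in> V" and ne: "i \<noteq> j" "k i \<noteq> k' i" "k j \<noteq> k' j"
  shows "\<exists>v. near_vertex \<epsilon> V v"
proof -
  obtain l where T: "UNIV = {i, j, l}" "i \<noteq> l" "j \<noteq> l" using pair_index[OF ne(1)] .
  obtain m :: int where m: "\<And>z. z \<in> V \<Longrightarrow> \<bar>bc z i - m\<bar> \<le> 19/20 * \<epsilon>" "\<And>z. z \<in> V \<Longrightarrow> ht z \<le> 7/4 * \<epsilon>"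
    using separated[OF cl k x V ne(2)] by blast
  obtain n :: int where n: "\<And>z. z \<in> V \<Longrightarrow> \<bar>bc z j - n\<bar> \<le> 19/20 * \<epsilon>"
    using separated[OF cl k x V ne(3)] by blast
  define v where "v = (\<lambda>q. if q = i then m else if q = j then n else 1 - m - n)"
  have v: "v i = m" "v j = n" "v l = 1 - m - n" using T ne(1) by (auto simp: v_def)
  have "near_vertex \<epsilon> V v"
  proof (rule near_vertexI[OF _ e m(2) T(1) ne(1) T(2,3)])
    show "sum v UNIV = 1" using v T ne(1) by (simp add: sum_triple[OF T(1) ne(1) T(2,3)])
    fix u assume u: "u \<in> V"
    show "v i - 19/20 * \<epsilon> \<le> bc u i" "bc u i \<le> v i + 19/20 * \<epsilon>"
      "v j - 3/2 * \<epsilon> \<le> bc u j" "bc u j \<le> v j + 19/10 * \<epsilon>"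
      using m(1)[OF u] n[OF u] e unfolding v by linarith+
    assume "v l = 0"
    then have "real_of_int m + n = 1" using v by linarith
    then show "bc u l \<le> 13/5 * \<epsilon>"
      using m(1)[OF u] n[OF u] e bc_third[OF ne(1) T(2,3), of u] by linarith
  qed
  then show ?thesis by blast
qed

text \<open>The excluded triangles are the base of the tetrahedron and its neighbour across edge
  \<open>j\<close>. If \<open>k i \<le> -1\<close> for some \<open>i\<close> other than
  \<open>j\<close>, nearness makes \<open>bc x i\<close>, \<open>bc x j\<close> and
  \<open>ht x\<close> all small and leaves the third vertex; otherwise \<open>k j \<le> -1\<close>
  and some \<open>k i \<ge> 1\<close>, and the vertex is \<open>i\<close>.\<close>

lemma near_vertex_lateral:
  assumes e: "0 < \<epsilon>" and cl: "close \<epsilon> V" and k: "box 1 k" "k \<noteq> (\<lambda>_. 0)"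
    "k \<noteq> (\<lambda>q. if q = j then -1 else 0)" and x: "x \<in> pyr" "y \<in> pyr"
    and V: "lt j x \<in> V" "pl 1 k y \<in> V"
  shows "\<exists>v. near_vertex \<epsilon> V v"
proof -
  define p q where "p = lt j x" and "q = pl 1 k y"
  have pq: "p \<in> V" "q \<in> V" using V by (auto simp: p_def q_def)
  have "(\<exists>i. i \<noteq> j \<and> k i \<le> -1) \<or> (k j \<le> -1 \<and> (\<exists>i. i \<noteq> j \<and> k i \<ge> 1))"
  proof -
    obtain i l where T: "UNIV = {j, i, l}" "j \<noteq> i" "j \<noteq> l" "i \<noteq> l" by (metis triple_index)
    have "k j + (k i + k l) = 0 \<or> k j + (k i + k l) = -1"
      using k(1) by (simp add: box_def sum_triple[OF T])
    moreover have "\<not> (k j = 0 \<and> k i = 0 \<and> k l = 0)"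
    proof
      assume "k j = 0 \<and> k i = 0 \<and> k l = 0"
      then have "k q = 0" for q using triple_cases[OF T(1), of q] by auto
      then show False using k(2) by blast
    qed
    moreover have "\<not> (k j = -1 \<and> k i = 0 \<and> k l = 0)"
    proof
      assume "k j = -1 \<and> k i = 0 \<and> k l = 0"
      then have "k q = (if q = j then -1 else 0)" for q using triple_cases[OF T(1), of q] T by auto
      then show False using k(3) by blast
    qed
    ultimately have "(k i \<le> -1 \<or> k l \<le> -1) \<or> (k j \<le> -1 \<and> (k i \<ge> 1 \<or> k l \<ge> 1))" by linarith
    then show ?thesis using T by metis
  qed
  then show ?thesis
  proof (elim disjE exE conjE)
    fix i assume i: "i \<noteq> j" "k i \<le> -1"
    obtain l where T: "UNIV = {i, j, l}" "i \<noteq> l" "j \<noteq> l" using pair_index[OF i(1)] .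
    define v where "v = (\<lambda>q. if q = l then 1 else 0 :: int)"
    have v: "v i = 0" "v j = 0" "v l = 1" using T by (auto simp: v_def)
    have p: "bc p i = bc x i + bc x j / 3 + 4/9 * ht x" "bc p j = bc x j / 3 - 8/9 * ht x"
      "ht p = bc x j + ht x / 3"
      using i(1) by (auto simp: p_def bc_lt ht_lt)
    have "real_of_int (k i) \<le> -1" using i(2) by linarith
    note facts = this box1_ht[OF x(2), of k, folded q_def] closeH[OF cl pq] closeH[OF cl pq(2,1)] box1[OF k(1) x(2), of i, folded q_def] pyrD(1)[OF x(1)] pyrD(2)[OF x(1), of i]
      pyrD(2)[OF x(1), of j] p e closeD[OF cl pq, of i] closeD[OF cl pq, of j]
    have main: "ht u \<le> 7/4 * \<epsilon> \<and> -19/20 * \<epsilon> \<le> bc u i \<and> bc u i \<le> 19/20 * \<epsilon> \<and> -6/5 * \<epsilon> \<le> bc u j \<and> bc u j \<le> 19/10 * \<epsilon>"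
      if u: "u \<in> V" for u
      unfolding abs_le_iff
      using facts closeH[OF cl u pq(1)] closeH[OF cl u pq(2)] closeD[OF cl u pq(1), of i] closeD[OF cl u pq(1), of j] closeD[OF cl u pq(2), of i]
        closeD[OF cl u pq(2), of j]
      by (intro conjI) linarith+
    have "near_vertex \<epsilon> V v"
    proof (rule near_vertexI[OF _ e _ T(1) i(1) T(2,3)])
      show "sum v UNIV = 1" using v by (simp add: sum_triple[OF T(1) i(1) T(2,3)])
      fix u assume u: "u \<in> V"
      show "ht u \<le> 7/4 * \<epsilon>" using main[OF u] by blast
      show "v i - 19/20 * \<epsilon> \<le> bc u i" "bc u i \<le> v i + 19/20 * \<epsilon>"
        "v j - 3/2 * \<epsilon> \<le> bc u j" "bc u j \<le> v j + 19/10 * \<epsilon>"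
        using main[OF u] v e by simp_all
      assume "v l = 0"
      then show "bc u l \<le> 13/5 * \<epsilon>"
        using main[OF u] v e bc_third[OF i(1) T(2,3), of u] by simp
    qed
    then show ?thesis by blast
  next
    fix i assume i: "i \<noteq> j" "k j \<le> -1" "k i \<ge> 1"
    obtain l where T: "UNIV = {i, j, l}" "i \<noteq> l" "j \<noteq> l" using pair_index[OF i(1)] .
    define v where "v = (\<lambda>q. if q = i then 1 else 0 :: int)"
    have v: "v i = 1" "v j = 0" "v l = 0" using T i(1) by (auto simp: v_def)
    have p: "bc p i = bc x i + bc x j / 3 + 4/9 * ht x" "bc p j = bc x j / 3 - 8/9 * ht x"
      "ht p = bc x j + ht x / 3"
      using i(1) by (auto simp: p_def bc_lt ht_lt)
    have "real_of_int (k j) \<le> -1" "real_of_int (k i) \<ge> 1" using i(2,3) by linarith+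
    note facts = this box1_ht[OF x(2), of k, folded q_def] closeH[OF cl pq] closeH[OF cl pq(2,1)] box1[OF k(1) x(2), of i, folded q_def] box1[OF k(1) x(2), of j, folded q_def]
      pyrD(1)[OF x(1)] pyrD(2)[OF x(1), of i] pyr_pair[OF x(1) i(1)]
      pyrD(2)[OF x(1), of j] p e closeD[OF cl pq, of i] closeD[OF cl pq, of j] closeD[OF cl pq(2,1), of j]
    have main: "ht u \<le> 7/4 * \<epsilon> \<and> 1 - 19/20 * \<epsilon> \<le> bc u i \<and> bc u i \<le> 1 + 19/20 * \<epsilon> \<and> -3/2 * \<epsilon> \<le> bc u j \<and> bc u j \<le> 19/20 * \<epsilon>"
      if u: "u \<in> V" for u
      unfolding abs_le_iff
      using facts closeH[OF cl u pq(1)] closeH[OF cl u pq(2)] closeD[OF cl u pq(1), of i] closeD[OF cl u pq(1), of j] closeD[OF cl u pq(2), of i]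
        closeD[OF cl u pq(2), of j]
      by (intro conjI) linarith+
    have "near_vertex \<epsilon> V v"
    proof (rule near_vertexI[OF _ e _ T(1) i(1) T(2,3)])
      show "sum v UNIV = 1" using v by (simp add: sum_triple[OF T(1) i(1) T(2,3)])
      fix u assume u: "u \<in> V"
      show "ht u \<le> 7/4 * \<epsilon>" using main[OF u] by blast
      show "v i - 19/20 * \<epsilon> \<le> bc u i" "bc u i \<le> v i + 19/20 * \<epsilon>"
        "v j - 3/2 * \<epsilon> \<le> bc u j" "bc u j \<le> v j + 19/10 * \<epsilon>"
        using main[OF u] v e by simp_all
      assume "v l = 0"
      then show "bc u l \<le> 13/5 * \<epsilon>"
        using main[OF u] v e bc_third[OF i(1) T(2,3), of u] by simp
    qed
    then show ?thesis by blast
  qed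
qed

lemma unit_vector:
  fixes w :: "3 \<Rightarrow> int"
  assumes "\<And>i. -1 < w i" "sum w UNIV = 1"
  obtains l where "w = (\<lambda>i. if i = l then 1 else 0)"
proof -
  have nn: "0 \<le> w i" for i using assms(1)[of i] by simp
  have "\<exists>l. w l \<noteq> 0" using assms(2) by (metis sum.neutral zero_neq_one)
  then obtain l where l: "w l \<noteq> 0" by blast
  obtain i j where T: "UNIV = {l, i, j}" "l \<noteq> i" "l \<noteq> j" "i \<noteq> j" by (metis triple_index)
  have "w l = 1 \<and> w i = 0 \<and> w j = 0"
    using assms(2) nn[of l] nn[of i] nn[of j] l by (simp add: sum_triple[OF T])
  then have "w i = (if i = l then 1 else 0)" for i
    using triple_cases[OF T(1), of i] T by auto
  then show thesis using that[of l] by blast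
qed

text \<open>All cells meeting \<open>V\<close> thus have one common vertex. The coordinates of the
  lattice point with respect to a planar cell are integers greater than -1 of sum 1, hence a unit
  vector. In the lateral case the bounds on \<open>bc x j\<close> and on the third coordinate
  combine to less than 4 * \<epsilon>.\<close>

lemma corner_at_vertex:
  assumes e: "0 < \<epsilon>" "\<epsilon> \<le> 1/16" and nv: "near_vertex \<epsilon> V v" and d: "mc d" and x: "x \<in> pyr"
    and u: "ma d x \<in> V"
  shows "\<exists>l. ma d (kv l) = mk v 0 \<and> bc x l > 1 - 4 * \<epsilon>"
proof -
  have sv: "sum v UNIV = 1" using nv by (simp add: near_vertex_def)
  have bv: "bc (mk v 0) i = v i" for i
  proof (rule bc_mk)
    show "(\<Sum>i\<in>UNIV. real_of_int (v i)) = 1" using sv by (simp flip: of_int_sum)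
  qed
  have n: "\<bar>bc (ma d x) i - v i\<bar> \<le> 29/10 * \<epsilon>" "v i = 0 \<Longrightarrow> bc (ma d x) i \<le> 13/5 * \<epsilon>"
    "ht (ma d x) \<le> 7/4 * \<epsilon>" for i
    using nv u unfolding near_vertex_def by blast+
  show ?thesis
  proof (cases d)
    case (Pl k)
    have b: "box 1 k" using d Pl by simp
    define w where "w = (\<lambda>i. if sum k UNIV = 0 then v i - k i else k i + 1 - v i)"
    have bx: "bc (pl 1 k x) i = (if sum k UNIV = 0 then k i + bc x i else k i + 1 - bc x i)" for x i
      using bc_pl[of 1 k x i] b by simp
    have xw: "\<bar>bc x i - w i\<bar> \<le> 29/10 * \<epsilon>" for i
    proof -
      have "\<bar>bc (pl 1 k x) i - v i\<bar> = \<bar>bc x i - w i\<bar>"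
        by (simp add: bx w_def abs_if)
      then show ?thesis using n(1)[of i] Pl by simp
    qed
    have "-1 < w i" for i
    proof -
      have "-1 < real_of_int (w i)" using xw[of i] pyr_nonneg[OF x, of i] e by linarith
      then show ?thesis by linarith
    qed
    moreover have "sum w UNIV = 1"
      using b sv by (auto simp: box_def w_def sum_subtractf sum.distrib)
    ultimately obtain l where l: "w = (\<lambda>i. if i = l then 1 else 0)" using unit_vector by blast
    have "ma d (kv l) = mk v 0"
    proof (rule pt_eqI)
      fix i
      have "(if i = l then 1 else 0) = w i" using l by simp
      then show "bc (ma d (kv l)) i = bc (mk v 0) i"
        unfolding Pl ma.simps bx bv bc_kv by (auto simp: w_def split: if_splits)
    qed (simp add: Pl ht_pl ht_kv)
    moreover have "bc x l > 1 - 4 * \<epsilon>"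
    proof -
      have wl: "real_of_int (w l) = 1" using l by simp
      show ?thesis using xw[of l] e unfolding wl by linarith
    qed
    ultimately show ?thesis by blast
  next
    case (Lt j)
    obtain i1 i2 where T: "UNIV = {j, i1, i2}" "j \<noteq> i1" "j \<noteq> i2" "i1 \<noteq> i2" by (metis triple_index)
    have p: "bc (ma d x) j = bc x j / 3 - 8/9 * ht x" "ht (ma d x) = bc x j + ht x / 3"
      "\<And>i. i \<noteq> j \<Longrightarrow> bc (ma d x) i = bc x i + bc x j / 3 + 4/9 * ht x"
      by (auto simp: Lt bc_lt ht_lt)
    note b = pyrD(1)[OF x] pyrD(2)[OF x, of j] e
    have "\<bar>real_of_int (v j)\<bar> < 1"
      using n(1)[of j] n(3) b p(1,2) unfolding abs_le_iff abs_less_iff by linarith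
    then have vj: "v j = 0" by linarith
    have "-1 < v i" for i
    proof (cases "i = j")
      case False
      have "-1 < real_of_int (v i)"
        using n(1)[of i] p(3)[OF False] b pyrD(2)[OF x, of i] unfolding abs_le_iff by linarith
      then show ?thesis by linarith
    qed (use vj in simp)
    then obtain l where l: "v = (\<lambda>i. if i = l then 1 else 0)" using unit_vector sv by blast
    have lj: "l \<noteq> j" using l vj by auto
    obtain i where T: "UNIV = {l, j, i}" "l \<noteq> i" "j \<noteq> i" using pair_index[OF lj] .
    have "bc (ma d x) i \<le> 13/5 * \<epsilon>" using n(2)[of i] l T by auto
    then have "bc x l > 1 - 4 * \<epsilon>"
      using b n(3) p(2) p(3)[of i] T(3) bc_third[OF lj T(2,3), of x] by simp
    moreover have "ma d (kv l) = mk v 0"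
    proof (rule pt_eqI)
      have vi: "v i = (if i = l then 1 else 0)" for i using l by simp
      show "bc (ma d (kv l)) i = bc (mk v 0) i" for i
        unfolding bv Lt ma.simps bc_lt bc_kv ht_kv using lj by (auto simp: vi)
    qed (use lj in \<open>simp add: Lt ht_lt bc_kv ht_kv\<close>)
    ultimately show ?thesis by blast
  qed
qed

definition ngb :: "3 \<Rightarrow> (3 \<Rightarrow> int) \<Rightarrow> 3 \<Rightarrow> int" where "ngb i a = (\<lambda>q. if q = i then a q - 1 else a q)"

text \<open>The half turn about the midpoint of side \<open>i\<close> exchanges the end points of
  that side; the transposition puts them back, and a reflection in the side remains.\<close>

lemma pl_ngb:
  assumes "sum a UNIV = 0" "UNIV = {i, j, l}" "i \<noteq> j" "i \<noteq> l" "j \<noteq> l"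
  shows "box 1 a" "box 1 (ngb i a)" "pl 1 (ngb i a) (tau (Transposition.transpose j l) x) = pl 1 a (rf i x)"
proof -
  note T = assms(2-)
  have s: "sum (ngb i a) UNIV = -1" using assms(1) T by (simp add: ngb_def sum_triple[OF T])
  show b: "box 1 a" "box 1 (ngb i a)" using assms(1) s by (auto simp: box_def)
  have bij: "bij (Transposition.transpose j l)" by simp
  show "pl 1 (ngb i a) (tau (Transposition.transpose j l) x) = pl 1 a (rf i x)"
  proof (rule pt_eqI)
    fix q
    have 1: "bc (pl 1 (ngb i a) y) q = ngb i a q + 1 - bc y q" for y
      unfolding bc_pl[OF zero_less_one b(2)] using s by simp
    have 2: "bc (pl 1 a y) q = a q + bc y q" for y
      unfolding bc_pl[OF zero_less_one b(1)] using assms(1) by simp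
    note ne = T(2-4) T(2-4)[symmetric]
    from triple_cases[OF T(1), of q]
    show "bc (pl 1 (ngb i a) (tau (Transposition.transpose j l) x)) q = bc (pl 1 a (rf i x)) q"
      unfolding 1 2 bc_rf bc_tau[OF bij]
      using bc_third[OF T(2,3,4), of x] ne
      by (elim disjE; simp add: ngb_def Transposition.transpose_def)
  qed (simp add: ht_pl ht_tau ht_rf)
qed

lemma pl_zero: "pl 1 (\<lambda>_. 0) x = x"
proof (rule pt_eqI)
  have b: "box 1 (\<lambda>_. 0)" by (simp add: box_def)
  show "bc (pl 1 (\<lambda>_. 0) x) i = bc x i" for i
    unfolding bc_pl[OF zero_less_one b] by simp
qed (simp add: ht_pl)

section \<open>Indices of the 1-cells relative to the middle triangle\<close>

context koch_scale
begin

text \<open>If the middle triangle is inverted, its coordinates run backwards, which reverses the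
  sign of the relative index.\<close>

fun hat :: "code \<Rightarrow> code" where
  "hat (Pl k) = Pl (\<lambda>i. if up then k i - N div 3 else N div 3 - k i)"
| "hat (Lt j) = Lt j"

lemma sum_mid: "N = 3 * (N div 3) + (if up then 1 else 2)"
proof (cases up)
  case True
  show ?thesis unfolding if_P[OF True] using True unfolding up_def .
next
  case False
  then show ?thesis using kappa(2) unfolding if_not_P[OF False] by (simp only: up_def) blast
qed

lemma mc_hat:
  assumes "c \<in> codes N"
  shows "mc (hat c)"
proof (cases c)
  case (Pl k)
  obtain q where q: "N div 3 = q" "N = 3 * q + (if up then 1 else 2)" using sum_mid by blast
  have k: "box N k" "k \<noteq> mid N" using assms Pl by (auto simp: Pl_codes)
  have "(\<lambda>i. if up then k i - q else q - k i) \<noteq> (\<lambda>_. 0)"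
  proof
    assume *: "(\<lambda>i. if up then k i - q else q - k i) = (\<lambda>_. 0)"
    have "k i = q" for i using fun_cong[OF *, of i] by (auto split: if_splits)
    then show False using k(2) q(1) by (auto simp: mid_def)
  qed
  moreover have "box 1 (\<lambda>i. if up then k i - q else q - k i)"
    using k(1) q(2) by (cases up) (auto simp: box_def sum_subtractf)
  ultimately show ?thesis unfolding Pl hat.simps mc.simps q(1) by blast
qed simp

lemma gm_ma:
  assumes "c \<in> codes N"
  shows "gm N c x = pl N (mid N) (ma (hat c) x)"
proof (cases c)
  case (Pl k)
  have b: "box 1 (\<lambda>i. if up then k i - N div 3 else N div 3 - k i)" using mc_hat[OF assms] Pl by simp
  have "(\<lambda>i. if sum (mid N) UNIV = N - 1 then 1 * mid N i + (if up then k i - N div 3 else N div 3 - k i)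
      else 1 * (mid N i + 1) - (if up then k i - N div 3 else N div 3 - k i) - 1) = k"
    unfolding mid_up by (rule ext) (simp add: mid_def)
  then show ?thesis
    using pl_comp(2)[OF Npos(1) zero_less_one box_mid' b, of x] Pl by simp
qed simp

lemma hat_inj: "hat c = hat c' \<Longrightarrow> c = c'"
  by (cases c; cases c') (auto simp: fun_eq_iff split: if_splits)

end

section \<open>Small sets that meet several 1-cells are scalable\<close>

context koch_attractor
begin

text \<open>Each point lies in the corner 2-cell at \<open>P\<close> of its 1-cell, and the
  homothety of ratio N about \<open>P\<close> carries every such 2-cell onto its 1-cell, however
  many cells meet there.\<close>

lemma vertex_scalable:
  assumes "\<And>u. u \<in> U \<Longrightarrow> \<exists>c\<in>codes N. \<exists>x\<in>K. \<exists>l. u = gm N c x \<and> gm N c (kv l) = P \<and> N * bc x l > N - 1"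
  shows "scalable U"
  unfolding scalable_def
proof (intro exI[of _ P] exI[of _ 1] ballI)
  fix u assume "u \<in> U"
  then obtain c x l where c: "c \<in> codes N" "x \<in> K" "u = gm N c x" "gm N c (kv l) = P" "N * bc x l > N - 1"
    using assms by blast
  obtain d y where d: "d \<in> codes N" "y \<in> K" "x = gm N d y" using K_cases[OF c(2)] .
  have yp: "y \<in> pyr" "x \<in> pyr" using c d K_pyr by auto
  have "N * bc x l \<le> N * (bc x l + 4/15 * ht x)"
    using pyrD(1)[OF yp(2)] by simp
  then have "N * (bc x l + 4/15 * ht x) > N - 1" using c(5) by linarith
  then have "d = Pl (corner N l)"
    using corner_cell[OF d(1) yp(1), of l] unfolding d(3) by blast
  then have xy: "x = pl N (corner N l) y" using d by simp
  have h: "hom (kv l) N (pl N (corner N l) y) = y" for y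
  proof (rule pt_eqI)
    obtain i j where T: "UNIV = {l, i, j}" "l \<noteq> i" "l \<noteq> j" "i \<noteq> j" by (metis triple_index)
    have s: "sum (corner N l) UNIV = N - 1" using T by (simp add: sum_triple[OF T] corner_def)
    have b: "box N (corner N l)" using corner_codes by (simp add: Pl_codes)
    show "bc (hom (kv l) N (pl N (corner N l) y)) q = bc y q" for q
      unfolding bc_hom bc_pl[OF Npos(1) b] if_P[OF s] bc_kv
      by (auto simp: corner_def right_diff_distrib)
  qed (simp add: ht_hom ht_pl ht_kv)
  show "\<exists>S S'. adm N (Suc 1) S \<and> adm N 1 S' \<and> u \<in> S ` K \<and> (\<forall>x. hom P N (S x) = S' x)"
  proof (intro exI conjI allI)
    show "adm N (Suc 1) (\<lambda>x. gm N c (pl N (corner N l) x))"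
      using adm_comp[OF adm_gm[OF c(1)] pl_gm[OF corner_codes]] by simp
    show "adm N 1 (gm N c)" using adm_gm[OF c(1)] .
    show "u \<in> (\<lambda>x. gm N c (pl N (corner N l) x)) ` K" using c(3) xy d(2) by blast
    show "hom P N (gm N c (pl N (corner N l) x)) = gm N c x" for x
      using affD[OF aff_adm[OF adm_gm[OF c(1)]], of "kv l" N "pl N (corner N l) x"] c(4) h by simp
  qed
qed

lemma edge_tau_scalable:
  assumes c: "c \<in> codes N" "c' \<in> codes N" and \<pi>: "bij \<pi>"
    and E: "edge 1 i (ma (hat c)) (\<lambda>x. ma (hat c') (tau \<pi> x))"
    and U: "U \<subseteq> gm N c ` K \<union> gm N c' ` K" "U \<inter> gm N c ` K \<noteq> {}" "U \<inter> gm N c' ` K \<noteq> {}"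
    and small: "\<And>u v. u \<in> U \<Longrightarrow> v \<in> U \<Longrightarrow> dist u v < sqrt (2/3) / N ^ 3"
  shows "scalable U"
proof (rule scalable_edge[where A = "gm N c" and B = "\<lambda>x. gm N c' (tau \<pi> x)"])
  show "adm N 1 (gm N c)" using adm_gm[OF c(1)] .
  show "adm N 1 (\<lambda>x. gm N c' (tau \<pi> x))" using adm_comp[OF adm_gm[OF c(2)] adm_0[OF \<pi>]] by simp
  show "edge N i (gm N c) (\<lambda>x. gm N c' (tau \<pi> x))"
  proof -
    have "gm N c = (\<lambda>x. pl N (mid N) (ma (hat c) x))" using gm_ma[OF c(1)] by blast
    then show ?thesis using edge_pl[OF E Npos(1) box_mid'] gm_ma[OF c(2)] by simp
  qed
  have "(\<lambda>x. gm N c' (tau \<pi> x)) ` K = gm N c' ` K"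
    using K_tau_image[OF \<pi>] by (metis image_image)
  then show "U \<subseteq> gm N c ` K \<union> (\<lambda>x. gm N c' (tau \<pi> x)) ` K" "U \<inter> (\<lambda>x. gm N c' (tau \<pi> x)) ` K \<noteq> {}"
    using U by simp_all
qed (use U small in auto)

lemma edge_planar:
  assumes "box 1 a" "box 1 b" "i \<noteq> j" "i \<noteq> l" "j \<noteq> l" "\<And>q. q \<noteq> i \<Longrightarrow> a q = b q" "a i \<noteq> b i" "sum a UNIV = 0"
  shows "edge 1 i (pl 1 a) (\<lambda>x. pl 1 b (tau (Transposition.transpose j l) x))"
proof -
  have T: "UNIV = {i, j, l}" using triple_UNIV[OF assms(3-5)] .
  have "b i = a i - 1"
    using assms(2,6-8) assms(3-5) unfolding box_def sum_triple[OF T assms(3-5)] by (auto; metis)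
  then have b: "b = ngb i a" using assms(6) by (auto simp: ngb_def)
  show ?thesis
    using edge_pl[OF edge_flat[of i] zero_less_one assms(1)] unfolding b pl_ngb(3)[OF assms(8) T assms(3-5)] by simp
qed

lemma edge_planar_lateral:
  assumes "i \<noteq> j" "i \<noteq> l" "j \<noteq> l"
  shows "edge 1 i (lt i) (\<lambda>x. pl 1 (ngb i (\<lambda>_. 0)) (tau (Transposition.transpose j l) x))"
  using edge_base[of i] unfolding pl_ngb(3)[of "\<lambda>_. 0", OF _ triple_UNIV[OF assms] assms, simplified] pl_zero .

text \<open>Away from vertices few combinations of 1-cells remain: planar ones differ pairwise in a
  single index, and a lateral one tolerates only the planar one across its base edge. So
  \<open>U\<close> meets two cells with a common edge, or all three lateral faces, which meet at the
  apex.\<close>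

lemma small_dichotomy:
  assumes UK: "U \<subseteq> K" and small: "\<And>u v. u \<in> U \<Longrightarrow> v \<in> U \<Longrightarrow> dist u v < sqrt (2/3) / N ^ 3"
    and single: "\<And>c. c \<in> codes N \<Longrightarrow> \<not> U \<subseteq> gm N c ` K"
  shows "scalable U"
proof -
  define \<epsilon> where "\<epsilon> = 1 / (real_of_int N)\<^sup>2"
  have e0: "0 < \<epsilon>" by (simp add: \<epsilon>_def)
  have e16: "\<epsilon> \<le> 1/16"
  proof -
    have "4\<^sup>2 \<le> (real_of_int N)\<^sup>2" using N4 by (intro power_mono) auto
    then show ?thesis by (simp add: \<epsilon>_def field_simps)
  qed
  have e4: "N * (4 * \<epsilon>) \<le> 1" using N4 by (simp add: \<epsilon>_def power2_eq_square)
  define V where "V = {w. pl N (mid N) w \<in> U}"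
  have cl: "close \<epsilon> V"
    unfolding close_def
  proof (intro ballI)
    fix u v assume uv: "u \<in> V" "v \<in> V"
    have "dist u v = N * dist (pl N (mid N) u) (pl N (mid N) v)" by (simp add: dist_pl)
    also have "\<dots> \<le> N * (sqrt (2/3) / N ^ 3)"
      using small[of "pl N (mid N) u" "pl N (mid N) v"] uv N4 by (intro mult_left_mono) (auto simp: V_def)
    also have "\<dots> = sqrt (2/3) * \<epsilon>" by (simp add: \<epsilon>_def power2_eq_square power3_eq_cube)
    finally have d: "dist u v \<le> sqrt (2/3) * \<epsilon>" .
    have "sqrt (3/2) * sqrt (2/3) = (1::real)" by (simp flip: real_sqrt_mult)
    then have d1: "sqrt (3/2) * dist u v \<le> \<epsilon>"
      using mult_left_mono[OF d, of "sqrt (3/2)"] by (simp flip: mult.assoc)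
    have s: "sqrt (4/3) * sqrt (2/3) \<le> (19/20::real)"
      unfolding real_sqrt_mult[symmetric] by (rule real_le_lsqrt) (auto simp: power2_eq_square)
    have "sqrt (4/3) * dist u v \<le> sqrt (4/3) * sqrt (2/3) * \<epsilon>"
      using mult_left_mono[OF d, of "sqrt (4/3)"] by (simp add: mult.assoc)
    also have "\<dots> \<le> 19/20 * \<epsilon>" using mult_right_mono[OF s, of \<epsilon>] e0 by simp
    finally have d2: "sqrt (4/3) * dist u v \<le> 19/20 * \<epsilon>" .
    show "\<bar>ht u - ht v\<bar> \<le> \<epsilon> \<and> (\<forall>i. \<bar>bc u i - bc v i\<bar> \<le> 19/20 * \<epsilon> \<and>
     \<bar>(bc u i - ht u / 3) - (bc v i - ht v / 3)\<bar> \<le> \<epsilon>)"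
    proof (intro conjI allI)
      show "\<bar>ht u - ht v\<bar> \<le> \<epsilon>" using ht_dist[of u v] d1 by linarith
      show "\<bar>bc u i - bc v i\<bar> \<le> 19/20 * \<epsilon>" for i using bc_dist[of u i v] d2 by linarith
      show "\<bar>(bc u i - ht u / 3) - (bc v i - ht v / 3)\<bar> \<le> \<epsilon>" for i
        using slanted_dist[of "-1/3" u i v] d1 by simp
    qed
  qed
  define H where "H = {c \<in> codes N. U \<inter> gm N c ` K \<noteq> {}}"
  have Hcov: "\<exists>c\<in>H. \<exists>x\<in>K. u = gm N c x" if "u \<in> U" for u
    using that UK K_cases[of u] unfolding H_def by blast
  have Hx: "\<exists>x\<in>K. x \<in> pyr \<and> ma (hat c) x \<in> V \<and> gm N c x \<in> U" if "c \<in> H" for c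
    using that gm_ma K_pyr unfolding H_def V_def by auto
  have Hc: "c \<in> codes N" if "c \<in> H" for c using that by (simp add: H_def)
  have UHH: "U \<subseteq> gm N c ` K \<union> gm N c' ` K" if "H \<subseteq> {c, c'}" for c c'
    using Hcov that by fastforce
  have Hmeet: "U \<inter> gm N c ` K \<noteq> {}" if "c \<in> H" for c using that by (simp add: H_def)
  show ?thesis
  proof (cases "\<exists>v. near_vertex \<epsilon> V v")
    case True
    then obtain v where v: "near_vertex \<epsilon> V v" ..
    show ?thesis
    proof (rule vertex_scalable[where P = "pl N (mid N) (mk v 0)"])
      fix u assume u: "u \<in> U"
      obtain c x where c: "c \<in> H" "x \<in> K" "u = gm N c x" using Hcov[OF u] by blast
      have "ma (hat c) x \<in> V" using u c gm_ma[OF Hc[OF c(1)]] by (simp add: V_def)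
      then obtain l where l: "ma (hat c) (kv l) = mk v 0" "bc x l > 1 - 4 * \<epsilon>"
        using corner_at_vertex[OF e0 e16 v mc_hat[OF Hc[OF c(1)]]] c(2) K_pyr by blast
      have "N * bc x l > N * (1 - 4 * \<epsilon>)" using l(2) by (intro mult_strict_left_mono) auto
      then have "N * bc x l > N - 1" using e4 by (simp add: right_diff_distrib)
      then show "\<exists>c\<in>codes N. \<exists>x\<in>K. \<exists>l. u = gm N c x \<and> gm N c (kv l) = pl N (mid N) (mk v 0) \<and> N * bc x l > N - 1"
        using c l gm_ma[OF Hc[OF c(1)]] Hc by metis
    qed
  next
    case nv: False
    have PP: "\<exists>i. (\<forall>q. q \<noteq> i \<longrightarrow> a q = b q) \<and> a i \<noteq> b i"
      if c: "c \<in> H" "c' \<in> H" "c \<noteq> c'" "hat c = Pl a" "hat c' = Pl b" for c c' a b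
    proof -
      have "a \<noteq> b" using c hat_inj by metis
      then obtain i where i: "a i \<noteq> b i" by auto
      have ab: "box 1 a" "box 1 b" using mc_hat[OF Hc[OF c(1)]] mc_hat[OF Hc[OF c(2)]] c by auto
      obtain x y where xy: "x \<in> pyr" "pl 1 a x \<in> V" "y \<in> pyr" "pl 1 b y \<in> V"
        using Hx[OF c(1)] Hx[OF c(2)] c(4,5) by auto
      have "a q = b q" if "q \<noteq> i" for q
        using near_vertex_planar[OF e0 cl ab xy(1,3,2,4) that _ i] nv by blast
      then show ?thesis using i by blast
    qed
    have PL: "a = ngb j (\<lambda>_. 0)" if c: "Lt j \<in> H" "c \<in> H" "hat c = Pl a" for j c a
    proof -
      have a: "box 1 a" "a \<noteq> (\<lambda>_. 0)" using mc_hat[OF Hc[OF c(2)]] c by auto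
      obtain x y where xy: "x \<in> pyr" "lt j x \<in> V" "y \<in> pyr" "pl 1 a y \<in> V"
        using Hx[OF c(1)] Hx[OF c(2)] c(3) by auto
      have "a = (\<lambda>q. if q = j then -1 else 0)"
        using near_vertex_lateral[OF e0 cl a _ xy(1,3,2,4)] nv by blast
      then show ?thesis by (auto simp: ngb_def)
    qed
    have "U \<noteq> {}" using single Lt_codes by blast
    then obtain c0 where c0: "c0 \<in> H" using Hcov by blast
    have not1: "\<exists>c'\<in>H. c' \<noteq> c" if "c \<in> H" for c
    proof (rule ccontr)
      assume "\<not> ?thesis"
      then have "U \<subseteq> gm N c ` K" using Hcov by (metis image_eqI subsetI)
      then show False using single Hc that by blast
    qed
    show ?thesis
    proof (cases "\<exists>k. Pl k \<in> H")
      case planar: True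
      then obtain k where k: "Pl k \<in> H" ..
      obtain a where a: "hat (Pl k) = Pl a" by simp
      have ba: "box 1 a" using mc_hat[OF Hc[OF k]] a by simp
      show ?thesis
      proof (cases "\<exists>j. Lt j \<in> H")
        case True
        then obtain i where j: "Lt i \<in> H" ..
        obtain j' l where T: "UNIV = {i, j', l}" "i \<noteq> j'" "i \<noteq> l" "j' \<noteq> l" by (metis triple_index)
        have aj: "a = ngb i (\<lambda>_. 0)" using PL[OF j k a] .
        have "H \<subseteq> {Lt i, Pl k}"
        proof
          fix c assume c: "c \<in> H"
          show "c \<in> {Lt i, Pl k}"
          proof (cases c)
            case (Pl k')
            obtain b where b: "hat c = Pl b" using Pl by simp
            have "b = a" using PL[OF j c b] aj by simp
            then have "hat c = hat (Pl k)" using a b by simp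
            then show ?thesis using hat_inj by blast
          next
            case (Lt j2)
            have "ngb j2 (\<lambda>_. 0) = ngb i (\<lambda>_. 0)" using PL[OF _ k a, of j2] aj c Lt by simp
            then have "j2 = i" unfolding ngb_def by (metis diff_0 neg_equal_0_iff_equal zero_neq_one)
            then show ?thesis using Lt by simp
          qed
        qed
        then have Ucov: "U \<subseteq> gm N (Lt i) ` K \<union> gm N (Pl k) ` K" by (rule UHH)
        have E: "edge 1 i (ma (hat (Lt i))) (\<lambda>x. ma (hat (Pl k)) (tau (Transposition.transpose j' l) x))"
          using edge_planar_lateral[OF T(2-4)] unfolding a aj by simp
        show ?thesis
          by (rule edge_tau_scalable[OF Hc[OF j] Hc[OF k] _ E Ucov Hmeet[OF j] Hmeet[OF k]], simp, erule (1) small)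
      next
        case False
        obtain c' where c': "c' \<in> H" "c' \<noteq> Pl k" using not1[OF k] by blast
        obtain k' where k': "c' = Pl k'" using c' False by (cases c') auto
        obtain b where b: "hat c' = Pl b" using k' by simp
        have bb: "box 1 b" using mc_hat[OF Hc[OF c'(1)]] b by simp
        have dsum: "sum a' UNIV \<noteq> sum b' UNIV" if "(\<forall>q. q \<noteq> i \<longrightarrow> a' q = b' q) \<and> a' i \<noteq> b' i" for a' b' :: "3 \<Rightarrow> int" and i
        proof -
          obtain j l where T: "UNIV = {i, j, l}" "i \<noteq> j" "i \<noteq> l" "j \<noteq> l" by (metis triple_index)
          show ?thesis using that T(2,3) by (simp add: sum_triple[OF T])
        qed
        \<comment> \<open>Indices that differ in one place only have different sums, and
          \<open>box 1\<close> admits just two sums, so three planar cells are impossible.\<close>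
        have "H \<subseteq> {Pl k, c'}"
        proof (rule ccontr)
          assume "\<not> ?thesis"
          then obtain d where d: "d \<in> H" "d \<noteq> Pl k" "d \<noteq> c'" by blast
          obtain k2 where k2: "d = Pl k2" using d False by (cases d) auto
          obtain b2 where b2: "hat d = Pl b2" using k2 by simp
          have bb2: "box 1 b2" using mc_hat[OF Hc[OF d(1)]] b2 by simp
          have "sum a UNIV \<noteq> sum b UNIV" "sum a UNIV \<noteq> sum b2 UNIV" "sum b UNIV \<noteq> sum b2 UNIV"
            using PP[OF k c'(1) c'(2)[symmetric] a b] PP[OF k d(1) d(2)[symmetric] a b2] PP[OF c'(1) d(1) d(3)[symmetric] b b2]
              dsum by blast+
          then show False using ba bb bb2 by (auto simp: box_def)
        qed
        have *: ?thesis if c: "c1 \<in> H" "c2 \<in> H" "hat c1 = Pl a1" "hat c2 = Pl b1" "sum a1 UNIV = 0" "H \<subseteq> {c1, c2}" "c1 \<noteq> c2"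
          for c1 c2 a1 b1
        proof -
          obtain i where i: "\<And>q. q \<noteq> i \<Longrightarrow> a1 q = b1 q" "a1 i \<noteq> b1 i" using PP[OF c(1,2,7,3,4)] by blast
          obtain j l where T: "UNIV = {i, j, l}" "i \<noteq> j" "i \<noteq> l" "j \<noteq> l" by (metis triple_index)
          have bx: "box 1 a1" "box 1 b1" using mc_hat[OF Hc[OF c(1)]] mc_hat[OF Hc[OF c(2)]] c by auto
          have E: "edge 1 i (ma (hat c1)) (\<lambda>x. ma (hat c2) (tau (Transposition.transpose j l) x))"
            using edge_planar[OF bx T(2-4) i c(5)] c(3,4) by simp
          show ?thesis
            by (rule edge_tau_scalable[OF Hc[OF c(1)] Hc[OF c(2)] _ E UHH[OF c(6)] Hmeet[OF c(1)] Hmeet[OF c(2)]], simp, erule (1) small)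
        qed
        have "sum a UNIV \<noteq> sum b UNIV"
          using PP[OF k c'(1) c'(2)[symmetric] a b] dsum by blast
        then have "sum a UNIV = 0 \<or> sum b UNIV = 0" using ba bb by (auto simp: box_def)
        then show ?thesis
          using *[OF k c'(1) a b _ \<open>H \<subseteq> {Pl k, c'}\<close> c'(2)[symmetric]] *[OF c'(1) k b a _ _ c'(2)] \<open>H \<subseteq> {Pl k, c'}\<close>
          by (metis insert_commute)
      qed
    next
      case False
      then have lat: "\<exists>j. c = Lt j" if "c \<in> H" for c using that by (cases c) auto
      obtain i where i: "Lt i \<in> H" using lat c0 by blast
      obtain j where j: "Lt j \<in> H" "i \<noteq> j" using not1[OF i] lat by metis
      obtain l where T: "UNIV = {i, j, l}" "i \<noteq> l" "j \<noteq> l" using pair_index[OF j(2)] .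
      show ?thesis
      proof (cases "Lt l \<in> H")
        case True
        then have all: "Lt q \<in> H" for q using triple_cases[OF T(1), of q] i j by auto
        show ?thesis
        proof (rule vertex_scalable[where P = "pl N (mid N) (mk (\<lambda>_. 1/3) 1)"])
          fix u assume u: "u \<in> U"
          obtain c x where c: "c \<in> H" "x \<in> K" "u = gm N c x" using Hcov[OF u] by blast
          obtain r where r: "c = Lt r" using lat[OF c(1)] ..
          have w: "lt r x \<in> V" using u c gm_ma[OF Hc[OF c(1)]] r by (simp add: V_def)
          have xp: "x \<in> pyr" using c K_pyr by blast
          \<comment> \<open>The functional \<open>bc _ q - ht _ / 3\<close> is nonpositive on the
            cell over face \<open>q\<close> and equals \<open>bc x q + ht x / 3\<close> at
            \<open>lt r x\<close>; since \<open>V\<close> also meets face \<open>q\<close>, that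
            value is at most \<epsilon>.\<close>
          have q: "bc x q \<le> \<epsilon>" if "q \<noteq> r" for q
          proof -
            obtain z where z: "z \<in> pyr" "lt q z \<in> V" using Hx[OF all[of q]] by auto
            have "\<bar>(bc (lt r x) q - ht (lt r x) / 3) - (bc (lt q z) q - ht (lt q z) / 3)\<bar> \<le> \<epsilon>"
              using cl w z unfolding close_def by blast
            then show ?thesis
              using that pyrD(1)[OF xp] pyrD(1)[OF z(1)] by (simp add: bc_lt ht_lt abs_le_iff field_simps)
          qed
          obtain i j where T: "UNIV = {i, j, r}" "i \<noteq> j" "i \<noteq> r" "j \<noteq> r"
            using triple_index[of r] by (metis insert_commute)
          have "bc x r \<ge> 1 - 2 * \<epsilon>"
            using q[OF T(3)] q[OF T(4)] bc_third[OF T(2-4), of x] by linarith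
          then have "N * bc x r \<ge> N * (1 - 2 * \<epsilon>)" using N4 by (intro mult_left_mono) auto
          moreover have "N * (2 * \<epsilon>) < 1" using e4 e0 by (simp add: mult.left_commute)
          ultimately have "N * bc x r > N - 1" by (simp add: right_diff_distrib)
          moreover have "lt r (kv r) = mk (\<lambda>_. 1/3) 1"
            by (rule pt_eqI) (simp_all add: bc_lt ht_lt bc_kv ht_kv bc_mk)
          ultimately show "\<exists>c\<in>codes N. \<exists>x\<in>K. \<exists>l. u = gm N c x \<and> gm N c (kv l) = pl N (mid N) (mk (\<lambda>_. 1/3) 1) \<and> N * bc x l > N - 1"
            using c r Hc by (intro bexI[of _ c] bexI[of _ x] exI[of _ r]) auto
        qed
      next
        case False
        have "H \<subseteq> {Lt i, Lt j}"
        proof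
          fix c assume c: "c \<in> H"
          obtain q where "c = Lt q" using lat[OF c] ..
          then show "c \<in> {Lt i, Lt j}" using triple_cases[OF T(1), of q] False c by auto
        qed
        then have Ucov: "U \<subseteq> gm N (Lt i) ` K \<union> gm N (Lt j) ` K" by (rule UHH)
        have E: "edge 1 j (ma (hat (Lt i))) (\<lambda>x. ma (hat (Lt j)) (tau (Transposition.transpose i j) x))"
          using edge_side[OF j(2)] by simp
        show ?thesis
          by (rule edge_tau_scalable[OF Hc[OF i] Hc[OF j(1)] _ E Ucov Hmeet[OF i] Hmeet[OF j(1)]], simp, erule (1) small)
      qed
    qed
  qed
qed

end

section \<open>Hausdorff content\<close>

lemma hausdorff_content_le:
  assumes "A \<subseteq> (\<Union>i. U i)" "\<And>i. bounded (U i)" "\<And>i. diameter (U i) \<le> \<delta>"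
  shows "hausdorff_content s \<delta> A \<le> (\<Sum>i. ennreal (diameter (U i) powr s))"
  unfolding hausdorff_content_def using assms by (intro INF_lower) auto

lemma hausdorff_content_antimono:
  assumes "\<delta> \<le> \<delta>'"
  shows "hausdorff_content s \<delta>' A \<le> hausdorff_content s \<delta> A"
  unfolding hausdorff_content_def
  by (rule INF_superset_mono) (auto intro: order_trans[OF _ assms])

lemma hausdorff_content_single:
  assumes "bounded A" "diameter A \<le> \<delta>" "0 \<le> \<delta>"
  shows "hausdorff_content s \<delta> A \<le> ennreal (diameter A powr s)"
proof -
  define U where "U = (\<lambda>i::nat. if i = 0 then A else {})"
  have "hausdorff_content s \<delta> A \<le> (\<Sum>i. ennreal (diameter (U i) powr s))"
    by (rule hausdorff_content_le) (use assms in \<open>auto simp: U_def\<close>)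
  also have "\<dots> = (\<Sum>i\<in>{0}. ennreal (diameter (U i) powr s))"
    by (rule suminf_finite) (auto simp: U_def)
  finally show ?thesis by (simp add: U_def)
qed

lemma suminf_interleave_le:
  fixes a b :: "nat \<Rightarrow> ennreal"
  shows "(\<Sum>n. if even n then a (n div 2) else b (n div 2)) \<le> suminf a + suminf b"
proof (rule suminf_le_const)
  define f where "f = (\<lambda>n. if even n then a (n div 2) else b (n div 2))"
  have eq: "(\<Sum>n<2 * k. f n) = (\<Sum>i<k. a i) + (\<Sum>i<k. b i)" for k
    by (induction k) (auto simp: f_def algebra_simps)
  fix n
  have "(\<Sum>i<n. f i) \<le> (\<Sum>i<2 * n. f i)" by (intro sum_mono2) auto
  also have "\<dots> \<le> suminf a + suminf b"
    unfolding eq by (intro add_mono sum_le_suminf) auto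
  finally show "(\<Sum>i<n. if even i then a (i div 2) else b (i div 2)) \<le> suminf a + suminf b"
    by (simp add: f_def)
qed simp

lemma hausdorff_content_Un:
  "hausdorff_content s \<delta> (A \<union> B) \<le> hausdorff_content s \<delta> A + hausdorff_content s \<delta> B"
proof (rule ennreal_le_epsilon)
  fix e :: real assume fin: "hausdorff_content s \<delta> A + hausdorff_content s \<delta> B < top" and e: "0 < e"
  have *: "\<exists>U. A \<subseteq> (\<Union>i. U i) \<and> (\<forall>i. bounded (U i) \<and> diameter (U i) \<le> \<delta>) \<and>
      (\<Sum>i. ennreal (diameter (U i) powr s)) < hausdorff_content s \<delta> A + ennreal (e / 2)"
    if "hausdorff_content s \<delta> A < top" for A
  proof -
    have "hausdorff_content s \<delta> A < hausdorff_content s \<delta> A + ennreal (e / 2)"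
      using that e
      by (cases "hausdorff_content s \<delta> A") (auto simp: ennreal_less_iff simp flip: ennreal_plus)
    then show ?thesis
      unfolding hausdorff_content_def INF_less_iff by auto
  qed
  obtain U where U: "A \<subseteq> (\<Union>i. U i)" "\<forall>i. bounded (U i) \<and> diameter (U i) \<le> \<delta>"
    "(\<Sum>i. ennreal (diameter (U i) powr s)) < hausdorff_content s \<delta> A + ennreal (e / 2)"
    using *[of A] fin unfolding ennreal_add_less_top by blast
  obtain V where V: "B \<subseteq> (\<Union>i. V i)" "\<forall>i. bounded (V i) \<and> diameter (V i) \<le> \<delta>"
    "(\<Sum>i. ennreal (diameter (V i) powr s)) < hausdorff_content s \<delta> B + ennreal (e / 2)"
    using *[of B] fin unfolding ennreal_add_less_top by blast
  define W where "W n = (if even n then U (n div 2) else V (n div 2))" for n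
  have "x \<in> (\<Union>n. W n)" if "x \<in> A \<union> B" for x
  proof -
    from that show ?thesis
    proof
      assume "x \<in> A"
      then obtain i where "x \<in> U i" using U(1) by blast
      then have "x \<in> W (2 * i)" by (simp add: W_def)
      then show ?thesis by blast
    next
      assume "x \<in> B"
      then obtain i where "x \<in> V i" using V(1) by blast
      then have "x \<in> W (2 * i + 1)" by (simp add: W_def)
      then show ?thesis by blast
    qed
  qed
  then have "A \<union> B \<subseteq> (\<Union>n. W n)" by blast
  moreover have "bounded (W n)" "diameter (W n) \<le> \<delta>" for n
    using U(2) V(2) by (auto simp: W_def)
  ultimately have "hausdorff_content s \<delta> (A \<union> B) \<le> (\<Sum>n. ennreal (diameter (W n) powr s))"
    by (rule hausdorff_content_le)
  also have "\<dots> = (\<Sum>n. if even n then ennreal (diameter (U (n div 2)) powr s) else ennreal (diameter (V (n div 2)) powr s))"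
    by (intro suminf_cong) (simp add: W_def)
  also have "\<dots> \<le> (\<Sum>i. ennreal (diameter (U i) powr s)) + (\<Sum>i. ennreal (diameter (V i) powr s))"
    by (rule suminf_interleave_le)
  also have "\<dots> \<le> (hausdorff_content s \<delta> A + ennreal (e / 2)) + (hausdorff_content s \<delta> B + ennreal (e / 2))"
    using U(3) V(3) by (intro add_mono) auto
  also have "\<dots> = hausdorff_content s \<delta> A + hausdorff_content s \<delta> B + (ennreal (e / 2) + ennreal (e / 2))"
    by (simp only: ac_simps)
  also have "ennreal (e / 2) + ennreal (e / 2) = ennreal e"
    using e by (simp flip: ennreal_plus)
  finally show "hausdorff_content s \<delta> (A \<union> B) \<le> hausdorff_content s \<delta> A + hausdorff_content s \<delta> B + ennreal e" .
qed

lemma hausdorff_content_Union: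
  assumes "finite C" "0 \<le> \<delta>"
  shows "hausdorff_content s \<delta> (\<Union>C) \<le> (\<Sum>c\<in>C. hausdorff_content s \<delta> c)"
  using assms(1)
proof induction
  case empty
  then show ?case using hausdorff_content_single[of "{}" \<delta> s] assms(2) by simp
next
  case (insert c C)
  have "hausdorff_content s \<delta> (\<Union>(insert c C)) \<le> hausdorff_content s \<delta> c + hausdorff_content s \<delta> (\<Union>C)"
    using hausdorff_content_Un[of s \<delta> c "\<Union>C"] by simp
  also have "\<dots> \<le> (\<Sum>c\<in>insert c C. hausdorff_content s \<delta> c)"
    using insert by (simp add: add_left_mono)
  finally show ?case .
qed

lemma diameter_image_scale:
  fixes S :: "'a::metric_space \<Rightarrow> 'b::metric_space"
  assumes S: "\<And>x y. dist (S x) (S y) = \<rho> * dist x y" and r: "0 < \<rho>" and "bounded A"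
  shows "bounded (S ` A)" "diameter (S ` A) = \<rho> * diameter A"
proof -
  obtain x e where "\<forall>y\<in>A. dist x y \<le> e" using assms(3) unfolding bounded_def by blast
  then have "\<forall>z\<in>S ` A. dist (S x) z \<le> \<rho> * e" using r by (simp add: S)
  then show b: "bounded (S ` A)" unfolding bounded_def by blast
  show "diameter (S ` A) = \<rho> * diameter A"
  proof (cases "A = {}")
    case False
    show ?thesis
    proof (rule antisym)
      show "diameter (S ` A) \<le> \<rho> * diameter A"
        unfolding diameter_def using False
        using diameter_bounded_bound[OF assms(3)] r
        by (auto simp: S diameter_def split: if_splits intro!: cSUP_least)
      have "diameter A \<le> diameter (S ` A) / \<rho>"
      proof -
        have "dist x y \<le> diameter (S ` A) / \<rho>" if "x \<in> A" "y \<in> A" for x y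
          using diameter_bounded_bound[OF b, of "S x" "S y"] that r by (simp add: S field_simps)
        then show ?thesis
          unfolding diameter_def[of A] using False by (auto intro!: cSUP_least)
      qed
      then show "\<rho> * diameter A \<le> diameter (S ` A)" using r by (simp add: field_simps)
    qed
  qed simp
qed

lemma hausdorff_content_scale:
  fixes S :: "'a::metric_space \<Rightarrow> 'b::metric_space"
  assumes S: "\<And>x y. dist (S x) (S y) = \<rho> * dist x y" and r: "0 < \<rho>"
  shows "hausdorff_content s (\<rho> * \<delta>) (S ` A) \<le> ennreal (\<rho> powr s) * hausdorff_content s \<delta> A"
proof -
  \<comment> \<open>The power is moved to the left so that the right-hand side is a bare infimum
    over coverings.\<close>
  have "ennreal (\<rho> powr (-s)) * hausdorff_content s (\<rho> * \<delta>) (S ` A) \<le> hausdorff_content s \<delta> A"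
    unfolding hausdorff_content_def[of s \<delta>]
  proof (rule INF_greatest)
    fix U :: "nat \<Rightarrow> 'a set"
    assume "U \<in> {U. A \<subseteq> (\<Union>i. U i) \<and> (\<forall>i. bounded (U i) \<and> diameter (U i) \<le> \<delta>)}"
    then have U: "A \<subseteq> (\<Union>i. U i)" "\<And>i. bounded (U i)" "\<And>i. diameter (U i) \<le> \<delta>" by auto
    note d = diameter_image_scale[OF S r U(2)]
    have "S ` A \<subseteq> (\<Union>i. S ` U i)" using U(1) by blast
    then have "hausdorff_content s (\<rho> * \<delta>) (S ` A) \<le> (\<Sum>i. ennreal (diameter (S ` U i) powr s))"
      by (rule hausdorff_content_le) (use U(3) d r in auto)
    also have "\<dots> = (\<Sum>i. ennreal (\<rho> powr s) * ennreal (diameter (U i) powr s))"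
      by (intro suminf_cong) (use d r diameter_ge_0[OF U(2)] in \<open>simp add: powr_mult ennreal_mult\<close>)
    also have "\<dots> = ennreal (\<rho> powr s) * (\<Sum>i. ennreal (diameter (U i) powr s))"
      by simp
    finally have "ennreal (\<rho> powr (-s)) * hausdorff_content s (\<rho> * \<delta>) (S ` A)
        \<le> ennreal (\<rho> powr (-s)) * (ennreal (\<rho> powr s) * (\<Sum>i. ennreal (diameter (U i) powr s)))"
      by (rule mult_left_mono) simp
    also have "\<dots> = (\<Sum>i. ennreal (diameter (U i) powr s))"
      using r by (simp flip: mult.assoc ennreal_mult powr_add)
    finally show "ennreal (\<rho> powr (-s)) * hausdorff_content s (\<rho> * \<delta>) (S ` A)
      \<le> (\<Sum>i. ennreal (diameter (U i) powr s))" .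
  qed
  then have "ennreal (\<rho> powr s) * (ennreal (\<rho> powr (-s)) * hausdorff_content s (\<rho> * \<delta>) (S ` A))
      \<le> ennreal (\<rho> powr s) * hausdorff_content s \<delta> A"
    by (rule mult_left_mono) simp
  then show ?thesis
    using r by (simp flip: mult.assoc ennreal_mult powr_add)
qed

section \<open>Overlaps of cells lie on their boundaries\<close>

context koch_scale
begin

text \<open>The boundary of the triangle T itself: in \<open>pyr\<close> a vanishing coordinate
  forces height 0.\<close>

definition rim :: "pt set" where "rim = {x \<in> pyr. \<exists>i. bc x i = 0}"

lemma rim_one:
  assumes "x \<in> pyr" "bc x i = 1"
  shows "x \<in> rim"
proof -
  obtain j l where T: "UNIV = {i, j, l}" "i \<noteq> j" "i \<noteq> l" "j \<noteq> l" by (metis triple_index)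
  have "bc x j = 0"
    using pyr_pair[OF assms(1) T(2)] pyr_nonneg[OF assms(1), of j] pyrD(1)[OF assms(1)] assms(2) by linarith
  then show ?thesis using assms(1) by (auto simp: rim_def)
qed

text \<open>On a grid line the corresponding coordinate inside the cell is an integer between 0 and
  1, and the value 1 makes the others 0.\<close>

lemma rim_planar:
  assumes "m > 0" "box m k" "x \<in> pyr" "m * bc (pl m k x) i = of_int z"
  shows "x \<in> rim"
proof -
  have "bc x i = of_int (z - k i) \<or> bc x i = of_int (k i + 1 - z)"
    using assms(1,4) by (auto simp: bc_pl[OF assms(1,2)] split: if_splits)
  then obtain w :: int where w: "bc x i = of_int w" by blast
  have "0 \<le> bc x i" "bc x i \<le> 1"
    using pyr_nonneg[OF assms(3)] pyr_upper[OF assms(3), of i] pyrD(1)[OF assms(3)] by (simp, linarith)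
  then have "w = 0 \<or> w = 1" unfolding w by simp linarith
  then show ?thesis
    using w rim_one[OF assms(3), of i] assms(3) by (auto simp: rim_def)
qed

text \<open>Two planar cells meet on a separating grid line. A planar cell other than the base has a
  negative index \<open>i\<close>, so there \<open>bc _ i\<close> is at most -4/3 of the height,
  while a lateral cell overhangs by at most 4/15 of it; contact has height 0. Two lateral cells are
  separated by the plane of one face, as in \<open>edge_side\<close>.\<close>

lemma ma_overlap:
  assumes c: "mc c" "mc c'" "c \<noteq> c'" and x: "x \<in> pyr" "y \<in> pyr" and eq: "ma c x = ma c' y"
  shows "x \<in> rim"
proof -
  have PP: "x \<in> rim" if k: "box 1 k" "box 1 k'" "k \<noteq> k'" "x \<in> pyr" "y \<in> pyr" "pl 1 k x = pl 1 k' y" for k k' x y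
  proof -
    obtain i where i: "k i \<noteq> k' i" using k(3) by auto
    note b = box1[OF k(1,4), of i] box1[OF k(2,5), of i, folded k(6)] box1_ht[OF k(4), of k]
    have "1 * bc (pl 1 k x) i = of_int (max (k i) (k' i))"
    proof (cases "k i < k' i")
      case True
      then have "real_of_int (k i) + 1 \<le> k' i" by linarith
      then show ?thesis using b True by (simp add: max_def)
    next
      case False
      then have "real_of_int (k' i) + 1 \<le> k i" using i by linarith
      then show ?thesis using b False by (simp add: max_def)
    qed
    then show ?thesis using rim_planar[of 1 k x i] k by simp
  qed
  have PL: "x \<in> rim \<and> y \<in> rim" if k: "box 1 k" "k \<noteq> (\<lambda>_. 0)" "x \<in> pyr" "y \<in> pyr" "lt j x = pl 1 k y" for k j x y
  proof -
    obtain i where i: "k i \<le> -1"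
    proof -
      have "\<exists>i. k i \<noteq> 0" using k(2) by auto
      moreover have "sum k UNIV \<le> 0" using k(1) by (auto simp: box_def)
      ultimately have "\<exists>i. k i < 0"
        by (meson UNIV_I finite linorder_not_le sum_nonneg_eq_0_iff sum_nonneg order_antisym)
      then obtain i where "k i < 0" ..
      then show thesis using that[of i] by simp
    qed
    have "real_of_int (k i) \<le> -1" using i by linarith
    then have q: "bc (pl 1 k y) i \<le> - 4/3 * ht (pl 1 k y)" using box1(2)[OF k(1,4), of i] by linarith
    then have q': "bc (lt j x) i \<le> - 4/3 * ht (lt j x)" using k(5) by simp
    note b = pyrD(1)[OF k(3)] pyrD(2)[OF k(3), of i] pyrD(2)[OF k(3), of j]
    have "bc x j = 0 \<and> bc (lt j x) i = 0"
    proof (cases "i = j")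
      case True
      have "bc x j / 3 - 8/9 * ht x \<le> - 4/3 * (bc x j + ht x / 3)" using q' True by (simp add: bc_lt ht_lt)
      then have 1: "5 * bc x j \<le> 4/3 * ht x" by (simp add: field_simps)
      have 2: "bc x j = 0" using 1 b by linarith
      moreover have "ht x = 0" using 1 2 b by linarith
      ultimately show ?thesis using True by (simp add: bc_lt)
    next
      case False
      have "bc x i + bc x j / 3 + 4/9 * ht x \<le> - 4/3 * (bc x j + ht x / 3)" using q' False by (simp add: bc_lt ht_lt)
      then have 1: "3 * bc x i + 5 * bc x j + 8/3 * ht x \<le> 0" by (simp add: field_simps)
      have 2: "bc x j = 0" "ht x = 0" "bc x i = 0" using 1 b by linarith+
      from 2 show ?thesis using False by (simp add: bc_lt)
    qed
    moreover have "x \<in> rim" using calculation k(3) by (auto simp: rim_def)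
    moreover have "y \<in> rim" using rim_planar[of 1 k y i 0] calculation k by simp
    ultimately show ?thesis by blast
  qed
  have LL: "x \<in> rim" if k: "i \<noteq> j" "x \<in> pyr" "y \<in> pyr" "lt i x = lt j y" for i j x y
  proof -
    have "bc (lt i x) j - ht (lt i x) / 3 = bc (lt j y) j - ht (lt j y) / 3" using k(4) by simp
    then have "bc x j + ht x / 3 = - ht y" using k(1) by (simp add: bc_lt ht_lt field_simps)
    then have "bc x j = 0" using pyrD(1)[OF k(2)] pyrD(1)[OF k(3)] pyr_nonneg[OF k(2), of j] by linarith
    then show ?thesis using k(2) by (auto simp: rim_def)
  qed
  show ?thesis
  proof (cases c)
    case k: (Pl k)
    show ?thesis
    proof (cases c')
      case (Pl k')
      then show ?thesis using PP[of k k' x y] k c x eq by auto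
    next
      case (Lt j)
      then show ?thesis using PL[of k y x j] k c x eq by auto
    qed
  next
    case j: (Lt j)
    show ?thesis
    proof (cases c')
      case (Pl k')
      then show ?thesis using PL[of k' x y j] j c x eq by auto
    next
      case (Lt j')
      then show ?thesis using LL[of j j' x y] j c x eq by auto
    qed
  qed
qed

lemma overlap_rim:
  assumes "c \<in> codes N" "c' \<in> codes N" "c \<noteq> c'" "x \<in> pyr" "y \<in> pyr" "gm N c x = gm N c' y"
  shows "x \<in> rim"
proof (rule ma_overlap)
  show "mc (hat c)" "mc (hat c')" using mc_hat assms by auto
  show "hat c \<noteq> hat c'" using hat_inj assms by blast
  have "dist (ma (hat c) x) (ma (hat c') y) = N * dist (gm N c x) (gm N c' y)"
    using assms(1,2) by (simp add: gm_ma dist_pl)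
  then show "ma (hat c) x = ma (hat c') y" using assms(6) by simp
qed (use assms in auto)

text \<open>Lateral cells stay away from the boundary of T: in units of \<open>1 / N\<close> their
  coordinates are at least 1 - 4/15 = 11/15.\<close>

lemma rim_preimage:
  assumes "c \<in> codes N" "x \<in> pyr" "gm N c x \<in> rim"
  shows "x \<in> rim" "c \<noteq> Lt j"
proof -
  obtain i where i: "bc (gm N c x) i = 0" using assms(3) by (auto simp: rim_def)
  have "c \<noteq> Lt j" for j
  proof
    assume c: "c = Lt j"
    obtain q :: real where q: "real_of_int (N div 3) = q" "q \<ge> 1" by (rule kappa_real)
    have "bc (gm N c x) i * N \<ge> 11/15"
      unfolding c bc_Lt
      using lt_pyr_bounds(1,5)[OF assms(2), where j = j and i = i] lt_pyr_bounds(2)[OF assms(2), where j = j and i = i]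
          lt_pyr_bounds(3,4)[OF assms(2), where j = j] q by auto
    then show False using i by simp
  qed
  then show "c \<noteq> Lt j" .
  then obtain k where k: "c = Pl k" using \<open>\<And>j. c \<noteq> Lt j\<close> by (cases c) auto
  then show "x \<in> rim"
    using rim_planar[of N k x i 0] assms(1,2) i by (simp add: Pl_codes)
qed

lemma rim_tau: "bij \<pi> \<Longrightarrow> x \<in> rim \<Longrightarrow> tau \<pi> x \<in> rim"
  unfolding rim_def using tau_pyr by (auto simp: bc_tau) (metis bij_pointE)

lemma closed_rim: "closed rim"
proof -
  have "rim = pyr \<inter> (\<Union>i\<in>UNIV. {x. bc x i = 0})" by (auto simp: rim_def)
  moreover have "closed {x. bc x i = 0}" for i
    by (intro closed_Collect_eq cont_bc continuous_on_const)
  ultimately show ?thesis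
    using compact_imp_closed[OF compact_pyr] by (metis (no_types, lifting) closed_Int closed_UN finite)
qed

end

section \<open>The self-similar measure\<close>

locale koch_measure = koch_attractor +
  fixes \<mu> :: "pt measure"
  assumes prob: "prob_space \<mu>" and sets_mu: "sets \<mu> = sets borel"
    and inv_mu: "\<And>A. A \<in> sets borel \<Longrightarrow>
      measure \<mu> A = (\<Sum>c\<in>codes N. measure \<mu> ((\<lambda>x. gm N c (tau (tw c) x)) -` A)) / card (codes N)"
    and card_codes: "real (card (codes N)) = (real_of_int N)\<^sup>2 + 2"
begin

interpretation prob_space \<mu> by (rule prob)

definition M :: real where "M = card (codes N)"

lemma M_pos: "M > 0" "M = (real_of_int N)\<^sup>2 + 2"
  using card_codes by (simp_all add: M_def add_nonneg_pos)

lemma finite_codes: "finite (codes N)"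
  using M_pos(1) card_ge_0_finite[of "codes N"] by (simp add: M_def)

definition f :: "code \<Rightarrow> pt \<Rightarrow> pt" where "f c x = gm N c (tau (tw c) x)"

lemma inv_f: "A \<in> sets borel \<Longrightarrow> M * measure \<mu> A = (\<Sum>c\<in>codes N. measure \<mu> (f c -` A))"
  using inv_mu[of A] M_pos(1) by (simp add: M_def f_def[abs_def])

lemma dist_f: "c \<in> codes N \<Longrightarrow> dist (f c x) (f c y) = dist x y / N"
  by (simp add: f_def dist_gm' dist_tau bij_tw)

lemma f_K: "c \<in> codes N \<Longrightarrow> x \<in> K \<Longrightarrow> f c x \<in> K"
  by (simp add: f_def gm_K K_tau bij_tw)

lemma f_cont: "c \<in> codes N \<Longrightarrow> continuous_on A (f c)"
  using adm_cont[OF adm_Suc[OF _ adm_0[OF bij_tw]], of c A c] by (simp add: f_def[abs_def])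

lemma borel_vimage_f [intro]: "c \<in> codes N \<Longrightarrow> A \<in> sets borel \<Longrightarrow> f c -` A \<in> sets borel"
  using measurable_sets[OF borel_measurable_continuous_onI[OF f_cont[of c UNIV]], of A] by simp

lemma space_mu [simp]: "space \<mu> = UNIV"
  using sets_eq_imp_space_eq[OF sets_mu] by simp

lemma compact_sets: "compact A \<Longrightarrow> A \<in> sets \<mu>"
  unfolding sets_mu by (intro borel_closed compact_imp_closed)

lemma closed_sets: "closed A \<Longrightarrow> A \<in> sets \<mu>"
  unfolding sets_mu by (intro borel_closed)

lemma K_ne_closed: "closed K" using K_compact by (rule compact_imp_closed)

text \<open>The maps contract the distance to \<open>K\<close> by the factor N, so invariance gives
  \<open>D (N * r)\<close> at most the measure of \<open>D r\<close>. Iteration and exhaustion of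
  the space by these neighbourhoods give measure 1 for every \<open>r > 0\<close>, and the
  neighbourhoods shrink to \<open>K\<close>.\<close>

lemma mu_K: "measure \<mu> K = 1"
proof -
  define D where "D r = {x. infdist x K \<le> r}" for r :: real
  have clD: "closed (D r)" for r
    unfolding D_def by (intro closed_Collect_le continuous_intros)
  have monoD: "D r \<subseteq> D r'" if "r \<le> r'" for r r' using that by (auto simp: D_def)
  have step: "measure \<mu> (D (N * r)) \<le> measure \<mu> (D r)" for r :: real
  proof -
    have "measure \<mu> (D (N * r)) \<le> measure \<mu> (f c -` D r)" if c: "c \<in> codes N" for c
    proof (rule finite_measure_mono)
      show "D (N * r) \<subseteq> f c -` D r"
      proof
        fix x assume "x \<in> D (N * r)"
        obtain z where z: "z \<in> K" "infdist x K = dist x z"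
          using infdist_attains_inf[OF K_ne_closed K_nonempty, of x] by blast
        have "infdist (f c x) K \<le> dist (f c x) (f c z)" using f_K[OF c z(1)] by (rule infdist_le)
        also have "\<dots> = infdist x K / N" using z dist_f[OF c] by simp
        also have "\<dots> \<le> r" using \<open>x \<in> D (N * r)\<close> by (simp add: D_def field_simps)
        finally show "x \<in> f c -` D r" by (simp add: D_def)
      qed
      show "f c -` D r \<in> sets \<mu>" using borel_vimage_f[OF c] clD sets_mu by auto
    qed
    then have "(\<Sum>c\<in>codes N. measure \<mu> (D (N * r))) \<le> (\<Sum>c\<in>codes N. measure \<mu> (f c -` D r))"
      by (rule sum_mono)
    also have "\<dots> = M * measure \<mu> (D r)" using inv_f[of "D r"] clD by simp
    finally show ?thesis using M_pos(1) by (simp add: M_def)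
  qed
  have iter: "measure \<mu> (D (real_of_int N ^ k * r)) \<le> measure \<mu> (D r)" for k and r :: real
  proof (induction k)
    case (Suc k)
    then show ?case using step[of "real_of_int N ^ k * r"] by (simp add: mult.assoc)
  qed simp
  have lim: "(\<lambda>n. measure \<mu> (D (real n))) \<longlonglongrightarrow> measure \<mu> (\<Union>n. D (real n))"
    by (intro finite_Lim_measure_incseq) (auto intro!: incseq_SucI monoD closed_sets clD simp: image_subset_iff)
  have "(\<Union>n. D (real n)) = UNIV"
    using real_arch_simple by (force simp: D_def)
  then have lim1: "(\<lambda>n. measure \<mu> (D (real n))) \<longlonglongrightarrow> 1"
    using lim prob_space by simp
  have one: "measure \<mu> (D r) = 1" if r: "r > 0" for r
  proof (rule antisym)
    show "1 \<le> measure \<mu> (D r)"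
    proof (rule LIMSEQ_le_const2[OF lim1])
      have "measure \<mu> (D (real n)) \<le> measure \<mu> (D r)" for n
      proof -
        have "1 < real_of_int N" using N4 by simp
        then obtain k where "real n / r < real_of_int N ^ k" using real_arch_pow by blast
        then have "real n \<le> real_of_int N ^ k * r" using r by (simp add: field_simps)
        then have "measure \<mu> (D (real n)) \<le> measure \<mu> (D (real_of_int N ^ k * r))"
          by (intro finite_measure_mono monoD closed_sets clD)
        then show ?thesis using iter[of k r] by simp
      qed
      then show "\<exists>N. \<forall>n\<ge>N. measure \<mu> (D (real n)) \<le> measure \<mu> (D r)" by blast
    qed
  qed simp
  have "(\<lambda>n. measure \<mu> (D (1 / real (Suc n)))) \<longlonglongrightarrow> measure \<mu> (\<Inter>n. D (1 / real (Suc n)))"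
    by (intro finite_Lim_measure_decseq)
      (auto intro!: decseq_SucI monoD closed_sets clD simp: image_subset_iff field_simps)
  moreover have "(\<Inter>n. D (1 / real (Suc n))) = K"
  proof
    show "K \<subseteq> (\<Inter>n. D (1 / real (Suc n)))" by (auto simp: D_def)
    show "(\<Inter>n. D (1 / real (Suc n))) \<subseteq> K"
    proof
      fix x assume x: "x \<in> (\<Inter>n. D (1 / real (Suc n)))"
      have "infdist x K \<le> 0"
      proof (rule LIMSEQ_le_const[OF LIMSEQ_inverse_real_of_nat])
        show "\<exists>N. \<forall>n\<ge>N. infdist x K \<le> inverse (real (Suc n))"
          using x by (auto simp: D_def inverse_eq_divide)
      qed
      then have "infdist x K = 0" using infdist_nonneg[of x K] by simp
      then show "x \<in> K" using in_closed_iff_infdist_zero[OF K_ne_closed K_nonempty] by blast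
    qed
  qed
  ultimately have "(\<lambda>n. 1) \<longlonglongrightarrow> measure \<mu> K" using one by simp
  then show ?thesis using LIMSEQ_unique tendsto_const by blast
qed

lemma mu_Int_K: "A \<in> sets \<mu> \<Longrightarrow> measure \<mu> (A \<inter> K) = measure \<mu> A"
proof -
  assume A: "A \<in> sets \<mu>"
  have "measure \<mu> (UNIV - K) = 0"
    using prob_compl[OF compact_sets[OF K_compact]] mu_K by simp
  moreover have "measure \<mu> (A - K) \<le> measure \<mu> (UNIV - K)"
    using compact_sets[OF K_compact] sets.compl_sets[of K \<mu>] by (intro finite_measure_mono) auto
  ultimately have "measure \<mu> (A - K) = 0" using measure_nonneg[of \<mu> "A - K"] by linarith
  then show ?thesis
    using finite_measure_Union[of "A \<inter> K" "A - K"] A compact_sets[OF K_compact]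
    by (metis Diff_disjoint Int_Diff_Un Int_Diff_disjoint add.right_neutral sets.Diff sets.Int)
qed

lemma mu_null_mono:
  assumes "A \<in> sets \<mu>" "B \<in> sets \<mu>" "measure \<mu> B = 0" "A \<inter> K \<subseteq> B"
  shows "measure \<mu> A = 0"
  using finite_measure_mono[OF assms(4,2)] mu_Int_K[OF assms(1)] assms(3) measure_nonneg[of \<mu> A] by linarith

lemma rim_sets: "rim \<in> sets \<mu>" using closed_sets closed_rim by blast

text \<open>Every preimage of the rim lies, within \<open>K\<close>, in the rim, and the one under
  the map for \<open>Lt 1\<close> is empty there. Invariance thus bounds M times the measure by M -
  1 times the measure.\<close>

lemma mu_rim: "measure \<mu> rim = 0"
proof -
  have le: "measure \<mu> (f c -` rim) \<le> (if c = Lt 1 then 0 else measure \<mu> rim)" if c: "c \<in> codes N" for c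
  proof -
    have s: "f c -` rim \<in> sets \<mu>" using borel_vimage_f[OF c] rim_sets sets_mu by auto
    have sub: "f c -` rim \<inter> K \<subseteq> rim \<inter> {x. c \<noteq> Lt 1}"
    proof
      fix x assume x: "x \<in> f c -` rim \<inter> K"
      then have p: "tau (tw c) x \<in> pyr" using tau_pyr[OF bij_tw] K_pyr by blast
      then have r: "tau (tw c) x \<in> rim" "c \<noteq> Lt 1" using rim_preimage[OF c p] x by (auto simp: f_def)
      then show "x \<in> rim \<inter> {x. c \<noteq> Lt 1}"
        using rim_tau[OF bij_imp_bij_inv[OF bij_tw] r(1), of c] tau_inv(1)[OF bij_tw, of c x] by auto
    qed
    show ?thesis
    proof (cases "c = Lt 1")
      case True
      then have "f c -` rim \<inter> K = {}" using sub by blast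
      then show ?thesis using mu_Int_K[OF s] True by simp
    next
      case False
      have "measure \<mu> (f c -` rim \<inter> K) \<le> measure \<mu> rim"
        using sub rim_sets by (intro finite_measure_mono) auto
      then show ?thesis using mu_Int_K[OF s] False by simp
    qed
  qed
  have "M * measure \<mu> rim = (\<Sum>c\<in>codes N. measure \<mu> (f c -` rim))"
    using inv_f rim_sets sets_mu by auto
  also have "\<dots> \<le> (\<Sum>c\<in>codes N. if c = Lt 1 then 0 else measure \<mu> rim)"
    by (intro sum_mono le)
  also have "\<dots> = (\<Sum>c\<in>codes N. measure \<mu> rim - (if c = Lt 1 then measure \<mu> rim else 0))"
    by (intro sum.cong) auto
  also have "\<dots> = (M - 1) * measure \<mu> rim"
    using finite_codes by (simp add: sum_subtractf M_def algebra_simps)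
  finally show ?thesis using measure_nonneg[of \<mu> rim] by (simp add: algebra_simps)
qed

lemma f_overlap:
  assumes "c \<in> codes N" "d \<in> codes N" "c \<noteq> d" "x \<in> K" "y \<in> K" "f c x = f d y"
  shows "x \<in> rim"
proof -
  have p: "tau (tw c) x \<in> pyr" "tau (tw d) y \<in> pyr" using tau_pyr[OF bij_tw] K_pyr assms by auto
  have "tau (tw c) x \<in> rim" using overlap_rim[OF assms(1-3) p] assms(6) by (simp add: f_def)
  then show ?thesis
    using rim_tau[OF bij_imp_bij_inv[OF bij_tw], of "tau (tw c) x" c] tau_inv(1)[OF bij_tw, of c x] by simp
qed

lemma compact_f: "c \<in> codes N \<Longrightarrow> compact Z \<Longrightarrow> compact (f c ` Z)"
  by (intro compact_continuous_image f_cont)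

text \<open>In the invariance equation for the image, all summands other than \<open>c\<close> are
  null: within \<open>K\<close> those preimages lie in the rim.\<close>

lemma mu_f:
  assumes c: "c \<in> codes N" and Z: "compact Z" "Z \<subseteq> K"
  shows "M * measure \<mu> (f c ` Z) = measure \<mu> Z"
proof -
  have s: "f c ` Z \<in> sets borel" using compact_sets[OF compact_f[OF c Z(1)]] sets_mu by simp
  have "measure \<mu> (f d -` (f c ` Z)) = (if d = c then measure \<mu> Z else 0)" if d: "d \<in> codes N" for d
  proof (cases "d = c")
    case True
    have "inj (f c)" using dist_f[OF c] by (intro injI) (metis dist_eq_0_iff divide_eq_0_iff Npos(3) less_irrefl)
    then show ?thesis using True by (simp add: inj_vimage_image_eq)
  next
    case False
    have "f d -` (f c ` Z) \<inter> K \<subseteq> rim" using f_overlap[OF d c False] Z(2) by auto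
    then show ?thesis
      using mu_null_mono[OF _ rim_sets mu_rim] borel_vimage_f[OF d s] sets_mu False by simp
  qed
  then have "(\<Sum>d\<in>codes N. measure \<mu> (f d -` (f c ` Z))) = measure \<mu> Z"
    using c finite_codes by simp
  then show ?thesis using inv_f[OF s] by simp
qed

lemma f_image_gm: "Z \<subseteq> K \<Longrightarrow> gm N c ` Z = f c ` tau (inv (tw c)) ` Z"
  by (auto simp: f_def image_image tau_inv bij_tw)

lemma compact_tau: "bij \<pi> \<Longrightarrow> compact Z \<Longrightarrow> compact (tau \<pi> ` Z)"
  using adm_cont[OF adm_0] by (intro compact_continuous_image) auto

lemma gm_overlap_null:
  assumes "c \<in> codes N" "d \<in> codes N" "c \<noteq> d"
  shows "measure \<mu> (gm N c ` K \<inter> gm N d ` K) = 0"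
proof -
  have e: "gm N c ` K = f c ` K" for c
    using f_image_gm[of K c] K_tau_image[OF bij_imp_bij_inv[OF bij_tw]] by simp
  have "gm N c ` K \<inter> gm N d ` K \<subseteq> f c ` (rim \<inter> K)"
    unfolding e using f_overlap[OF assms] by blast
  moreover have "compact (rim \<inter> K)" using closed_rim K_compact by (simp add: closed_Int_compact)
  moreover have "measure \<mu> (f c ` (rim \<inter> K)) = 0"
    using mu_f[OF assms(1) \<open>compact (rim \<inter> K)\<close>] mu_Int_K[OF rim_sets] mu_rim M_pos(1) by simp
  moreover have "compact (gm N c ` K)" "compact (gm N d ` K)"
    unfolding e using compact_f K_compact assms by auto
  ultimately show ?thesis
    using finite_measure_mono[of "gm N c ` K \<inter> gm N d ` K" "f c ` (rim \<inter> K)"] compact_sets[OF compact_f[OF assms(1), of "rim \<inter> K"]]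
      measure_nonneg[of \<mu> "gm N c ` K \<inter> gm N d ` K"] by linarith
qed

section \<open>Cells and their measures\<close>

definition cells :: "nat \<Rightarrow> pt set set" where "cells n = {S ` K | S. adm N n S}"

lemma adm_0_cases: "adm N 0 S \<Longrightarrow> \<exists>\<pi>. bij \<pi> \<and> S = tau \<pi>"
  by (cases rule: adm.cases) auto

lemma cells_0: "cells 0 = {K}"
proof
  show "cells 0 \<subseteq> {K}" using adm_0_cases K_tau_image by (fastforce simp: cells_def)
  show "{K} \<subseteq> cells 0" unfolding cells_def using adm_id by force
qed

lemma adm_Suc_cases: "adm N (Suc n) S \<Longrightarrow> \<exists>c T. c \<in> codes N \<and> adm N n T \<and> S = (\<lambda>x. gm N c (T x))"
  by (cases rule: adm.cases) auto

lemma cells_Suc: "cells (Suc n) = (\<lambda>(c, k). gm N c ` k) ` (codes N \<times> cells n)"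
proof (intro equalityI subsetI)
  fix x assume "x \<in> cells (Suc n)"
  then obtain S where S: "adm N (Suc n) S" "x = S ` K" by (auto simp: cells_def)
  obtain c T where c: "c \<in> codes N" "adm N n T" "S = (\<lambda>x. gm N c (T x))" using adm_Suc_cases[OF S(1)] by blast
  have "x = gm N c ` T ` K" using S(2) c(3) by (simp add: image_image)
  moreover have "T ` K \<in> cells n" using c(2) by (auto simp: cells_def)
  ultimately show "x \<in> (\<lambda>(c, k). gm N c ` k) ` (codes N \<times> cells n)" using c(1) by force
next
  fix x assume "x \<in> (\<lambda>(c, k). gm N c ` k) ` (codes N \<times> cells n)"
  then obtain c T where c: "c \<in> codes N" "adm N n T" "x = gm N c ` T ` K" by (auto simp: cells_def)
  have "x = (\<lambda>x. gm N c (T x)) ` K" using c(3) by (simp add: image_image)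
  then show "x \<in> cells (Suc n)" unfolding cells_def using adm_Suc[OF c(1,2)] by blast
qed

lemma finite_cells: "finite (cells n)"
  by (induction n) (auto simp: cells_0 cells_Suc finite_codes)

lemma card_cells: "real (card (cells n)) \<le> M ^ n"
proof (induction n)
  case (Suc n)
  have "card (cells (Suc n)) \<le> card (codes N \<times> cells n)"
    unfolding cells_Suc using finite_codes finite_cells by (intro card_image_le) auto
  then have "real (card (cells (Suc n))) \<le> M * real (card (cells n))"
    by (simp add: card_cartesian_product M_def flip: of_nat_mult)
  also have "\<dots> \<le> M * M ^ n" using Suc M_pos(1) by (intro mult_left_mono) auto
  finally show ?case by simp
qed (simp add: cells_0)

lemma compact_adm: "adm N n S \<Longrightarrow> compact Z \<Longrightarrow> compact (S ` Z)"
  using adm_cont by (intro compact_continuous_image) auto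

lemma cells_compact: "k \<in> cells n \<Longrightarrow> compact k"
  using compact_adm K_compact by (auto simp: cells_def)

lemma cells_K: "k \<in> cells n \<Longrightarrow> k \<subseteq> K"
  using adm_K by (auto simp: cells_def)

lemma cells_tau: "bij \<pi> \<Longrightarrow> k \<in> cells n \<Longrightarrow> tau \<pi> ` k \<in> cells n"
proof -
  assume b: "bij \<pi>" and "k \<in> cells n"
  then obtain S where S: "adm N n S" "k = S ` K" by (auto simp: cells_def)
  then have "tau \<pi> ` k = (\<lambda>x. tau \<pi> (S x)) ` K" by (simp add: image_image)
  then show "tau \<pi> ` k \<in> cells n" unfolding cells_def using tau_adm[OF S(1) b] by blast
qed

lemma Union_cells: "\<Union>(cells n) = K"
proof (induction n)
  case (Suc n)
  have "\<Union>(cells (Suc n)) = (\<Union>c\<in>codes N. gm N c ` \<Union>(cells n))"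
    unfolding cells_Suc by auto
  then show ?case using Suc K_eq by simp
qed (simp add: cells_0)

text \<open>Invariance speaks of the twisted map \<open>f c\<close>, and the symmetry of \<mu> is
  not yet known. Since the family of n-cells is closed under \<open>tau\<close>, the twist can be
  absorbed into the smaller cell before the induction hypothesis is applied.\<close>

lemma mu_cells: "k \<in> cells n \<Longrightarrow> measure \<mu> k = 1 / M ^ n"
proof (induction n arbitrary: k)
  case 0
  then show ?case by (simp add: cells_0 mu_K)
next
  case (Suc n)
  then obtain c k' where c: "c \<in> codes N" "k' \<in> cells n" "k = gm N c ` k'" by (auto simp: cells_Suc)
  define k2 where "k2 = tau (inv (tw c)) ` k'"
  have k2: "k2 \<in> cells n" unfolding k2_def using cells_tau bij_imp_bij_inv[OF bij_tw] c by blast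
  have "k = f c ` k2" using f_image_gm[OF cells_K[OF c(2)], of c] c(3) by (simp add: k2_def)
  then have "M * measure \<mu> k = 1 / M ^ n"
    using mu_f[OF c(1) cells_compact[OF k2] cells_K[OF k2]] Suc.IH[OF k2] by simp
  then show ?case using M_pos(1) by (simp add: field_simps)
qed

lemma mu_cells_Int: "k \<in> cells n \<Longrightarrow> l \<in> cells n \<Longrightarrow> k \<noteq> l \<Longrightarrow> measure \<mu> (k \<inter> l) = 0"
proof (induction n arbitrary: k l)
  case 0
  then show ?case by (simp add: cells_0)
next
  case (Suc n)
  obtain c k' where c: "c \<in> codes N" "k' \<in> cells n" "k = gm N c ` k'" using Suc.prems by (auto simp: cells_Suc)
  obtain d l' where d: "d \<in> codes N" "l' \<in> cells n" "l = gm N d ` l'" using Suc.prems by (auto simp: cells_Suc)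
  show ?case
  proof (cases "c = d")
    case False
    have "k \<inter> l \<subseteq> gm N c ` K \<inter> gm N d ` K" using c d cells_K by blast
    moreover have "compact (gm N c ` K)" "compact (gm N d ` K)"
      using compact_adm[OF adm_gm] c d K_compact by auto
    ultimately show ?thesis
      using finite_measure_mono[of "k \<inter> l" "gm N c ` K \<inter> gm N d ` K"] gm_overlap_null[OF c(1) d(1) False] compact_sets
        measure_nonneg[of \<mu> "k \<inter> l"] by (metis sets.Int order_antisym)
  next
    case True
    have "k' \<noteq> l'" using Suc.prems(3) c d True by blast
    define k2 l2 where "k2 = tau (inv (tw c)) ` k'" and "l2 = tau (inv (tw c)) ` l'"
    have b: "bij (inv (tw c))" using bij_imp_bij_inv[OF bij_tw] .
    have k2: "k2 \<in> cells n" "l2 \<in> cells n" unfolding k2_def l2_def using cells_tau b c d by blast+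
    have ne: "k2 \<noteq> l2"
    proof
      assume "k2 = l2"
      then have "tau (tw c) ` k2 = tau (tw c) ` l2" by simp
      then show False using \<open>k' \<noteq> l'\<close> by (simp add: k2_def l2_def image_image tau_inv bij_tw)
    qed
    have inj: "inj (f c)" using dist_f[OF c(1)] by (intro injI) (metis dist_eq_0_iff divide_eq_0_iff Npos(3) less_irrefl)
    have "k = f c ` k2" "l = f c ` l2"
      using f_image_gm[OF cells_K[OF c(2)], of c] f_image_gm[OF cells_K[OF d(2)], of c] c(3) d(3) True by (simp_all add: k2_def l2_def)
    then have "k \<inter> l = f c ` (k2 \<inter> l2)" using inj by (simp add: image_Int)
    then have "M * measure \<mu> (k \<inter> l) = 0"
      using mu_f[OF c(1), of "k2 \<inter> l2"] Suc.IH[OF k2 ne] cells_compact[OF k2(1)] cells_compact[OF k2(2)] cells_K[OF k2(1)]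
      by (auto simp: compact_Int)
    then show ?thesis using M_pos(1) by simp
  qed
qed

lemma mu_Union:
  assumes "finite C" "\<And>k. k \<in> C \<Longrightarrow> compact k" "\<And>k l. k \<in> C \<Longrightarrow> l \<in> C \<Longrightarrow> k \<noteq> l \<Longrightarrow> measure \<mu> (k \<inter> l) = 0"
  shows "measure \<mu> (\<Union>C) = (\<Sum>k\<in>C. measure \<mu> k)"
proof (rule measure_Union_AE[OF assms(1)])
  show "S \<in> fmeasurable \<mu>" if "S \<in> C" for S
    using compact_sets[OF assms(2)[OF that]] by (simp add: fmeasurable_eq_sets)
  show "pairwise (\<lambda>S T. AE x in \<mu>. x \<notin> S \<or> x \<notin> T) C"
  proof (rule pairwiseI)
    fix S T assume ST: "S \<in> C" "T \<in> C" "S \<noteq> T"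
    have s: "S \<inter> T \<in> sets \<mu>" using compact_sets assms(2) ST by auto
    have "S \<inter> T \<in> null_sets \<mu>"
      using assms(3)[OF ST] s by (simp add: null_sets_def emeasure_eq_measure)
    then show "AE x in \<mu>. x \<notin> S \<or> x \<notin> T"
      using AE_not_in[of "S \<inter> T"] by simp
  qed
qed

lemma mu_Union_cells: "C \<subseteq> cells n \<Longrightarrow> measure \<mu> (\<Union>C) = card C / M ^ n"
proof -
  assume C: "C \<subseteq> cells n"
  have "measure \<mu> (\<Union>C) = (\<Sum>k\<in>C. measure \<mu> k)"
    using C finite_subset[OF C finite_cells] cells_compact mu_cells_Int by (intro mu_Union) blast+
  also have "\<dots> = (\<Sum>k\<in>C. 1 / M ^ n)" using C mu_cells by (intro sum.cong) auto
  finally show ?thesis by simp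
qed

lemma cells_diam: "k \<in> cells n \<Longrightarrow> x \<in> k \<Longrightarrow> y \<in> k \<Longrightarrow> dist x y \<le> 1 / N ^ n"
proof -
  assume k: "k \<in> cells n" "x \<in> k" "y \<in> k"
  then obtain S x' y' where S: "adm N n S" "x' \<in> K" "y' \<in> K" "x = S x'" "y = S y'" by (auto simp: cells_def)
  then have "dist x y = dist x' y' / N ^ n" using dist_adm by simp
  also have "\<dots> \<le> 1 / N ^ n" using dist_pyr_le_1[of x' y'] S K_pyr N4 by (intro divide_right_mono) auto
  finally show ?thesis .
qed

text \<open>The symmetry of \<mu> follows by counting. The n-cells meeting \<open>Z\<close> lie in
  the neighbourhood \<open>D n\<close>, and these shrink to \<open>Z\<close>;
  \<open>tau \<pi>\<close> maps n-cells to n-cells, all of mass \<open>1 / M ^ n\<close>.\<close>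

lemma mu_tau_le:
  assumes \<pi>: "bij \<pi>" and Z: "compact Z" "Z \<subseteq> K"
  shows "measure \<mu> (tau \<pi> ` Z) \<le> measure \<mu> Z"
proof (cases "Z = {}")
  case False
  have clZ: "closed Z" using Z(1) by (rule compact_imp_closed)
  define D where "D n = {x. infdist x Z \<le> 1 / N ^ n}" for n :: nat
  have clD: "closed (D n)" for n
    unfolding D_def by (intro closed_Collect_le continuous_intros)
  have pw: "(\<lambda>n. 1 / real_of_int N ^ n) \<longlonglongrightarrow> 0"
    using LIMSEQ_realpow_zero[of "1 / real_of_int N"] N4 by (simp add: power_divide)
  have lim: "(\<lambda>n. measure \<mu> (D n)) \<longlonglongrightarrow> measure \<mu> (\<Inter>n. D n)"
  proof (intro finite_Lim_measure_decseq decseq_SucI)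
    show "range D \<subseteq> sets \<mu>" using closed_sets clD by auto
    fix n
    have "1 / real_of_int N ^ Suc n \<le> 1 / real_of_int N ^ n"
      using N4 by (intro divide_left_mono) (auto simp: mult_le_cancel_right1)
    then show "D (Suc n) \<subseteq> D n" unfolding D_def by auto
  qed
  have "(\<Inter>n. D n) = Z"
  proof
    show "Z \<subseteq> (\<Inter>n. D n)" using N4 by (auto simp: D_def)
    show "(\<Inter>n. D n) \<subseteq> Z"
    proof
      fix x assume x: "x \<in> (\<Inter>n. D n)"
      have "infdist x Z \<le> 0" by (rule LIMSEQ_le_const[OF pw]) (use x in \<open>auto simp: D_def\<close>)
      then have "infdist x Z = 0" using infdist_nonneg[of x Z] by simp
      then show "x \<in> Z" using in_closed_iff_infdist_zero[OF clZ False] by blast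
    qed
  qed
  with lim have lim': "(\<lambda>n. measure \<mu> (D n)) \<longlonglongrightarrow> measure \<mu> Z" by simp
  show ?thesis
  proof (rule LIMSEQ_le_const[OF lim'])
    have "measure \<mu> (tau \<pi> ` Z) \<le> measure \<mu> (D n)" for n
    proof -
      define C where "C = {k \<in> cells n. k \<inter> Z \<noteq> {}}"
      have C: "C \<subseteq> cells n" "finite C" using finite_cells by (auto simp: C_def)
      have C2: "(`) (tau \<pi>) ` C \<subseteq> cells n" using C cells_tau[OF \<pi>] by blast
      have "tau \<pi> ` Z \<subseteq> \<Union>((`) (tau \<pi>) ` C)"
        using Z(2) Union_cells[of n] by (auto simp: C_def) blast
      then have "measure \<mu> (tau \<pi> ` Z) \<le> measure \<mu> (\<Union>((`) (tau \<pi>) ` C))"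
        using C C2 cells_compact by (intro finite_measure_mono compact_sets compact_Union) auto
      also have "\<dots> = card ((`) (tau \<pi>) ` C) / M ^ n" using mu_Union_cells[OF C2] .
      also have "\<dots> \<le> card C / M ^ n"
        using card_image_le[OF C(2), of "(`) (tau \<pi>)"] M_pos(1) by (intro divide_right_mono) auto
      also have "\<dots> = measure \<mu> (\<Union>C)" using mu_Union_cells[OF C(1)] by simp
      also have "\<dots> \<le> measure \<mu> (D n)"
      proof (rule finite_measure_mono)
        show "\<Union>C \<subseteq> D n"
        proof
          fix x assume "x \<in> \<Union>C"
          then obtain k z where k: "k \<in> cells n" "x \<in> k" "z \<in> k" "z \<in> Z" by (auto simp: C_def)
          have "infdist x Z \<le> dist x z" using k(4) by (rule infdist_le)
          then show "x \<in> D n" using cells_diam[OF k(1-3)] by (simp add: D_def)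
        qed
      qed (use clD closed_sets in auto)
      finally show ?thesis .
    qed
    then show "\<exists>N. \<forall>n\<ge>N. measure \<mu> (tau \<pi> ` Z) \<le> measure \<mu> (D n)" by blast
  qed
qed simp

lemma mu_tau:
  assumes \<pi>: "bij \<pi>" and Z: "compact Z" "Z \<subseteq> K"
  shows "measure \<mu> (tau \<pi> ` Z) = measure \<mu> Z"
proof (rule antisym)
  have "tau \<pi> ` Z \<subseteq> K" using K_tau[OF \<pi>] Z(2) by auto
  then have "measure \<mu> (tau (inv \<pi>) ` tau \<pi> ` Z) \<le> measure \<mu> (tau \<pi> ` Z)"
    by (rule mu_tau_le[OF bij_imp_bij_inv[OF \<pi>] compact_tau[OF \<pi> Z(1)]])
  then show "measure \<mu> Z \<le> measure \<mu> (tau \<pi> ` Z)"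
    by (simp add: image_image tau_inv \<pi>)
qed (rule mu_tau_le[OF assms])

lemma mu_adm:
  assumes "adm N n S" "compact Z" "Z \<subseteq> K"
  shows "M ^ n * measure \<mu> (S ` Z) = measure \<mu> Z"
  using assms
proof (induction arbitrary: Z rule: adm.induct)
  case (adm_0 \<pi>)
  then show ?case by (simp add: mu_tau)
next
  case (adm_Suc c n S)
  have SZ: "compact (S ` Z)" "S ` Z \<subseteq> K"
    using compact_adm[OF adm_Suc.hyps(2) adm_Suc.prems(1)] adm_K[OF adm_Suc.hyps(2)] adm_Suc.prems(2) by auto
  define Y where "Y = tau (inv (tw c)) ` S ` Z"
  have b: "bij (inv (tw c))" using bij_imp_bij_inv[OF bij_tw] .
  have Y: "compact Y" "Y \<subseteq> K" unfolding Y_def using compact_tau[OF b SZ(1)] K_tau[OF b] SZ(2) by auto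
  have "(\<lambda>x. gm N c (S x)) ` Z = f c ` Y"
    using f_image_gm[OF SZ(2), of c] by (simp add: Y_def image_image)
  then have "M * measure \<mu> ((\<lambda>x. gm N c (S x)) ` Z) = measure \<mu> (S ` Z)"
    using mu_f[OF adm_Suc.hyps(1) Y] mu_tau[OF b SZ] by (simp add: Y_def)
  then have "M ^ Suc n * measure \<mu> ((\<lambda>x. gm N c (S x)) ` Z) = M ^ n * measure \<mu> (S ` Z)"
    by (simp add: mult.assoc mult.left_commute)
  then show ?case using adm_Suc by simp
qed

section \<open>Enlarging small compact subsets of the surface\<close>

lemma hom_cont: "continuous_on A (hom y r)"
  unfolding hom_def by (intro continuous_intros)

lemma hom_diameter:
  assumes "bounded X"
  shows "diameter (hom y N ` X) = N * diameter X"
proof -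
  have "dist (hom y N u) (hom y N v) = N * dist u v" for u v using N4 by (intro dist_hom) simp
  from diameter_image_scale(2)[OF this Npos(3) assms] show ?thesis .
qed

text \<open>Inside one 1-cell the preimage does it. Otherwise the homothety \<open>g\<close> of a
  scalable set takes distinct cells of level \<open>Suc m\<close> to distinct cells of level
  \<open>m\<close>: every piece of \<open>X\<close> gains the factor M exactly, and the images of
  the pieces overlap in null sets.\<close>

lemma scale_up:
  assumes X: "compact X" "X \<subseteq> K" "X \<noteq> {}" and small: "diameter X < sqrt (2/3) / N ^ 3"
  shows "\<exists>Y. compact Y \<and> Y \<subseteq> K \<and> Y \<noteq> {} \<and> diameter Y = N * diameter X \<and> M * measure \<mu> X \<le> measure \<mu> Y"
proof (cases "\<exists>c\<in>codes N. X \<subseteq> gm N c ` K")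
  case True
  then obtain c where c: "c \<in> codes N" "X \<subseteq> gm N c ` K" by blast
  define Y where "Y = K \<inter> gm N c -` X"
  have cont: "continuous_on UNIV (gm N c)" using adm_cont[OF adm_gm[OF c(1)]] .
  have "closed (gm N c -` X)"
    by (rule closed_vimage[OF compact_imp_closed[OF X(1)] cont])
  then have Y: "compact Y" "Y \<subseteq> K" unfolding Y_def using K_compact by (auto simp: compact_Int_closed)
  have XY: "X = gm N c ` Y"
  proof (intro equalityI subsetI)
    fix x assume x: "x \<in> X"
    then obtain y where "y \<in> K" "x = gm N c y" using c(2) by blast
    then show "x \<in> gm N c ` Y" using x unfolding Y_def by blast
  next
    fix x assume "x \<in> gm N c ` Y"
    then show "x \<in> X" unfolding Y_def by blast
  qed
  have d: "dist (gm N c x) (gm N c y) = 1 / N * dist x y" for x y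
    by (simp add: dist_gm'[OF c(1)])
  have "0 < 1 / real_of_int N" by simp
  from diameter_image_scale(2)[OF d this compact_imp_bounded[OF Y(1)]]
  have "diameter X = 1 / N * diameter Y" unfolding XY[symmetric] .
  then have D: "diameter Y = N * diameter X" by simp
  have Mx: "M * measure \<mu> X = measure \<mu> Y"
    using mu_adm[OF adm_gm[OF c(1)] Y] unfolding XY[symmetric] by simp
  have "Y \<noteq> {}" using XY X(3) by blast
  with Y D Mx show ?thesis by (metis order_refl)
next
  case False
  have "dist u v < sqrt (2/3) / N ^ 3" if "u \<in> X" "v \<in> X" for u v
    using diameter_bounded_bound[OF compact_imp_bounded[OF X(1)] that] small by linarith
  then have "scalable X"
    using small_dichotomy[OF X(2)] False by blast
  then obtain y m where ym: "\<And>u. u \<in> X \<Longrightarrow> \<exists>S S'. adm N (Suc m) S \<and> adm N m S' \<and> u \<in> S ` K \<and> (\<forall>x. hom y N (S x) = S' x)"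
    unfolding scalable_def by blast
  define g where "g = hom y N"
  have ginj: "inj g"
    using dist_hom[of N y] N4 unfolding g_def by (intro injI) (metis dist_eq_0_iff less_imp_le mult_eq_0_iff Npos(3) less_irrefl)
  define T where "T = {k \<in> cells (Suc m). k \<inter> X \<noteq> {} \<and> (\<exists>S S'. adm N (Suc m) S \<and> adm N m S' \<and> k = S ` K \<and> (\<forall>x. g (S x) = S' x))}"
  have T: "finite T" "T \<subseteq> cells (Suc m)" using finite_cells by (auto simp: T_def)
  have XT: "X = (\<Union>k\<in>T. X \<inter> k)"
  proof
    show "X \<subseteq> (\<Union>k\<in>T. X \<inter> k)"
    proof
      fix u assume u: "u \<in> X"
      obtain S S' where S: "adm N (Suc m) S" "adm N m S'" "u \<in> S ` K" "\<forall>x. g (S x) = S' x"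
        using ym[OF u] unfolding g_def by blast
      have "S ` K \<in> T" unfolding T_def using S u by (auto simp: cells_def)
      then show "u \<in> (\<Union>k\<in>T. X \<inter> k)" using S(3) u by blast
    qed
  qed blast
  have gk: "g ` k \<in> cells m" if k: "k \<in> T" for k
  proof -
    obtain S S' where S: "adm N m S'" "k = S ` K" "\<And>x. g (S x) = S' x" using k unfolding T_def by blast
    have "g ` k = S' ` K" using S(2,3) by (simp add: image_image)
    then show ?thesis using S(1) by (auto simp: cells_def)
  qed
  have Xk: "compact (X \<inter> k)" if "k \<in> T" for k
    using X(1) cells_compact[of k "Suc m"] T that by (auto intro: compact_Int)
  have gc: "compact (g ` Z)" if "compact Z" for Z
    unfolding g_def by (intro compact_continuous_image hom_cont that)
  have gX: "measure \<mu> (g ` (X \<inter> k)) = M * measure \<mu> (X \<inter> k)" if k: "k \<in> T" for k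
  proof -
    obtain S S' where S: "adm N (Suc m) S" "adm N m S'" "k = S ` K" "\<And>x. g (S x) = S' x"
      using k unfolding T_def by blast
    define Z where "Z = K \<inter> S -` X"
    have "closed (S -` X)"
      by (rule closed_vimage[OF compact_imp_closed[OF X(1)] adm_cont[OF S(1)]])
    then have Z: "compact Z" "Z \<subseteq> K" unfolding Z_def using K_compact by (auto simp: compact_Int_closed)
    have e: "X \<inter> k = S ` Z" unfolding Z_def S(3) by blast
    have "g ` (X \<inter> k) = S' ` Z" unfolding e by (simp add: image_image S(4))
    moreover have "M ^ m * measure \<mu> (S' ` Z) = M ^ m * (M * measure \<mu> (S ` Z))"
      using mu_adm[OF S(1) Z] mu_adm[OF S(2) Z] by (simp add: ac_simps)
    ultimately show ?thesis
      using M_pos(1) unfolding e by simp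
  qed
  have "M * measure \<mu> X \<le> M * (\<Sum>k\<in>T. measure \<mu> (X \<inter> k))"
    using finite_measure_subadditive_finite[OF T(1), of "\<lambda>k. X \<inter> k"] Xk compact_sets XT M_pos(1)
    by (intro mult_left_mono) auto
  also have "\<dots> = (\<Sum>k\<in>T. measure \<mu> (g ` (X \<inter> k)))"
    using gX by (simp add: sum_distrib_left)
  also have "\<dots> = measure \<mu> (\<Union>k\<in>T. g ` (X \<inter> k))"
  proof (rule measure_UNION_AE[symmetric, OF T(1)])
    show "g ` (X \<inter> k) \<in> fmeasurable \<mu>" if "k \<in> T" for k
      using compact_sets[OF gc[OF Xk[OF that]]] by (simp add: fmeasurable_eq_sets)
    show "pairwise (\<lambda>i j. AE x in \<mu>. x \<notin> g ` (X \<inter> i) \<or> x \<notin> g ` (X \<inter> j)) T"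
    proof (rule pairwiseI)
      fix k l assume kl: "k \<in> T" "l \<in> T" "k \<noteq> l"
      have ne: "g ` k \<noteq> g ` l" using kl(3) ginj by (simp add: inj_image_eq_iff)
      have "g ` k \<inter> g ` l \<in> null_sets \<mu>"
        using mu_cells_Int[OF gk[OF kl(1)] gk[OF kl(2)] ne] cells_compact[OF gk[OF kl(1)]] cells_compact[OF gk[OF kl(2)]] compact_sets
        by (auto simp: null_sets_def emeasure_eq_measure)
      from AE_not_in[OF this] show "AE x in \<mu>. x \<notin> g ` (X \<inter> k) \<or> x \<notin> g ` (X \<inter> l)"
        by eventually_elim blast
    qed
  qed
  also have "(\<Union>k\<in>T. g ` (X \<inter> k)) = g ` X" using XT by (metis image_UN)
  finally have m: "M * measure \<mu> X \<le> measure \<mu> (g ` X)" .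
  have "g ` X \<subseteq> K"
  proof
    fix x assume "x \<in> g ` X"
    then obtain k where "k \<in> T" "x \<in> g ` k" using XT by blast
    then show "x \<in> K" using cells_K[OF gk] by blast
  qed
  then show ?thesis
    using m gc[OF X(1)] X(3) hom_diameter[OF compact_imp_bounded[OF X(1)], of y]
    by (intro exI[of _ "g ` X"]) (auto simp: g_def)
qed

section \<open>The two bounds for the Hausdorff measure\<close>

definition sN :: real where "sN = ln M / ln N"

lemma M_gt_1: "1 < M"
  unfolding M_pos(2) using zero_le_power2[of "real_of_int N"] by linarith

lemma ln_N_pos: "0 < ln (real_of_int N)"
  using N4 by (intro ln_gt_zero) simp

lemma sN_pos: "sN > 0"
  unfolding sN_def by (intro divide_pos_pos ln_gt_zero M_gt_1 ln_N_pos)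

lemma N_powr_sN: "real_of_int N powr sN = M"
proof -
  have "sN * ln (real_of_int N) = ln M" using ln_N_pos unfolding sN_def by simp
  then show ?thesis using M_pos(1) by (simp add: powr_def)
qed

lemma bounded_K: "bounded K" using K_compact by (rule compact_imp_bounded)

lemma diameter_cover:
  fixes n :: nat
  assumes X: "compact X" "X \<subseteq> K" "X \<noteq> {}"
  defines "C \<equiv> {k \<in> cells n. k \<inter> X \<noteq> {}}"
  shows "X \<subseteq> \<Union>C" "C \<noteq> {}" "C \<subseteq> cells n" "diameter (\<Union>C) \<le> diameter X + 2 / N ^ n"
proof -
  show sub: "X \<subseteq> \<Union>C"
  proof
    fix x assume x: "x \<in> X"
    then have "x \<in> \<Union>(cells n)" using X(2) unfolding Union_cells by blast
    then obtain k where "k \<in> cells n" "x \<in> k" by blast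
    then show "x \<in> \<Union>C" using x by (auto simp: C_def)
  qed
  show "C \<noteq> {}" using sub X(3) by blast
  show "C \<subseteq> cells n" by (auto simp: C_def)
  show "diameter (\<Union>C) \<le> diameter X + 2 / N ^ n"
  proof (rule diameter_le)
    show "\<Union>C \<noteq> {} \<or> 0 \<le> diameter X + 2 / N ^ n" using sub X(3) by blast
    fix u v assume "u \<in> \<Union>C" "v \<in> \<Union>C"
    then obtain k l x y where k: "k \<in> cells n" "l \<in> cells n" "u \<in> k" "x \<in> k" "x \<in> X" "v \<in> l" "y \<in> l" "y \<in> X"
      unfolding C_def by blast
    have "dist u v \<le> dist u x + dist x y + dist y v"
      using dist_triangle[of u v x] dist_triangle[of x v y] by linarith
    also have "\<dots> \<le> 1 / N ^ n + diameter X + 1 / N ^ n"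
      using cells_diam[OF k(1,3,4)] cells_diam[OF k(2,7,6)] diameter_bounded_bound[OF compact_imp_bounded[OF X(1)] k(5,8)]
      by linarith
    finally show "norm (u - v) \<le> diameter X + 2 / N ^ n" by (simp add: dist_norm)
  qed
qed

lemma Union_cells_pos:
  assumes "C \<subseteq> cells n" "C \<noteq> {}"
  shows "measure \<mu> (\<Union>C) > 0"
proof -
  have "card C > 0" using assms finite_subset[OF assms(1) finite_cells] by (simp add: card_gt_0_iff)
  then show ?thesis unfolding mu_Union_cells[OF assms(1)] using M_pos(1) by (intro divide_pos_pos) auto
qed

lemma set_bound:
  assumes a: "\<And>C. C \<subseteq> cells n \<Longrightarrow> C \<noteq> {} \<Longrightarrow> a \<le> diameter (\<Union>C) powr sN / measure \<mu> (\<Union>C)" and "0 \<le> a"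
    and X: "compact X" "X \<subseteq> K" "X \<noteq> {}"
  shows "a * exp (- (sqrt 6 * sN) / N powr (real n - 3)) * measure \<mu> X \<le> diameter X powr sN"
proof -
  define b where "b = a * exp (- (sqrt 6 * sN) / N powr (real n - 3))"
  have b0: "0 \<le> b" using assms(2) by (simp add: b_def)
  define c0 where "c0 = sqrt (2/3) / real_of_int N ^ 3"
  have c0: "c0 > 0" by (simp add: c0_def)
  have big: "b * measure \<mu> X \<le> diameter X powr sN"
    if X: "compact X" "X \<subseteq> K" "X \<noteq> {}" and d: "c0 \<le> diameter X" for X
  proof -
    define C where "C = {k \<in> cells n. k \<inter> X \<noteq> {}}"
    note C = diameter_cover[OF X, of n, folded C_def]
    have fin: "finite C" using finite_subset[OF C(3) finite_cells] .
    have pos: "measure \<mu> (\<Union>C) > 0" using Union_cells_pos C by blast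
    have UC: "compact (\<Union>C)" using fin C(3) cells_compact by (intro compact_Union) auto
    have dX: "diameter X > 0" using d c0 by linarith
    \<comment> \<open>An upper bound for the relative growth of the diameter from \<open>X\<close>
      to the union of the cells meeting it. By \<open>1 + q \<le> exp q\<close> it costs the factor
      \<open>exp (q * sN)\<close>.\<close>
    define q where "q = 2 / real_of_int N ^ n / c0"
    have q0: "q \<ge> 0" using c0 N4 unfolding q_def by (intro divide_nonneg_nonneg) auto
    have "diameter X + 2 / N ^ n \<le> diameter X * (1 + q)"
    proof -
      have "2 / real_of_int N ^ n = c0 * q" using c0 by (simp add: q_def)
      also have "\<dots> \<le> diameter X * q" using d q0 by (rule mult_right_mono)
      finally show ?thesis by (simp add: algebra_simps)
    qed
    also have "\<dots> \<le> diameter X * exp q"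
      using exp_ge_add_one_self[of q] dX by (intro mult_left_mono) auto
    finally have dC: "diameter (\<Union>C) \<le> diameter X * exp q" using C(4) by linarith
    have qe: "q * sN = sqrt 6 * sN / N powr (real n - 3)"
    proof -
      have "real_of_int N powr (real n - 3) = real_of_int N ^ n / real_of_int N ^ 3"
        using N4 powr_realpow[of N n] powr_realpow[of N 3] by (simp add: powr_diff)
      moreover have "2 / sqrt (2/3) = sqrt (6::real)"
      proof -
        have "sqrt 6 * sqrt (2/3) = sqrt (4::real)" by (simp flip: real_sqrt_mult)
        then show ?thesis by (simp add: field_simps)
      qed
      ultimately show ?thesis
        by (simp add: q_def c0_def flip: times_divide_eq_right) (simp add: field_simps)
    qed
    have "a * measure \<mu> X \<le> a * measure \<mu> (\<Union>C)"
      using C(1) compact_sets[OF UC] assms(2) by (intro mult_left_mono finite_measure_mono) auto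
    also have "\<dots> \<le> diameter (\<Union>C) powr sN"
      using a[OF C(3,2)] pos by (simp add: field_simps)
    also have "\<dots> \<le> (diameter X * exp q) powr sN"
      using dC sN_pos diameter_ge_0[OF compact_imp_bounded[OF UC]] by (intro powr_mono2) auto
    also have "\<dots> = diameter X powr sN * exp (q * sN)"
      using dX by (simp add: powr_mult exp_powr_real)
    finally have "a * measure \<mu> X * exp (- (q * sN)) \<le> diameter X powr sN * exp (q * sN) * exp (- (q * sN))"
      by (rule mult_right_mono) simp
    also have "\<dots> = diameter X powr sN" by (simp add: mult.assoc flip: exp_add)
    finally show ?thesis unfolding qe b_def by (simp add: algebra_simps)
  qed
  have ind: "b * measure \<mu> X \<le> diameter X powr sN"
    if X: "compact X" "X \<subseteq> K" "X \<noteq> {}" and d: "c0 \<le> N ^ j * diameter X" for j X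
    using that
  proof (induction j arbitrary: X)
    case 0
    then show ?case using big by simp
  next
    case (Suc j)
    show ?case
    proof (cases "c0 \<le> diameter X")
      case True
      then show ?thesis using big Suc.prems by blast
    next
      case False
      then obtain Y where Y: "compact Y" "Y \<subseteq> K" "Y \<noteq> {}" "diameter Y = N * diameter X" "M * measure \<mu> X \<le> measure \<mu> Y"
        using scale_up[OF Suc.prems(1-3)] unfolding c0_def by fastforce
      have "b * (M * measure \<mu> X) \<le> b * measure \<mu> Y" using Y(5) b0 by (rule mult_left_mono)
      also have "\<dots> \<le> diameter Y powr sN"
        using Suc.IH[OF Y(1-3)] Y(4) Suc.prems(4) by (simp add: mult.assoc mult.left_commute)
      also have "\<dots> = M * diameter X powr sN"
        unfolding Y(4) using N4 diameter_ge_0[OF compact_imp_bounded[OF Suc.prems(1)]]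
        by (simp add: powr_mult N_powr_sN)
      finally show ?thesis using M_pos(1) by (simp add: mult.left_commute)
    qed
  qed
  have "b * measure \<mu> X \<le> diameter X powr sN"
  proof (cases "diameter X = 0")
    case False
    then have "diameter X > 0" using diameter_ge_0[OF compact_imp_bounded[OF X(1)]] by simp
    moreover have "1 < real_of_int N" using N4 by simp
    ultimately obtain j where "c0 / diameter X < real_of_int N ^ j" using real_arch_pow by blast
    then have "c0 \<le> N ^ j * diameter X" using \<open>diameter X > 0\<close> by (simp add: field_simps)
    then show ?thesis using ind[OF X] by blast
  next
    case True
    \<comment> \<open>A single point never grows to size \<open>c0\<close>. Enlarging it forever
      instead shows that its measure is 0.\<close>
    have "M ^ j * measure \<mu> X \<le> 1" for j
    proof -
      have "\<exists>Y. compact Y \<and> Y \<subseteq> K \<and> Y \<noteq> {} \<and> diameter Y = 0 \<and> M ^ j * measure \<mu> X \<le> measure \<mu> Y"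
      proof (induction j)
        case 0
        then show ?case using X True by auto
      next
        case (Suc j)
        then obtain Y where Y: "compact Y" "Y \<subseteq> K" "Y \<noteq> {}" "diameter Y = 0" "M ^ j * measure \<mu> X \<le> measure \<mu> Y"
          by blast
        obtain Z where Z: "compact Z" "Z \<subseteq> K" "Z \<noteq> {}" "diameter Z = N * diameter Y" "M * measure \<mu> Y \<le> measure \<mu> Z"
          using scale_up[OF Y(1-3)] Y(4) c0 by (auto simp: c0_def)
        have "M * (M ^ j * measure \<mu> X) \<le> M * measure \<mu> Y" using Y(5) M_pos(1) by (intro mult_left_mono) auto
        then show ?case using Z Y(4) by (intro exI[of _ Z]) auto
      qed
      then obtain Y where "M ^ j * measure \<mu> X \<le> measure \<mu> Y" by blast
      then show ?thesis using prob_le_1[of Y] by linarith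
    qed
    moreover have "1 < M" using M_pos(2) zero_le_power2[of "real_of_int N"] by linarith
    ultimately have "measure \<mu> X = 0"
      using real_arch_pow[of M "1 / measure \<mu> X"] measure_nonneg[of \<mu> X]
      by (metis divide_less_eq less_eq_real_def not_less)
    then show ?thesis by simp
  qed
  then show ?thesis by (simp add: b_def)
qed

text \<open>Mass distribution principle: a covering set is replaced by the trace of its closure on
  \<open>K\<close>, which is compact and has no larger diameter. A bound for the content at scale 1
  is enough, as the Hausdorff measure is the supremum over all scales.\<close>

lemma hausdorff_lower:
  assumes a: "\<And>C. C \<subseteq> cells n \<Longrightarrow> C \<noteq> {} \<Longrightarrow> a \<le> diameter (\<Union>C) powr sN / measure \<mu> (\<Union>C)" and "0 \<le> a"
  shows "ennreal (a * exp (- (sqrt 6 * sN) / N powr (real n - 3))) \<le> hausdorff_measure sN K"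
proof -
  define b where "b = a * exp (- (sqrt 6 * sN) / N powr (real n - 3))"
  have b0: "0 \<le> b" using assms(2) by (simp add: b_def)
  have "ennreal b \<le> hausdorff_content sN 1 K"
    unfolding hausdorff_content_def
  proof (rule INF_greatest)
    fix U :: "nat \<Rightarrow> pt set"
    assume "U \<in> {U. K \<subseteq> (\<Union>i. U i) \<and> (\<forall>i. bounded (U i) \<and> diameter (U i) \<le> 1)}"
    then have U: "K \<subseteq> (\<Union>i. U i)" "\<And>i. bounded (U i)" by auto
    define X where "X i = K \<inter> closure (U i)" for i
    have X: "compact (X i)" "X i \<subseteq> K" for i using K_compact by (auto simp: X_def compact_Int_closed)
    have Xi: "ennreal b * emeasure \<mu> (X i) \<le> ennreal (diameter (U i) powr sN)" for i
    proof (cases "X i = {}")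
      case False
      have "b * measure \<mu> (X i) \<le> diameter (X i) powr sN"
        using set_bound[OF a assms(2) X False] by (simp add: b_def)
      also have "\<dots> \<le> diameter (closure (U i)) powr sN"
        using sN_pos diameter_ge_0[OF compact_imp_bounded[OF X(1)]] U(2)
        by (intro powr_mono2 diameter_subset bounded_closure) (auto simp: X_def)
      finally have "b * measure \<mu> (X i) \<le> diameter (U i) powr sN" using diameter_closure[OF U(2)] by simp
      then show ?thesis using b0 by (simp add: emeasure_eq_measure ennreal_leI flip: ennreal_mult)
    qed simp
    have "K \<subseteq> (\<Union>i. X i)"
    proof
      fix x assume x: "x \<in> K"
      then obtain i where "x \<in> U i" using U(1) by blast
      then have "x \<in> closure (U i)" using closure_subset by blast
      then show "x \<in> (\<Union>i. X i)" using x unfolding X_def by blast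
    qed
    then have "K = (\<Union>i. X i)" using X(2) by blast
    then have "emeasure \<mu> K \<le> (\<Sum>i. emeasure \<mu> (X i))"
      using emeasure_subadditive_countably[of X \<mu>] compact_sets[OF X(1)] by auto
    then have "ennreal b * emeasure \<mu> K \<le> ennreal b * (\<Sum>i. emeasure \<mu> (X i))" by (rule mult_left_mono) simp
    also have "\<dots> = (\<Sum>i. ennreal b * emeasure \<mu> (X i))" by simp
    also have "\<dots> \<le> (\<Sum>i. ennreal (diameter (U i) powr sN))" by (intro suminf_le Xi) auto
    finally show "ennreal b \<le> (\<Sum>i. ennreal (diameter (U i) powr sN))"
      using mu_K by (simp add: emeasure_eq_measure)
  qed
  also have "\<dots> \<le> hausdorff_measure sN K"
    unfolding hausdorff_measure_def by (rule SUP_upper) simp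
  finally show ?thesis by (simp add: b_def)
qed

lemma content_cell:
  assumes "k \<in> cells n"
  shows "hausdorff_content sN (\<delta> / real_of_int N ^ n) k \<le> ennreal (1 / M ^ n) * hausdorff_content sN \<delta> K"
proof -
  obtain S where S: "adm N n S" "k = S ` K" using assms by (auto simp: cells_def)
  have "(1 / real_of_int N ^ n) powr sN = 1 / M ^ n"
  proof -
    have "(real_of_int N ^ n) powr sN = (real_of_int N powr sN) powr n"
      using N4 by (simp add: powr_powr mult.commute flip: powr_realpow)
    then have "(real_of_int N ^ n) powr sN = M ^ n"
      unfolding N_powr_sN using M_pos(1) by (simp add: powr_realpow)
    then show ?thesis using N4 by (simp add: powr_divide)
  qed
  moreover have d: "dist (S x) (S y) = 1 / real_of_int N ^ n * dist x y" for x y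
    using dist_adm[OF S(1)] by simp
  moreover have p: "0 < 1 / real_of_int N ^ n" by simp
  ultimately show ?thesis
    using hausdorff_content_scale[OF d p, of sN \<delta> K] unfolding S(2) by simp
qed

text \<open>Let \<open>r\<close> be the content of \<open>K\<close> at scale 1. Covering the n-cells
  outside \<open>C\<close> by copies gives a linear inequality for \<open>r\<close>, whose solution
  is the claimed bound. Covering \<open>K\<close> by its l-cells, each of content at most
  \<open>r / M ^ l\<close> at scale \<open>1 / N ^ l\<close>, shows that \<open>r\<close> bounds the
  content at every scale.\<close>

lemma hausdorff_upper:
  assumes C: "C \<subseteq> cells n" "C \<noteq> {}"
  shows "hausdorff_measure sN K \<le> ennreal (diameter (\<Union>C) powr sN / measure \<mu> (\<Union>C))"
proof -
  have dK: "diameter K \<le> 1"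
    using K_nonempty dist_pyr_le_1 K_pyr by (intro diameter_le) (auto simp: dist_norm subset_iff)
  have UK: "\<Union>C \<subseteq> K" using C(1) cells_K by blast
  have bU: "bounded (\<Union>C)" "diameter (\<Union>C) \<le> 1"
    using bounded_subset[OF bounded_K UK] diameter_subset[OF UK bounded_K] dK by auto
  have finC: "finite C" using finite_subset[OF C(1) finite_cells] .
  have "hausdorff_content sN 1 K \<le> ennreal (diameter K powr sN)"
    using hausdorff_content_single[OF bounded_K dK] by simp
  \<comment> \<open>Finiteness is what permits the inequality to be solved for
    \<open>r\<close>.\<close>
  then obtain r where r: "0 \<le> r" "hausdorff_content sN 1 K = ennreal r"
    by (cases "hausdorff_content sN 1 K") (auto simp: top_unique)
  have cell1: "hausdorff_content sN 1 k \<le> ennreal (r / M ^ n)" if "k \<in> cells n" for k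
  proof -
    have "1 / real_of_int N ^ n \<le> 1" using N4 by simp
    then have "hausdorff_content sN 1 k \<le> hausdorff_content sN (1 / real_of_int N ^ n) k" by (rule hausdorff_content_antimono)
    also have "\<dots> \<le> ennreal (1 / M ^ n) * ennreal r" using content_cell[OF that, of 1] r by simp
    finally show ?thesis using r M_pos(1) by (simp flip: ennreal_mult)
  qed
  define D where "D = cells n - C"
  have "cells n = C \<union> D" using C(1) by (auto simp: D_def)
  then have "K = \<Union>C \<union> \<Union>D" using Union_cells[of n] by (metis Union_Un_distrib)
  then have "hausdorff_content sN 1 K \<le> hausdorff_content sN 1 (\<Union>C) + hausdorff_content sN 1 (\<Union>D)"
    using hausdorff_content_Un by metis
  also have "\<dots> \<le> ennreal (diameter (\<Union>C) powr sN) + (\<Sum>k\<in>D. ennreal (r / M ^ n))"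
  proof (rule add_mono)
    show "hausdorff_content sN 1 (\<Union>C) \<le> ennreal (diameter (\<Union>C) powr sN)"
      using hausdorff_content_single[OF bU] by simp
    have "hausdorff_content sN 1 (\<Union>D) \<le> (\<Sum>k\<in>D. hausdorff_content sN 1 k)"
      using finite_cells by (intro hausdorff_content_Union) (auto simp: D_def)
    also have "\<dots> \<le> (\<Sum>k\<in>D. ennreal (r / M ^ n))" using cell1 by (intro sum_mono) (auto simp: D_def)
    finally show "hausdorff_content sN 1 (\<Union>D) \<le> (\<Sum>k\<in>D. ennreal (r / M ^ n))" .
  qed
  also have "\<dots> = ennreal (diameter (\<Union>C) powr sN + card D * (r / M ^ n))"
    using r M_pos(1) by (simp add: ennreal_of_nat_eq_real_of_nat flip: ennreal_mult ennreal_plus)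
  finally have "ennreal r \<le> ennreal (diameter (\<Union>C) powr sN + card D * (r / M ^ n))"
    unfolding r(2) .
  moreover have "0 \<le> diameter (\<Union>C) powr sN + card D * (r / M ^ n)"
    using r(1) M_pos(1) by (intro add_nonneg_nonneg mult_nonneg_nonneg divide_nonneg_nonneg) auto
  ultimately have "r \<le> diameter (\<Union>C) powr sN + card D * (r / M ^ n)"
    by (simp only: ennreal_le_iff)
  moreover have "real (card D) \<le> M ^ n - card C"
  proof -
    have "card D + card C = card (cells n)"
      using card_Diff_subset[OF finC C(1)] card_mono[OF finite_cells C(1)] by (simp add: D_def)
    then have "real (card D) + card C = card (cells n)" by (simp flip: of_nat_add)
    then show ?thesis using card_cells[of n] by linarith
  qed
  then have "card D * (r / M ^ n) \<le> (M ^ n - card C) * (r / M ^ n)"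
    using r M_pos(1) by (intro mult_right_mono) auto
  moreover have "(M ^ n - card C) * (r / M ^ n) = r - measure \<mu> (\<Union>C) * r"
    using M_pos(1) mu_Union_cells[OF C(1)] by (simp add: field_simps)
  ultimately have "measure \<mu> (\<Union>C) * r \<le> diameter (\<Union>C) powr sN" by linarith
  then have rle: "r \<le> diameter (\<Union>C) powr sN / measure \<mu> (\<Union>C)"
    using Union_cells_pos[OF C] by (simp add: field_simps)
  have "hausdorff_content sN \<delta> K \<le> ennreal r" if d: "\<delta> > 0" for \<delta>
  proof -
    have "1 < real_of_int N" using N4 by simp
    then obtain l where "1 / \<delta> < real_of_int N ^ l" using real_arch_pow by blast
    then have "1 / real_of_int N ^ l \<le> \<delta>" using d by (simp add: field_simps)
    then have "hausdorff_content sN \<delta> K \<le> hausdorff_content sN (1 / real_of_int N ^ l) (\<Union>(cells l))"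
      unfolding Union_cells by (rule hausdorff_content_antimono)
    also have "\<dots> \<le> (\<Sum>k\<in>cells l. hausdorff_content sN (1 / real_of_int N ^ l) k)"
      using finite_cells N4 by (intro hausdorff_content_Union) auto
    also have "\<dots> \<le> (\<Sum>k\<in>cells l. ennreal (r / M ^ l))"
    proof (rule sum_mono)
      fix k assume "k \<in> cells l"
      then have "hausdorff_content sN (1 / real_of_int N ^ l) k \<le> ennreal (1 / M ^ l) * ennreal r"
        using content_cell[of k l 1] r by simp
      then show "hausdorff_content sN (1 / real_of_int N ^ l) k \<le> ennreal (r / M ^ l)" using r M_pos(1) by (simp flip: ennreal_mult)
    qed
    also have "\<dots> = ennreal (card (cells l) * (r / M ^ l))"
      using r M_pos(1) by (simp add: ennreal_of_nat_eq_real_of_nat flip: ennreal_mult)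
    also have "\<dots> \<le> ennreal r"
    proof (rule ennreal_leI)
      have "card (cells l) * (r / M ^ l) \<le> M ^ l * (r / M ^ l)"
        using card_cells[of l] r M_pos(1) by (intro mult_right_mono) auto
      then show "card (cells l) * (r / M ^ l) \<le> r" using M_pos(1) by simp
    qed
    finally show ?thesis .
  qed
  then have "hausdorff_measure sN K \<le> ennreal r"
    unfolding hausdorff_measure_def by (intro SUP_least) auto
  also have "\<dots> \<le> ennreal (diameter (\<Union>C) powr sN / measure \<mu> (\<Union>C))" using rle by (rule ennreal_leI)
  finally show ?thesis .
qed

end

section \<open>Koch iterated function systems\<close>

lemma range_kv: "range kv = {kv1, kv2, kv3}"
proof -
  have U: "(UNIV :: 3 set) = {1, 2, 3}" using exhaust_3 by auto
  show ?thesis unfolding U by (auto simp: kv_def)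
qed

lemma upper_ht: "x \<in> upper \<longleftrightarrow> 0 < ht x"
  by (simp add: upper_def ht_def zero_less_mult_iff)

lemma mk_bc: "mk (bc x) (ht x) = x"
  by (rule pt_eqI) (simp_all add: bc_mk)

lemma baseT_eq: "baseT = {x. ht x = 0 \<and> (\<forall>i. 0 \<le> bc x i)}"
proof
  have "convex {x. ht x = 0 \<and> (\<forall>i. 0 \<le> bc x i)}"
    unfolding convex_alt
  proof (clarify)
    fix x y u assume x: "ht x = 0" "\<forall>i. 0 \<le> bc x i" and y: "ht y = 0" "\<forall>i. 0 \<le> bc y i" and u: "(0::real) \<le> u" "u \<le> 1"
    have e: "(1 - u) *\<^sub>R x + u *\<^sub>R y = hom x u y" by (simp add: hom_def algebra_simps)
    have "bc (hom x u y) i = (1 - u) * bc x i + u * bc y i" for i by (simp add: bc_hom algebra_simps)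
    then show "ht ((1 - u) *\<^sub>R x + u *\<^sub>R y) = 0 \<and> (\<forall>i. 0 \<le> bc ((1 - u) *\<^sub>R x + u *\<^sub>R y) i)"
      unfolding e using x y u by (simp add: ht_hom)
  qed
  then show "baseT \<subseteq> {x. ht x = 0 \<and> (\<forall>i. 0 \<le> bc x i)}"
    unfolding baseT_def range_kv[symmetric]
    by (intro hull_minimal) (auto simp: bc_kv ht_kv)
  show "{x. ht x = 0 \<and> (\<forall>i. 0 \<le> bc x i)} \<subseteq> baseT"
  proof clarify
    fix x assume x: "ht x = 0" "\<forall>i. 0 \<le> bc x i"
    have z: "(vector [0, 0, 0] :: pt) = 0" by (simp add: vec_eq_iff forall_3)
    have "x = mk (bc x) (ht x)" by (simp add: mk_bc)
    also have "\<dots> = (\<Sum>i\<in>UNIV. bc x i *\<^sub>R kv i)" using x(1) z by (simp add: mk_def)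
    finally have e: "x = (\<Sum>i\<in>UNIV. bc x i *\<^sub>R kv i)" .
    have "(\<Sum>i\<in>UNIV. bc x i *\<^sub>R kv i) \<in> baseT"
      unfolding baseT_def range_kv[symmetric]
      by (rule convex_sum) (use x(2) in \<open>auto intro: hull_inc\<close>)
    with e show "x \<in> baseT" by simp
  qed
qed

lemma baseT_pyr: "baseT \<subseteq> pyr"
  by (auto simp: baseT_eq pyr_def)

lemma kv_baseT: "kv l \<in> baseT"
  by (simp add: baseT_eq bc_kv ht_kv)

text \<open>This makes every isometry of T permute its vertices. The squared differences add up to
  2, while the squares of each point add up to at most 1 and the mixed term is of the favourable
  sign; equality forces every coordinate to be 0 or 1.\<close>

lemma unit_distance_baseT:
  assumes "x \<in> baseT" "y \<in> baseT" "dist x y = 1"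
  shows "x \<in> range kv"
proof -
  have x: "ht x = 0" "\<And>i. 0 \<le> bc x i" and y: "ht y = 0" "\<And>i. 0 \<le> bc y i"
    using assms by (auto simp: baseT_eq)
  have le1: "bc z i \<le> 1" if "\<And>i. 0 \<le> bc z i" for z i
    using member_le_sum[of i UNIV "bc z"] that by simp
  have nn: "0 \<le> bc z i - (bc z i)\<^sup>2" if "\<And>i. 0 \<le> bc z i" for z i
    using mult_left_mono[OF le1[OF that, of i] that[of i]] by (simp add: power2_eq_square)
  have s: "(\<Sum>i\<in>UNIV. bc z i - (bc z i)\<^sup>2) = 1 - (\<Sum>i\<in>UNIV. (bc z i)\<^sup>2)" for z
    by (simp add: sum_subtractf)
  have "(\<Sum>i\<in>UNIV. (bc x i - bc y i)\<^sup>2) = 2"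
    using dist_sq[of x y] assms(3) x(1) y(1) by simp
  moreover have "(\<Sum>i\<in>UNIV. (bc x i - bc y i)\<^sup>2) = (\<Sum>i\<in>UNIV. (bc x i)\<^sup>2) + (\<Sum>i\<in>UNIV. (bc y i)\<^sup>2) - 2 * (\<Sum>i\<in>UNIV. bc x i * bc y i)"
    by (simp add: power2_diff sum.distrib sum_subtractf sum_distrib_left mult.assoc)
  moreover have "0 \<le> (\<Sum>i\<in>UNIV. bc x i * bc y i)" using x y by (intro sum_nonneg) auto
  moreover have "0 \<le> (\<Sum>i\<in>UNIV. bc y i - (bc y i)\<^sup>2)" using nn y by (intro sum_nonneg) auto
  moreover have "0 \<le> (\<Sum>i\<in>UNIV. bc x i - (bc x i)\<^sup>2)" using nn x by (intro sum_nonneg) auto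
  ultimately have "(\<Sum>i\<in>UNIV. bc x i - (bc x i)\<^sup>2) = 0" using s[of x] s[of y] by linarith
  then have "bc x i - (bc x i)\<^sup>2 = 0" for i
    using sum_nonneg_eq_0_iff[of UNIV "\<lambda>i. bc x i - (bc x i)\<^sup>2"] nn[of x, OF x(2)] by auto
  then have m: "bc x i * (1 - bc x i) = 0" for i by (simp add: power2_eq_square algebra_simps)
  have "sum (bc x) UNIV \<noteq> 0" unfolding sum_bc by (rule one_neq_zero)
  then obtain l where "bc x l \<noteq> 0" by (rule sum.not_neutral_contains_not_neutral)
  then have l: "bc x l = 1" using m[of l] mult_eq_0_iff[of "bc x l" "1 - bc x l"] by linarith
  obtain i j where T: "UNIV = {l, i, j}" "l \<noteq> i" "l \<noteq> j" "i \<noteq> j" by (metis triple_index)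
  have "bc x i = 0" "bc x j = 0"
    using bc_third[OF T(2-4), of x] l x(2)[of i] x(2)[of j] by linarith+
  then have "bc x q = bc (kv l) q" for q
    using triple_cases[OF T(1), of q] l T(2,3) by (auto simp: bc_kv)
  then have "x = kv l" by (intro pt_eqI) (simp_all add: x ht_kv)
  then show ?thesis by blast
qed

text \<open>Apex of the regular tetrahedron over T, the test point that detects orientation.\<close>

definition topD :: pt where "topD = mk (\<lambda>_. 1/3) 1"

lemma bc_topD: "bc topD i = 1/3"
  unfolding topD_def by (rule bc_mk) simp

lemma ht_topD: "ht topD = 1"
  by (simp add: topD_def)

lemma dist_kv_sq: "(dist x (kv l))\<^sup>2 = (\<Sum>i\<in>UNIV. (bc x i)\<^sup>2) / 2 + 1/2 + 2/3 * (ht x)\<^sup>2 - bc x l"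
proof -
  obtain i j where T: "UNIV = {l, i, j}" "l \<noteq> i" "l \<noteq> j" "i \<noteq> j" by (metis triple_index)
  have "(\<Sum>i\<in>UNIV. (bc x i - bc (kv l) i)\<^sup>2) = (\<Sum>i\<in>UNIV. (bc x i)\<^sup>2) + 1 - 2 * bc x l"
    using T(2-4) by (simp add: sum_triple[OF T] bc_kv power2_diff)
  then show ?thesis by (simp add: dist_sq ht_kv)
qed

text \<open>Distances to the three vertices determine the barycentric coordinates and the height up to sign;
  the sign is fixed by the image of one point above the triangle.\<close>

lemma rigid:
  assumes S: "\<And>x y. dist (S x) (S y) = dist x y" and T: "S ` baseT = baseT"
  obtains \<pi> where "bij \<pi>" "\<And>x i. bc (S x) i = bc x (\<pi> i)" "\<And>x. (ht (S x))\<^sup>2 = (ht x)\<^sup>2"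
    "ht (S topD) = 1 \<Longrightarrow> S = tau \<pi>"
proof -
  have "\<exists>q. S (kv l) = kv q" for l
  proof -
    obtain i j where t: "UNIV = {l, i, j}" "l \<noteq> i" "l \<noteq> j" "i \<noteq> j" by (metis triple_index)
    have "(dist (kv l) (kv i))\<^sup>2 = 1\<^sup>2"
      unfolding dist_kv_sq using t(2-4) by (simp add: sum_triple[OF t] bc_kv ht_kv)
    then have "dist (kv l) (kv i) = 1" by (simp only: power2_eq_iff_nonneg zero_le_dist zero_le_one)
    then have "dist (S (kv l)) (S (kv i)) = 1" using S by simp
    moreover have "S (kv l) \<in> baseT" "S (kv i) \<in> baseT" using T kv_baseT by blast+
    ultimately show ?thesis using unit_distance_baseT by blast
  qed
  then obtain \<sigma> where \<sigma>: "\<And>l. S (kv l) = kv (\<sigma> l)" by metis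
  have kvinj: "kv l = kv q \<Longrightarrow> l = q" for l q using bc_kv[of l l] bc_kv[of q l] by (auto split: if_splits)
  have "inj \<sigma>"
  proof (rule injI)
    fix l q assume "\<sigma> l = \<sigma> q"
    then have "dist (S (kv l)) (S (kv q)) = 0" using \<sigma> by simp
    then show "l = q" using S kvinj by simp
  qed
  then have b: "bij \<sigma>" using finite_UNIV_inj_surj[of \<sigma>] by (simp add: bij_def)
  have A: "bc (S x) (\<sigma> l) = bc x l \<and> (ht (S x))\<^sup>2 = (ht x)\<^sup>2" for x l
  proof -
    define a where "a x = (\<Sum>i\<in>UNIV. (bc x i)\<^sup>2) / 2 + 1/2 + 2/3 * (ht x)\<^sup>2" for x
    have e: "a x - bc x l = a (S x) - bc (S x) (\<sigma> l)" for l
      using S[of x "kv l"] dist_kv_sq[of x l] dist_kv_sq[of "S x" "\<sigma> l"] by (simp add: \<sigma> a_def)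
    have "(\<Sum>l\<in>UNIV. a x - bc x l) = (\<Sum>l\<in>UNIV. a (S x) - bc (S x) (\<sigma> l))" using e by simp
    then have "a x = a (S x)"
      using sum_perm[OF b, of "bc (S x)"] by (simp add: sum_subtractf)
    then have c: "bc (S x) (\<sigma> l) = bc x l" for l using e[of l] by simp
    have "(\<Sum>i\<in>UNIV. (bc (S x) i)\<^sup>2) = (\<Sum>i\<in>UNIV. (bc x i)\<^sup>2)"
      using sum_perm[OF b, of "\<lambda>i. (bc (S x) i)\<^sup>2"] by (simp add: c)
    then show ?thesis using \<open>a x = a (S x)\<close> c by (simp add: a_def)
  qed
  define \<pi> where "\<pi> = inv \<sigma>"
  have \<pi>: "bij \<pi>" "\<And>i. \<sigma> (\<pi> i) = i"
    using b by (simp_all add: \<pi>_def bij_imp_bij_inv bij_is_surj surj_f_inv_f)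
  have bc: "bc (S x) i = bc x (\<pi> i)" for x i using A[of x "\<pi> i"] \<pi>(2) by simp
  have ht: "(ht (S x))\<^sup>2 = (ht x)\<^sup>2" for x using A by blast
  have St: "S = tau \<pi>" if up: "ht (S topD) = 1"
  proof
    fix x
    have "(dist (S x) (S topD))\<^sup>2 = (dist x topD)\<^sup>2" using S by simp
    moreover have "(\<Sum>i\<in>UNIV. (bc (S x) i - bc (S topD) i)\<^sup>2) = (\<Sum>i\<in>UNIV. (bc x i - bc topD i)\<^sup>2)"
      using sum_perm[OF \<pi>(1), of "\<lambda>i. (bc x i - bc topD i)\<^sup>2"] by (simp add: bc)
    ultimately have "(ht (S x) - 1)\<^sup>2 = (ht x - 1)\<^sup>2" using up by (simp add: dist_sq ht_topD)
    then have "ht (S x) = ht x" using ht[of x] by (simp add: power2_diff)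
    then show "S x = tau \<pi> x" by (intro pt_eqI) (simp_all add: bc bc_tau[OF \<pi>(1)] ht_tau)
  qed
  show thesis by (rule that[OF \<pi>(1) bc ht]) (rule St)
qed

text \<open>Homotheties about 0 give homogeneity; the midpoint, a homothety of ratio 1/2, gives
  additivity.\<close>

lemma aff_linear:
  assumes "\<And>x y r. S (hom y r x) = hom (S y) r (S x)"
  shows "linear (\<lambda>x. S x - S 0)"
proof (rule linearI)
  fix x y :: pt and r :: real
  show "S (r *\<^sub>R x) - S 0 = r *\<^sub>R (S x - S 0)"
    using assms[of 0 r x] by (simp add: hom_def)
  have h: "S (2 *\<^sub>R z) - S 0 = 2 *\<^sub>R (S z - S 0)" for z
    using assms[of 0 2 z] by (simp add: hom_def)
  have m: "S (hom y (1/2) x) = hom (S y) (1/2) (S x)" using assms .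
  have "x + y = 2 *\<^sub>R hom y (1/2) x" by (simp add: hom_def algebra_simps flip: scaleR_2)
  then have "S (x + y) - S 0 = 2 *\<^sub>R (hom (S y) (1/2) (S x) - S 0)" using h[of "hom y (1/2) x"] m by simp
  also have "\<dots> = (S x - S 0) + (S y - S 0)"
    by (simp add: hom_def algebra_simps scaleR_2)
  finally show "S (x + y) - S 0 = (S x - S 0) + (S y - S 0)" .
qed

lemma aff_hull:
  assumes "\<And>x y r. S (hom y r x) = hom (S y) r (S x)"
  shows "S ` (convex hull V) = convex hull (S ` V)"
proof -
  define L where "L x = S x - S 0" for x
  have L: "linear L" unfolding L_def[abs_def] by (rule aff_linear[OF assms])
  have e: "S ` A = (\<lambda>x. S 0 + x) ` L ` A" for A by (simp add: L_def image_image)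
  have "S ` (convex hull V) = (\<lambda>x. S 0 + x) ` (convex hull (L ` V))"
    by (simp only: e convex_hull_linear_image[OF L])
  also have "\<dots> = convex hull ((\<lambda>x. S 0 + x) ` L ` V)"
    by (rule convex_hull_translation[symmetric])
  also have "\<dots> = convex hull (S ` V)" by (simp only: e)
  finally show ?thesis .
qed

section \<open>Targets of the system as images under the standard maps\<close>

context koch_scale
begin

lemma aff_gm: "c \<in> codes N \<Longrightarrow> gm N c (hom y r x) = hom (gm N c y) r (gm N c x)"
  using aff_adm[OF adm_gm] by (simp add: aff_def)

lemma surj_pl:
  assumes "m > 0" "box m k"
  shows "\<exists>y. pl m k y = x"
proof -
  define p where "p i = (if sum k UNIV = m - 1 then m * bc x i - k i else k i + 1 - m * bc x i)" for i
  have "(\<Sum>i\<in>UNIV. real_of_int (k i)) = real_of_int (sum k UNIV)" by simp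
  note R = this
  have "sum p UNIV = 1"
  proof (cases "sum k UNIV = m - 1")
    case True
    have "sum p UNIV = real_of_int m - (\<Sum>i\<in>UNIV. real_of_int (k i))"
      using True by (simp add: p_def sum_subtractf flip: sum_distrib_left)
    then show ?thesis unfolding R True by simp
  next
    case False
    then have m: "sum k UNIV = m - 2" using assms(2) by (simp add: box_def)
    have "sum p UNIV = (\<Sum>i\<in>UNIV. real_of_int (k i)) + 3 - real_of_int m"
      using False by (simp add: p_def sum_subtractf sum.distrib flip: sum_distrib_left)
    then show ?thesis unfolding R m by simp
  qed
  note p = bc_mk[OF this]
  have "pl m k (mk p (m * ht x)) = x"
  proof (rule pt_eqI)
    show "bc (pl m k (mk p (m * ht x))) i = bc x i" for i
      unfolding bc_pl[OF assms] p using assms(1) by (simp add: p_def)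
    show "ht (pl m k (mk p (m * ht x))) = ht x" using assms(1) by (simp add: ht_pl)
  qed
  then show ?thesis by blast
qed

lemma surj_gm: "c \<in> codes N \<Longrightarrow> \<exists>y. gm N c y = x"
proof (cases c)
  case (Pl k)
  assume "c \<in> codes N"
  then show ?thesis using surj_pl[of N k x] Pl by (simp add: Pl_codes)
next
  case (Lt j)
  obtain y where "pl N (mid N) y = x" using surj_pl[of N "mid N" x] by auto
  then have "gm N c (lti j y) = x" using Lt by (simp add: lt_lti)
  then show ?thesis by blast
qed

definition tgt :: "code \<Rightarrow> pt set" where "tgt c = gm N c ` baseT"

lemma tgt_hull: "c \<in> codes N \<Longrightarrow> tgt c = convex hull (gm N c ` range kv)"
  unfolding tgt_def baseT_def range_kv[symmetric] by (rule aff_hull) (rule aff_gm)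

text \<open>A target shared by two codes would, by \<open>overlap_rim\<close>, place the centroid of
  T on the boundary of T.\<close>

lemma tgt_inj: "inj_on tgt (codes N)"
proof (rule inj_onI, rule ccontr)
  fix c d assume cd: "c \<in> codes N" "d \<in> codes N" "tgt c = tgt d" "c \<noteq> d"
  define x where "x = mk (\<lambda>_. 1/3) 0"
  have bx: "bc x i = 1/3" for i unfolding x_def by (rule bc_mk) simp
  have x: "x \<in> baseT" by (simp add: baseT_eq bx) (simp add: x_def)
  then have "gm N c x \<in> tgt d" using cd(3) by (auto simp: tgt_def)
  then obtain y where y: "y \<in> baseT" "gm N c x = gm N d y" by (auto simp: tgt_def)
  have "x \<in> rim" using overlap_rim[OF cd(1,2,4) _ _ y(2)] x y(1) baseT_pyr by blast
  then show False using bx by (simp add: rim_def)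
qed

text \<open>\<open>F\<close> followed by the inverse of \<open>gm N c\<close> is an isometry
  preserving T. The last premise excludes that it swaps the two sides: its \<open>x\<close> is the
  mirror image of the apex \<open>topD\<close> in the plane of T.\<close>

lemma tgt_isometry:
  assumes c: "c \<in> codes N" and F: "\<And>x y. dist (F x) (F y) = dist x y / N" and T: "F ` baseT = tgt c"
    and up: "\<And>x. gm N c x = F topD \<Longrightarrow> ht x = -1 \<Longrightarrow> (\<And>i. bc x i = 1/3) \<Longrightarrow> False"
  shows "\<exists>\<pi>. bij \<pi> \<and> F = (\<lambda>x. gm N c (tau \<pi> x))"
proof -
  have "\<forall>x. \<exists>y. gm N c y = F x" using surj_gm[OF c] by blast
  then have "\<exists>S. \<forall>x. gm N c (S x) = F x" by (rule choice)
  then obtain S where S: "\<And>x. gm N c (S x) = F x" by blast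
  have d: "dist (S x) (S y) = dist x y" for x y
    using dist_gm'[OF c, of "S x" "S y"] F[of x y] S by simp
  have inj: "gm N c x = gm N c y \<Longrightarrow> x = y" for x y
    using dist_gm'[OF c, of x y] by simp
  have "S ` baseT = baseT"
  proof (intro equalityI subsetI)
    fix y assume "y \<in> S ` baseT"
    then obtain x where x: "x \<in> baseT" "y = S x" by blast
    then have "F x \<in> tgt c" using T by blast
    then obtain z where "z \<in> baseT" "gm N c z = F x" by (auto simp: tgt_def)
    then show "y \<in> baseT" using x S[of x] inj[of z "S x"] by simp
  next
    fix y assume y: "y \<in> baseT"
    then have "gm N c y \<in> F ` baseT" using T by (simp add: tgt_def)
    then obtain x where x: "x \<in> baseT" "gm N c y = F x" by blast
    have "gm N c y = gm N c (S x)" using x(2) S[of x] by simp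
    then have "y = S x" by (rule inj)
    then show "y \<in> S ` baseT" using x(1) by blast
  qed
  from rigid[of S, OF d this] obtain \<pi> where p: "bij \<pi>" "\<And>x i. bc (S x) i = bc x (\<pi> i)" "\<And>x. (ht (S x))\<^sup>2 = (ht x)\<^sup>2"
    "ht (S topD) = 1 \<Longrightarrow> S = tau \<pi>" by metis
  have "(ht (S topD))\<^sup>2 = 1" using p(3)[of topD] by (simp add: ht_topD)
  then have "ht (S topD) = 1 \<or> ht (S topD) = -1" by (simp add: power2_eq_1_iff)
  moreover have "bc (S topD) i = 1/3" for i using p(2) by (simp add: bc_topD)
  ultimately have "ht (S topD) = 1" using up[OF S] by blast
  then have "S = tau \<pi>" by (rule p(4))
  then have "F = (\<lambda>x. gm N c (tau \<pi> x))" using S by metis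
  then show ?thesis using p(1) by blast
qed

lemma real_nat_N: "real (nat N) = real_of_int N"
  by (rule of_nat_nat) (rule less_imp_le[OF Npos(1)])

lemma subtris_eq: "subtris (nat N) = (\<lambda>k. pl N k ` range kv) ` {k. box N k \<and> (\<forall>i. 0 \<le> k i)}"
proof -
  have bg: "bc (gridP (nat N) i j) q = (if q = 1 then real_of_int N - real i - real j else if q = 2 then real i else real j) / real_of_int N"
    and hg: "ht (gridP (nat N) i j) = 0" for i j q
  proof -
    define u v where "u = real i / real (nat N)" and "v = real j / real (nat N)"
    have k: "kv1 = kv 1" "kv2 = kv 2" "kv3 = kv 3" by (simp_all add: kv_def)
    have "bc (gridP (nat N) i j) q = bc (kv 1) q + u * (bc (kv 2) q - bc (kv 1) q) + v * (bc (kv 3) q - bc (kv 1) q)"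
      unfolding gridP_def k bc_def u_def[symmetric] v_def[symmetric]
      by (simp add: inner_add_left inner_diff_left algebra_simps)
    moreover note real_nat_N
    ultimately show "bc (gridP (nat N) i j) q = (if q = 1 then real_of_int N - real i - real j else if q = 2 then real i else real j) / real_of_int N"
      using exhaust_3[of q] by (auto simp: bc_kv u_def v_def diff_divide_distrib)
    show "ht (gridP (nat N) i j) = 0"
      unfolding gridP_def k u_def[symmetric] v_def[symmetric] ht_def
      by (simp only: vector_add_component vector_minus_component vector_scaleR_component kv_3) simp
  qed
  have r: "range h = {h 1, h 2, h 3}" for h :: "3 \<Rightarrow> pt"
  proof -
    have U: "(UNIV :: 3 set) = {1, 2, 3}" using exhaust_3 by auto
    show ?thesis unfolding U by simp
  qed
  \<comment> \<open>Scaled by N, the point \<open>gridP (nat N) i j\<close> has coordinates N - i -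
    j, i, j. The index of a triangle consists of the coordinatewise minima over its vertices;
    \<open>ku\<close> and \<open>kd\<close> are these minima for the two kinds of triangles.\<close>
  define ku where "ku i j = (\<lambda>q::3. if q = 1 then N - 1 - int i - int j else if q = 2 then int i else int j)" for i j
  define kd where "kd i j = (\<lambda>q::3. if q = 1 then N - 2 - int i - int j else if q = 2 then int i else int j)" for i j
  have su: "sum (ku i j) UNIV = N - 1" and sd: "sum (kd i j) UNIV = N - 2" for i j
    by (simp_all add: ku_def kd_def sum_3)
  have b: "box N (ku i j)" "box N (kd i j)" for i j using su sd by (auto simp: box_def)
  have q3: "q \<noteq> 3 \<Longrightarrow> q \<noteq> 2 \<Longrightarrow> q = 1" for q :: 3 using exhaust_3[of q] by blast
  have u: "pl N (ku i j) (kv 1) = gridP (nat N) i j" "pl N (ku i j) (kv 2) = gridP (nat N) (i+1) j"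
    "pl N (ku i j) (kv 3) = gridP (nat N) i (j+1)" for i j
    by (rule pt_eqI; simp add: bc_pl b su bg hg ht_pl ht_kv bc_kv; (simp add: ku_def)?; (blast intro: q3)?)+
  have d: "pl N (kd i j) (kv 1) = gridP (nat N) (i+1) (j+1)" "pl N (kd i j) (kv 2) = gridP (nat N) i (j+1)"
    "pl N (kd i j) (kv 3) = gridP (nat N) (i+1) j" for i j
    by (rule pt_eqI; simp add: bc_pl b sd bg hg ht_pl ht_kv bc_kv; (simp add: kd_def)?; (blast intro: q3)?)+
  have ru: "pl N (ku i j) ` range kv = {gridP (nat N) i j, gridP (nat N) (i+1) j, gridP (nat N) i (j+1)}" for i j
    unfolding r image_insert image_empty u by (rule refl)
  have rd: "pl N (kd i j) ` range kv = {gridP (nat N) (i+1) j, gridP (nat N) i (j+1), gridP (nat N) (i+1) (j+1)}" for i j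
    unfolding r image_insert image_empty d by blast
  show ?thesis
  proof (intro equalityI subsetI)
    fix V assume "V \<in> subtris (nat N)"
    then consider i j where "V = {gridP (nat N) i j, gridP (nat N) (i+1) j, gridP (nat N) i (j+1)}" "i + j < nat N"
      | i j where "V = {gridP (nat N) (i+1) j, gridP (nat N) i (j+1), gridP (nat N) (i+1) (j+1)}" "i + j + 2 \<le> nat N"
      unfolding subtris_def by blast
    then show "V \<in> (\<lambda>k. pl N k ` range kv) ` {k. box N k \<and> (\<forall>i. 0 \<le> k i)}"
    proof cases
      case 1
      have "\<forall>q. 0 \<le> ku i j q" using 1(2) by (auto simp: ku_def)
      then show ?thesis using b(1)[of i j] 1(1) ru[of i j] by blast
    next
      case 2
      have "\<forall>q. 0 \<le> kd i j q" using 2(2) by (auto simp: kd_def)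
      then show ?thesis using b(2)[of i j] 2(1) rd[of i j] by blast
    qed
  next
    fix V assume "V \<in> (\<lambda>k. pl N k ` range kv) ` {k. box N k \<and> (\<forall>i. 0 \<le> k i)}"
    then obtain k where k: "box N k" "\<And>i. 0 \<le> k i" "V = pl N k ` range kv" by blast
    have s3: "sum k UNIV = k 1 + k 2 + k 3" by (simp add: sum_3)
    define i j where "i = nat (k 2)" and "j = nat (k 3)"
    have ij: "int i = k 2" "int j = k 3" using k(2) by (simp_all add: i_def j_def)
    show "V \<in> subtris (nat N)"
    proof (cases "sum k UNIV = N - 1")
      case True
      have "k q = ku i j q" for q using exhaust_3[of q] True ij s3 by (auto simp: ku_def)
      then have e: "k = ku i j" by blast
      have "i + j < nat N" using True s3 ij k(2)[of 1] by linarith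
      then show ?thesis unfolding k(3) e ru subtris_def by blast
    next
      case False
      then have s: "sum k UNIV = N - 2" using k(1) by (simp add: box_def)
      have "k q = kd i j q" for q using exhaust_3[of q] s ij s3 by (auto simp: kd_def)
      then have e: "k = kd i j" by blast
      have "i + j + 2 \<le> nat N" using s s3 ij k(2)[of 1] by linarith
      then show ?thesis unfolding k(3) e rd subtris_def by blast
    qed
  qed
qed

lemma zero_bc: "bc 0 i = 1/3" and zero_ht: "ht 0 = 0"
  by (simp_all add: bc_def ht_def)

lemma pl_kv_inj: "box N k \<Longrightarrow> inj (\<lambda>l. pl N k (kv l))"
proof (rule injI)
  fix l q assume k: "box N k" "pl N k (kv l) = pl N k (kv q)"
  then have "dist (kv l) (kv q) = 0" using dist_pl[OF Npos(1) k(1), of "kv l" "kv q"] by simp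
  then show "l = q" using bc_kv[of l l] bc_kv[of q l] by (auto split: if_splits)
qed

lemma pl_hull: "box N k \<Longrightarrow> convex hull (pl N k ` range kv) = pl N k ` baseT"
  unfolding baseT_def range_kv[symmetric]
  using aff_pl[OF Npos(1), of k] by (intro aff_hull[symmetric]) (simp add: aff_def)

lemma real_N: "real_of_int N = 3 * real_of_int (N div 3) + (if up then 1 else 2)"
proof -
  have "real_of_int N = real_of_int (3 * (N div 3) + (if up then 1 else 2))"
    by (rule arg_cong[OF sum_mid])
  also have "\<dots> = 3 * real_of_int (N div 3) + (if up then 1 else 2)" by simp
  finally show ?thesis .
qed

lemma sum_mid_verts: "(\<Sum>(pl N (mid N) ` range kv)) = 0"
proof -
  have e: "(\<Sum>(pl N (mid N) ` range kv)) = (\<Sum>l\<in>UNIV. pl N (mid N) (kv l))"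
    unfolding image_image using pl_kv_inj[OF box_mid'] by (simp add: sum.reindex)
  obtain q :: real where q: "real_of_int (N div 3) = q" by blast
  have N: "real_of_int N = 3 * q + (if up then 1 else 2)"
    using real_N unfolding q .
  have bs: "bc (pl N (mid N) x) i = (if up then q + bc x i else q + 1 - bc x i) / N" for x i
    unfolding bc_pl[OF Npos(1) box_mid'] mid_up using q by (simp add: mid_def)
  have "(1/3) *\<^sub>R (\<Sum>l\<in>UNIV. pl N (mid N) (kv l)) = 0"
  proof (rule pt_eqI)
    fix i
    have "bc ((1/3) *\<^sub>R (\<Sum>l\<in>UNIV. pl N (mid N) (kv l))) i = (\<Sum>l\<in>UNIV. bc (pl N (mid N) (kv l)) i) / 3"
      by (simp add: bc_def inner_sum_left sum.distrib sum_distrib_left add_divide_distrib)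
        (simp flip: sum_divide_distrib)
    also have "\<dots> = 1/3"
    proof -
      have "(\<Sum>l\<in>UNIV. bc (pl N (mid N) (kv l)) i) = (\<Sum>l\<in>UNIV. (if up then q + bc (kv l) i else q + 1 - bc (kv l) i)) / N"
        unfolding bs by (simp add: sum_divide_distrib)
      also have "(\<Sum>l\<in>UNIV. (if up then q + bc (kv l) i else q + 1 - bc (kv l) i)) = 3 * q + (if up then 1 else 2)"
        using exhaust_3[of i] by (auto simp: bc_kv sum_3)
      finally show ?thesis using N Npos(3) by simp
    qed
    finally show "bc ((1/3) *\<^sub>R (\<Sum>l\<in>UNIV. pl N (mid N) (kv l))) i = bc 0 i" by (simp add: zero_bc)
  next
    have "ht (\<Sum>l\<in>UNIV. pl N (mid N) (kv l)) = (\<Sum>l\<in>UNIV. ht (pl N (mid N) (kv l)))"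
      by (simp add: ht_def sum_distrib_left)
    then have z: "ht (\<Sum>l\<in>UNIV. pl N (mid N) (kv l)) = 0" by (simp add: ht_pl ht_kv)
    show "ht ((1/3) *\<^sub>R (\<Sum>l\<in>UNIV. pl N (mid N) (kv l))) = ht 0"
      using z by (simp add: ht_def)
  qed
  then show ?thesis using e by simp
qed

text \<open>All coordinates of the origin are 1/3, so N / 3 lies between \<open>k i\<close> and
  \<open>k i + 1\<close>; as 3 does not divide N, this determines \<open>k i\<close>.\<close>

lemma zero_mid:
  assumes "box N k" "0 \<in> convex hull (pl N k ` range kv)"
  shows "k = mid N"
proof
  fix i
  obtain x where x: "x \<in> pyr" "0 = pl N k x" using assms pl_hull baseT_pyr by blast
  have "k i \<le> N * (1/3)" "N * (1/3) \<le> k i + 1"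
    using pl_box[OF Npos(1) assms(1) x(1), of i] pyrD(1)[OF x(1)] unfolding x(2)[symmetric] zero_bc by linarith+
  then have "3 * k i \<le> N" "N \<le> 3 * k i + 3" by linarith+
  then show "k i = mid N i" using N3 unfolding mid_def by presburger
qed

lemma zero_rel_interior_mid: "0 \<in> rel_interior (convex hull (pl N (mid N) ` range kv))"
proof -
  let ?V = "pl N (mid N) ` range kv"
  have card: "card ?V = 3"
    using card_image[OF pl_kv_inj[OF box_mid']] by (simp add: image_image)
  have fin: "finite ?V" by simp
  have "sum (\<lambda>x. 1/3::real) ?V = 1" using card by simp
  moreover have "sum (\<lambda>x. (1/3::real) *\<^sub>R x) ?V = 0"
    using sum_mid_verts by (simp only: scaleR_right.sum[symmetric] scaleR_zero_right)
  ultimately have "\<exists>u. (\<forall>x\<in>?V. 0 < u x \<and> u x < (1::real)) \<and> sum u ?V = 1 \<and> (\<Sum>x\<in>?V. u x *\<^sub>R x) = 0"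
    by (intro exI[of _ "\<lambda>_. 1/3"]) simp
  then show ?thesis using explicit_subset_rel_interior_convex_hull[OF fin] by blast
qed

lemma midtri_eq: "midtri (nat N) = pl N (mid N) ` range kv"
  unfolding midtri_def
proof (rule the_equality)
  let ?V = "pl N (mid N) ` range kv"
  have "?V \<in> subtris (nat N)"
    unfolding subtris_eq using kappa(1) box_mid' by (intro imageI) (simp add: mid_def)
  then show "?V \<in> subtris (nat N) \<and> 0 \<in> rel_interior (convex hull ?V)" using zero_rel_interior_mid by blast
  fix V assume V: "V \<in> subtris (nat N) \<and> 0 \<in> rel_interior (convex hull V)"
  then obtain k where k: "box N k" "V = pl N k ` range kv" unfolding subtris_eq by blast
  have "0 \<in> convex hull V" using V rel_interior_subset by blast
  then show "V = ?V" using zero_mid[OF k(1)] k(2) by simp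
qed

lemma apex_eq: "apex (nat N) = pl N (mid N) topD"
proof (rule pt_eqI)
  have a: "apex (nat N) = vector [0, 0, sqrt (2/3) / N]"
    unfolding apex_def midtri_eq sum_mid_verts by (simp add: real_nat_N)
  have b1: "bc (apex (nat N)) i = 1/3" for i
    unfolding a bc_def by (simp add: kv_def kv1_def kv2_def kv3_def inner_vec_def sum_3)
  have b2: "bc (pl N (mid N) topD) i = 1/3" for i
  proof -
    obtain q :: real where q: "real_of_int (N div 3) = q" by blast
    have N: "real_of_int N = 3 * q + (if up then 1 else 2)"
      using real_N unfolding q .
    have "bc (pl N (mid N) topD) i * N = (if up then q + 1/3 else q + 1 - 1/3)"
      unfolding bc_pl[OF Npos(1) box_mid'] mid_up bc_topD using q by (simp add: mid_def)
    then have "bc (pl N (mid N) topD) i * N = 1/3 * N" unfolding N by auto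
    then show ?thesis by (rule mult_right_cancel[THEN iffD1, rotated]) simp
  qed
  show "bc (apex (nat N)) i = bc (pl N (mid N) topD) i" for i by (rule trans[OF b1 b2[symmetric]])
  have "sqrt (3/2) * sqrt (2/3) = (1::real)" by (simp flip: real_sqrt_mult)
  then show "ht (apex (nat N)) = ht (pl N (mid N) topD)"
    unfolding a ht_pl ht_topD by (simp add: ht_def)
qed

lemma lt_kv: "lt j (kv l) = (if l = j then topD else kv l)"
proof (cases "l = j")
  case True
  have "lt j (kv j) = topD" by (rule pt_eqI) (auto simp: bc_lt ht_lt bc_kv ht_kv bc_topD ht_topD)
  then show ?thesis using True by simp
next
  case False
  have "lt j (kv l) = kv l" by (rule pt_eqI) (use False in \<open>auto simp: bc_lt ht_lt bc_kv ht_kv\<close>)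
  then show ?thesis using False by simp
qed

lemma planar_targets_eq: "planar_targets (nat N) = tgt ` {c \<in> codes N. \<exists>k. c = Pl k}"
proof -
  have t: "tgt (Pl k) = convex hull (pl N k ` range kv)" if "box N k" for k
    unfolding tgt_def pl_hull[OF that] by simp
  have ne: "pl N k ` range kv = pl N (mid N) ` range kv \<longleftrightarrow> k = mid N" if "box N k" for k
  proof
    assume e: "pl N k ` range kv = pl N (mid N) ` range kv"
    have "0 \<in> convex hull (pl N k ` range kv)"
      unfolding e using zero_rel_interior_mid rel_interior_subset by blast
    then show "k = mid N" using zero_mid[OF that] by blast
  qed simp
  have "subtris (nat N) - {midtri (nat N)} = (\<lambda>k. pl N k ` range kv) ` {k. box N k \<and> (\<forall>i. 0 \<le> k i) \<and> k \<noteq> mid N}"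
    unfolding subtris_eq midtri_eq using ne by (auto simp: image_iff)
  then have "planar_targets (nat N) = (\<lambda>k. convex hull (pl N k ` range kv)) ` {k. box N k \<and> (\<forall>i. 0 \<le> k i) \<and> k \<noteq> mid N}"
    unfolding planar_targets_def by (simp add: image_image)
  also have "\<dots> = (\<lambda>k. tgt (Pl k)) ` {k. box N k \<and> (\<forall>i. 0 \<le> k i) \<and> k \<noteq> mid N}"
    by (intro image_cong refl) (simp add: t)
  also have "\<dots> = tgt ` Pl ` {k. box N k \<and> (\<forall>i. 0 \<le> k i) \<and> k \<noteq> mid N}" by (simp only: image_image)
  also have "Pl ` {k. box N k \<and> (\<forall>i. 0 \<le> k i) \<and> k \<noteq> mid N} = {c \<in> codes N. \<exists>k. c = Pl k}"
    by (auto simp: codes_def)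
  finally show ?thesis .
qed

lemma face_targets_eq: "face_targets (nat N) = tgt ` range Lt"
proof -
  have "convex hull (insert (apex (nat N)) (midtri (nat N) - {pl N (mid N) (kv j)})) = tgt (Lt j)" for j
  proof -
    have "gm N (Lt j) ` range kv = insert (pl N (mid N) topD) (pl N (mid N) ` range kv - {pl N (mid N) (kv j)})"
      using pl_kv_inj[OF box_mid'] by (auto simp: image_iff lt_kv inj_def split: if_splits)
    then show ?thesis unfolding tgt_hull[OF Lt_codes] midtri_eq apex_eq by simp
  qed
  then show ?thesis unfolding face_targets_def midtri_eq image_image by simp
qed

lemma targets_eq: "planar_targets (nat N) \<union> face_targets (nat N) = tgt ` codes N"
proof -
  have "codes N = {c \<in> codes N. \<exists>k. c = Pl k} \<union> range Lt" by (auto simp: codes_def)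
  then show ?thesis unfolding planar_targets_eq face_targets_eq by (metis image_Un)
qed

text \<open>The orientation clauses exclude the mirror image. On a planar target it would send the
  apex \<open>topD\<close> below the plane; on the lateral face opposite to vertex \<open>j\<close>
  it would send it to that vertex, a point of \<open>tetra\<close>.\<close>

lemma ifs_cell:
  assumes F: "koch_ifs (nat N) F" and i: "i \<in> {1..(nat N)\<^sup>2 + 2}" and c: "c \<in> codes N" "F i ` baseT = tgt c"
  shows "\<exists>\<pi>. bij \<pi> \<and> F i = (\<lambda>x. gm N c (tau \<pi> x))"
proof (rule tgt_isometry[OF c(1) _ c(2)])
  show "dist (F i x) (F i y) = dist x y / N" for x y
    using F i Npos(1) unfolding koch_ifs_def by auto
  fix x assume x: "gm N c x = F i topD" "ht x = -1" "\<And>i. bc x i = 1/3"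
  have D: "topD \<in> upper" by (simp add: upper_ht ht_topD)
  show False
  proof (cases c)
    case (Pl k)
    then have "F i ` baseT \<in> planar_targets (nat N)" using c unfolding planar_targets_eq by blast
    then have "F i ` upper = upper" using F i unfolding koch_ifs_def by blast
    then have "gm N c x \<in> upper" using D x(1) by auto
    then have "0 < - 1 / real_of_int N" using x(2) Pl by (simp add: upper_ht ht_pl)
    then show False using Npos(1) by simp
  next
    case (Lt j)
    then have "F i ` baseT \<in> face_targets (nat N)" using c unfolding face_targets_eq by blast
    then have e: "F i ` upper \<inter> tetra (nat N) = {}" using F i unfolding koch_ifs_def by blast
    have "lt j x = kv j" by (rule pt_eqI) (auto simp: bc_lt ht_lt bc_kv ht_kv x)
    then have "F i topD = pl N (mid N) (kv j)" using x(1) Lt by simp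
    then have "F i topD \<in> tetra (nat N)"
      unfolding tetra_def midtri_eq by (auto intro: hull_inc)
    then show False using e D by blast
  qed
qed

end

section \<open>Reduction of an admissible system to the standard maps\<close>

locale koch_surface = koch_scale +
  fixes F :: "nat \<Rightarrow> pt \<Rightarrow> pt" and K :: "pt set" and \<mu> :: "pt measure"
  assumes ifs: "koch_ifs (nat N) F"
    and compact: "compact K" and nonempty: "K \<noteq> {}"
    and self_similar: "K = (\<Union>i\<in>{1..(nat N)\<^sup>2+2}. F i ` K)"
    and prob_space: "prob_space \<mu>" and sets_borel: "sets \<mu> = sets borel"
    and invariant: "\<forall>A\<in>sets borel. measure \<mu> A = (\<Sum>i = 1..(nat N)\<^sup>2+2. measure \<mu> (F i -` A)) / real ((nat N)\<^sup>2+2)"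
begin

abbreviation I :: "nat set" where "I \<equiv> {1..(nat N)\<^sup>2+2}"

definition cd :: "nat \<Rightarrow> code" where "cd i = inv_into (codes N) tgt (F i ` baseT)"

lemma F_bij: "bij_betw (\<lambda>i. F i ` baseT) I (tgt ` codes N)"
  using ifs unfolding koch_ifs_def targets_eq by blast

lemma cd_bij: "bij_betw cd I (codes N)"
proof -
  have "bij_betw (inv_into (codes N) tgt) (tgt ` codes N) (codes N)"
    using tgt_inj by (intro bij_betw_inv_into) (simp add: bij_betw_def)
  then have "bij_betw (inv_into (codes N) tgt \<circ> (\<lambda>i. F i ` baseT)) I (codes N)"
    using F_bij by (intro bij_betw_trans)
  then show ?thesis unfolding cd_def[abs_def] comp_def .
qed

lemma cd_tgt:
  assumes "i \<in> I"
  shows "cd i \<in> codes N" "F i ` baseT = tgt (cd i)"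
proof -
  show "cd i \<in> codes N" using cd_bij assms by (auto simp: bij_betw_def)
  have "F i ` baseT \<in> tgt ` codes N" using F_bij assms unfolding bij_betw_def by blast
  then show "F i ` baseT = tgt (cd i)" unfolding cd_def by (rule f_inv_into_f[symmetric])
qed

text \<open>The symmetry of the triangle by which \<open>F i\<close> differs from the standard map with the same target.\<close>

definition tw :: "code \<Rightarrow> 3 \<Rightarrow> 3" where
  "tw c = (if c \<in> codes N
     then SOME \<pi>. bij \<pi> \<and> F (inv_into I cd c) = (\<lambda>x. gm N c (tau \<pi> x)) else id)"

lemma tw:
  assumes "c \<in> codes N"
  shows "bij (tw c)" "F (inv_into I cd c) = (\<lambda>x. gm N c (tau (tw c) x))"
proof -
  have i: "inv_into I cd c \<in> I" and e: "cd (inv_into I cd c) = c"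
    using cd_bij assms by (simp_all only: bij_betw_def inv_into_into f_inv_into_f)
  have "F (inv_into I cd c) ` baseT = tgt c" using cd_tgt(2)[OF i] e by simp
  from someI_ex[OF ifs_cell[OF ifs i assms this]]
  show "bij (tw c)" "F (inv_into I cd c) = (\<lambda>x. gm N c (tau (tw c) x))"
    using assms by (simp_all only: tw_def if_True)
qed

lemma F_eq: "i \<in> I \<Longrightarrow> F i = (\<lambda>x. gm N (cd i) (tau (tw (cd i)) x))"
  using tw(2)[OF cd_tgt(1)] cd_bij by (simp only: bij_betw_def inv_into_f_f)

sublocale koch_measure N K tw \<mu>
proof (intro koch_measure.intro koch_attractor.intro koch_attractor_axioms.intro koch_measure_axioms.intro)
  show "bij (tw c)" for c
  proof (cases "c \<in> codes N")
    case True
    then show ?thesis by (rule tw(1))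
  qed (simp add: tw_def)
  have ci: "cd ` I = codes N" using cd_bij by (simp add: bij_betw_def)
  have "K = (\<Union>i\<in>I. (\<lambda>x. gm N (cd i) (tau (tw (cd i)) x)) ` K)"
    by (subst self_similar) (intro SUP_cong refl arg_cong2[where f = image] F_eq)
  also have "\<dots> = (\<Union>c\<in>cd ` I. (\<lambda>x. gm N c (tau (tw c) x)) ` K)" by (simp only: image_image)
  finally show "K = (\<Union>c\<in>codes N. (\<lambda>x. gm N c (tau (tw c) x)) ` K)" unfolding ci .
  have card: "card (codes N) = (nat N)\<^sup>2 + 2" using bij_betw_same_card[OF cd_bij] by simp
  show "real (card (codes N)) = (real_of_int N)\<^sup>2 + 2" unfolding card by (simp add: real_nat_N)
  fix A :: "pt set" assume A: "A \<in> sets borel"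
  have "(\<Sum>c\<in>codes N. measure \<mu> ((\<lambda>x. gm N c (tau (tw c) x)) -` A))
    = (\<Sum>i\<in>I. measure \<mu> ((\<lambda>x. gm N (cd i) (tau (tw (cd i)) x)) -` A))"
    by (rule sum.reindex_bij_betw[OF cd_bij, of "\<lambda>c. measure \<mu> ((\<lambda>x. gm N c (tau (tw c) x)) -` A)", symmetric])
  also have "\<dots> = (\<Sum>i\<in>I. measure \<mu> (F i -` A))"
    by (intro sum.cong refl) (simp only: F_eq)
  finally show "measure \<mu> A = (\<Sum>c\<in>codes N. measure \<mu> ((\<lambda>x. gm N c (tau (tw c) x)) -` A)) / card (codes N)"
    using invariant A unfolding card by simp
qed (fact koch_scale_axioms compact nonempty prob_space sets_borel)+

lemma kcells_0: "kcells (nat N) F K 0 = {K}"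
  by (auto simp: kcells_def kcell_def)

lemma kcells_Suc: "kcells (nat N) F K (Suc n) = (\<Union>i\<in>I. image (F i) ` kcells (nat N) F K n)"
proof (intro equalityI subsetI)
  fix k assume "k \<in> kcells (nat N) F K (Suc n)"
  then obtain w where w: "k = kcell F K w" "length w = Suc n" "set w \<subseteq> I" by (auto simp: kcells_def)
  \<comment> \<open>In \<open>kcell\<close> the last letter of a word is the outermost map, so the
    word is split at its end.\<close>
  then obtain i v where v: "w = v @ [i]" by (cases w rule: rev_cases) auto
  have "kcell F K v \<in> kcells (nat N) F K n" using w v unfolding kcells_def by auto
  moreover have "k = F i ` kcell F K v" using w(1) v by (simp add: kcell_def)
  moreover have "i \<in> I" using w(3) v by simp
  ultimately show "k \<in> (\<Union>i\<in>I. image (F i) ` kcells (nat N) F K n)" by blast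
next
  fix k assume "k \<in> (\<Union>i\<in>I. image (F i) ` kcells (nat N) F K n)"
  then obtain i v where v: "i \<in> I" "k = F i ` kcell F K v" "length v = n" "set v \<subseteq> I"
    by (auto simp: kcells_def)
  have "k = kcell F K (v @ [i])" using v(2) by (simp add: kcell_def)
  moreover have "length (v @ [i]) = Suc n" "set (v @ [i]) \<subseteq> I" using v by auto
  ultimately show "k \<in> kcells (nat N) F K (Suc n)" unfolding kcells_def by blast
qed

text \<open>The twists vanish because a symmetry merely permutes the cells of each level.\<close>

lemma kcells_eq: "kcells (nat N) F K n = cells n"
proof (induction n)
  case 0
  show ?case by (simp only: kcells_0 cells_0)
next
  case (Suc n)
  have t: "image (tau \<pi>) ` cells n = cells n" if b: "bij \<pi>" for \<pi>
  proof (intro equalityI subsetI)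
    fix k assume "k \<in> image (tau \<pi>) ` cells n"
    then show "k \<in> cells n" using cells_tau[OF b] by blast
  next
    fix k assume "k \<in> cells n"
    then have "tau (inv \<pi>) ` k \<in> cells n" by (rule cells_tau[OF bij_imp_bij_inv[OF b]])
    moreover have "k = tau \<pi> ` tau (inv \<pi>) ` k" by (simp add: image_image tau_inv(2)[OF b])
    ultimately show "k \<in> image (tau \<pi>) ` cells n" by (rule rev_image_eqI)
  qed
  have f: "image (F i) ` cells n = image (gm N (cd i)) ` cells n" if "i \<in> I" for i
  proof -
    have "image (F i) ` cells n = image (gm N (cd i)) ` (image (tau (tw (cd i))) ` cells n)"
      by (simp only: image_image F_eq[OF that])
    then show ?thesis by (simp only: t bij_tw)
  qed
  have ci: "cd ` I = codes N" using cd_bij by (simp add: bij_betw_def)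
  have "kcells (nat N) F K (Suc n) = (\<Union>i\<in>I. image (gm N (cd i)) ` cells n)"
    unfolding kcells_Suc Suc by (intro SUP_cong refl f)
  also have "\<dots> = (\<Union>c\<in>cd ` I. image (gm N c) ` cells n)" by (simp only: image_image)
  also have "\<dots> = cells (Suc n)" unfolding ci cells_Suc by auto
  finally show ?case .
qed

lemma koch_a_eq:
  "koch_a (nat N) F K \<mu> sN n = Min ((\<lambda>C. diameter (\<Union>C) powr sN / measure \<mu> (\<Union>C)) ` {C. C \<subseteq> cells n \<and> C \<noteq> {}})"
  unfolding koch_a_def kcells_eq by (rule arg_cong[of _ _ Min]) blast

lemma hausdorff_bounds:
  "hausdorff_measure sN K \<le> ennreal (koch_a (nat N) F K \<mu> sN n)"
  "ennreal (koch_a (nat N) F K \<mu> sN n * exp (- (sqrt 6 * sN) / N powr (real n - 3))) \<le> hausdorff_measure sN K"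
proof -
  let ?q = "\<lambda>C. diameter (\<Union>C) powr sN / measure \<mu> (\<Union>C)" and ?C = "{C. C \<subseteq> cells n \<and> C \<noteq> {}}"
  have fin: "finite (?q ` ?C)"
    using finite_cells[of n] by (intro finite_imageI finite_subset[of ?C "Pow (cells n)"]) auto
  have "cells n \<noteq> {}"
  proof (induction n)
    case (Suc n)
    have "Lt 1 \<in> codes N" by (rule Lt_codes)
    then show ?case using Suc unfolding cells_Suc by blast
  qed (simp add: cells_0)
  then have ne: "?q ` ?C \<noteq> {}" by blast
  have "Min (?q ` ?C) \<in> ?q ` ?C" by (rule Min_in[OF fin ne])
  then obtain C where C: "Min (?q ` ?C) = ?q C" "C \<subseteq> cells n" "C \<noteq> {}" by blast
  show "hausdorff_measure sN K \<le> ennreal (koch_a (nat N) F K \<mu> sN n)"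
    unfolding koch_a_eq C(1) by (rule hausdorff_upper[OF C(2,3)])
  have "0 \<le> koch_a (nat N) F K \<mu> sN n" unfolding koch_a_eq C(1) by simp
  moreover have "koch_a (nat N) F K \<mu> sN n \<le> ?q D" if "D \<subseteq> cells n" "D \<noteq> {}" for D
    unfolding koch_a_eq using that by (intro Min_le[OF fin] imageI) simp
  ultimately show "ennreal (koch_a (nat N) F K \<mu> sN n * exp (- (sqrt 6 * sN) / N powr (real n - 3))) \<le> hausdorff_measure sN K"
    by (intro hausdorff_lower)
qed

end

theorem theorem4:
  fixes N :: nat and F :: "nat \<Rightarrow> real^3 \<Rightarrow> real^3" and K :: "(real^3) set"
    and \<mu> :: "(real^3) measure" and n :: nat
  assumes "N > 2" and "\<not> 3 dvd N"
    and "koch_ifs N F"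
    and "compact K" and "K \<noteq> {}" and "K = (\<Union>i \<in> {1..N^2+2}. F i ` K)"
    and "prob_space \<mu>" and "sets \<mu> = sets borel"
    and "\<forall>A \<in> sets borel. measure \<mu> A =
            (\<Sum>i = 1..N^2+2. measure \<mu> (F i -` A)) / real (N^2+2)"
  shows "hausdorff_measure (ln (real N^2 + 2) / ln (real N)) K
           \<le> ennreal (koch_a N F K \<mu> (ln (real N^2 + 2) / ln (real N)) n)
       \<and> ennreal (koch_a N F K \<mu> (ln (real N^2 + 2) / ln (real N)) n
             * exp (- (sqrt 6 * (ln (real N^2 + 2) / ln (real N))) / real N powr (real n - 3)))
           \<le> hausdorff_measure (ln (real N^2 + 2) / ln (real N)) K"
proof -
  \<comment> \<open>This raises the hypothesis to N \<ge> 4, as \<open>koch_scale\<close>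
    demands.\<close>
  have "N \<noteq> 3" using assms(2) by auto
  then have N4: "int N \<ge> 4" using assms(1) by simp
  have N3: "\<not> 3 dvd int N" using assms(2) by presburger
  interpret koch_surface "int N" F K \<mu>
    unfolding koch_surface_def koch_scale_def koch_surface_axioms_def nat_int
    by (intro conjI) (fact N4 N3 assms)+
  have s: "sN = ln (real N^2 + 2) / ln (real N)"
    unfolding sN_def M_pos(2) by simp
  show ?thesis
    using hausdorff_bounds[of n] unfolding s nat_int by simp
qed

end
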